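(* Let $\mathcal Z=\{x\in U(sl_3)\mid [x,H_1]=[x,H_2]=0\}$ be the centralizer of the Cartan subalgebra in $U(sl_3)$. Then $\mathcal Z$ is isomorphic (each generator corresponding to the element of $U(sl_3)$ of the same name) to the algebra generated by $J,\overline J,K$ and central elements $H_1,H_2,C_2,C_3$ with the defining relations $$K=[J,\overline J],\qquad [J,K]=2J^2+2\{J,\overline J\}-aJ+b^+,\qquad [K,\overline J]=2\overline J^2+2\{J,\overline J\}-a\overline J+b^-,$$ and $$\begin{aligned}&2\{J^2,\overline J\}+2\{J,\overline J^2\}-K^2-4(J+\overline J)^2-a\{J,\overline J\}+2(b^-+a)J+2(b^++a)\overline J\\ &=\tfrac12(y^2+h^2)^2(1-C_2)-\tfrac18(h^2-y^2)^3+2h^2y^2-\Big(\tfrac{C_3}{3}+2y+yC_2\Big)\Big(\tfrac{C_3}{3}+2y+yC_2-C_2\Big)\\ &\quad-\tfrac y6(3h^2-11y^2)(3C_2-2C_3)+\tfrac{C_2}{8}(h^2+3y^2)(5h^2-y^2+4),\end{aligned}$$ where $h=H_2$, $y=\frac13(2H_1+H_2)$, $a=h^2+3y^2+C_2$ and $$b^{\pm}=(3y\mp h)\left(\frac{(2-y\mp h)C_2}{4}-\frac{C_3}{3}+\frac{(y-2\pm h)(y+2\pm h)(y\pm h)}{8}\right).$$ A basis of $\mathcal Z$ is given by the set $$\{H_1^{\alpha}H_2^{\beta}C_2^{c}C_3^{d}J^i\,\overline J^{\,j}K^k\ \mid\ \alpha,\beta,c,d,i,j\ge0,\ k\in\{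0,1\}\}.$$
   Context: $sl_3$ is the complex Lie algebra of traceless $3\times3$ matrices, $e_{ij}=E_{ij}-\frac{\delta_{ij}}3I$ ($E_{ij}$ matrix units), and $U(sl_3)$ is its universal enveloping algebra; all algebras are unital associative over $\mathbb C$. $[A,B]=AB-BA$, $\{A,B\}=AB+BA$. In $U(sl_3)$: $H_1=\frac12(e_{11}-e_{22})$, $H_2=\frac12(e_{22}-e_{33})$, $C_2=\sum_{i,j=1}^3e_{ij}e_{ji}$, $C_3=\sum_{i,j,k=1}^3e_{ij}e_{jk}e_{ki}$, $J=\frac{(e_{11}-e_{22})^2+2(e_{11}-e_{22})}{4}+e_{21}e_{12}$, $\overline J=\frac{(e_{11}-e_{33})^2+2(e_{11}-e_{33})}{4}+e_{31}e_{13}$, $K=[J,\overline J]=e_{31}e_{12}e_{23}-e_{32}e_{21}e_{13}$. The elements $h,y$ correspond to $h=\frac12(e_{22}-e_{33})$ and $y=\frac16(2e_{11}-e_{22}-e_{33})$ in $U(sl_3)$. *)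

theory Defs
  imports "HOL-Analysis.Analysis" "HOL-Library.Poly_Mapping"
begin

section \<open>Unital associative algebras over the complex numbers\<close>

class complex_algebra_1 = ring_1 +
  fixes scaleC :: "complex \<Rightarrow> 'a \<Rightarrow> 'a"  (infixr \<open>*\<^sub>C\<close> 75)
  assumes scaleC_add_right: "c *\<^sub>C (x + y) = c *\<^sub>C x + c *\<^sub>C y"
    and scaleC_add_left: "(c + d) *\<^sub>C x = c *\<^sub>C x + d *\<^sub>C x"
    and scaleC_scaleC: "c *\<^sub>C d *\<^sub>C x = (c * d) *\<^sub>C x"
    and scaleC_one: "1 *\<^sub>C x = x"
    and mult_scaleC_left: "c *\<^sub>C x * y = c *\<^sub>C (x * y)"
    and mult_scaleC_right: "x * c *\<^sub>C y = c *\<^sub>C (x * y)"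

interpretation complex_vector: vector_space "scaleC :: complex \<Rightarrow> 'a \<Rightarrow> 'a::complex_algebra_1"
  by unfold_locales (rule scaleC_add_right scaleC_add_left scaleC_scaleC scaleC_one)+

definition complex_algebra_hom :: "('a::complex_algebra_1 \<Rightarrow> 'b::complex_algebra_1) \<Rightarrow> bool"
  where "complex_algebra_hom f \<longleftrightarrow>
    (\<forall>x y. f (x + y) = f x + f y) \<and> (\<forall>c x. f (c *\<^sub>C x) = c *\<^sub>C f x) \<and>
    (\<forall>x y. f (x * y) = f x * f y) \<and> f 1 = 1"

definition commutator :: "'a::ring_1 \<Rightarrow> 'a \<Rightarrow> 'a"
  where "commutator x y = x * y - y * x"

definition anticommutator :: "'a::ring_1 \<Rightarrow> 'a \<Rightarrow> 'a"
  where "anticommutator x y = x * y + y * x"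

instantiation complex :: complex_algebra_1
begin
definition scaleC_complex :: "complex \<Rightarrow> complex \<Rightarrow> complex"
  where "scaleC_complex c x = c * x"
instance
  by standard (simp_all add: scaleC_complex_def algebra_simps)
end


section \<open>Free algebras\<close>

text \<open>The free algebra on a type of generators is the monoid algebra of the free monoid; the
  convolution product on \<^typ>\<open>'m \<Rightarrow>\<^sub>0 'k\<close> is provided by the library for any \<^class>\<open>monoid_add\<close>,
  so that concatenation of words is written additively.\<close>

datatype 'a free_monoid = Word "'a list"

instantiation free_monoid :: (type) monoid_add
begin
definition zero_free_monoid :: "'a free_monoid"
  where "zero_free_monoid = Word []"
fun plus_free_monoid :: "'a free_monoid \<Rightarrow> 'a free_monoid \<Rightarrow> 'a free_monoid"
  where "plus_free_monoid (Word xs) (Word ys) = Word (xs @ ys)"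
instance
proof
  fix a b c :: "'a free_monoid"
  show "a + b + c = a + (b + c)" by (cases a; cases b; cases c) simp
  show "0 + a = a" "a + 0 = a" by (cases a; simp add: zero_free_monoid_def)+
qed
end

lemma poly_mapping_single_sum_induct [case_names zero single sum]:
  fixes P :: "('a \<Rightarrow>\<^sub>0 'b::monoid_add) \<Rightarrow> bool"
  assumes "P 0" "\<And>k v. P (Poly_Mapping.single k v)" "\<And>f g. P f \<Longrightarrow> P g \<Longrightarrow> P (f + g)"
  shows "P p"
proof (induction p rule: Poly_Mapping.update_induct)
  case (update f a b)
  have "Poly_Mapping.update a b f = f + Poly_Mapping.single a b"
    using update.hyps(1)
    by (intro poly_mapping_eqI) (auto simp: lookup_update lookup_add lookup_single in_keys_iff)
  then show ?case
    using assms(2,3) update.IH by simp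
qed (fact assms(1))

instantiation poly_mapping :: (monoid_add, complex_algebra_1) complex_algebra_1
begin

definition scaleC_poly_mapping :: "complex \<Rightarrow> ('a \<Rightarrow>\<^sub>0 'b) \<Rightarrow> 'a \<Rightarrow>\<^sub>0 'b"
  where "scaleC_poly_mapping c p = Poly_Mapping.single 0 (c *\<^sub>C 1) * p"

instance
proof
  fix c d :: complex and x y :: "'a \<Rightarrow>\<^sub>0 'b"
  have central: "Poly_Mapping.single 0 (c *\<^sub>C 1) * p = p * Poly_Mapping.single 0 (c *\<^sub>C 1)"
    for p :: "'a \<Rightarrow>\<^sub>0 'b"
  proof (induction p rule: poly_mapping_single_sum_induct)
    case zero
    show ?case by simp
  next
    case (single k v)
    then show ?case
      by (simp add: mult_single mult_scaleC_left mult_scaleC_right)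
  next
    case (sum f g)
    then show ?case
      by (simp add: algebra_simps)
  qed
  show "c *\<^sub>C (x + y) = c *\<^sub>C x + c *\<^sub>C y"
    by (simp add: scaleC_poly_mapping_def algebra_simps)
  show "(c + d) *\<^sub>C x = c *\<^sub>C x + d *\<^sub>C x"
    by (simp add: scaleC_poly_mapping_def scaleC_add_left single_add algebra_simps)
  show "c *\<^sub>C d *\<^sub>C x = (c * d) *\<^sub>C x"
    by (simp add: scaleC_poly_mapping_def mult.assoc [symmetric] mult_single mult_scaleC_left
        scaleC_scaleC)
  show "1 *\<^sub>C x = x"
    by (simp add: scaleC_poly_mapping_def scaleC_one)
  show "c *\<^sub>C x * y = c *\<^sub>C (x * y)"
    by (simp add: scaleC_poly_mapping_def mult.assoc)
  show "x * c *\<^sub>C y = c *\<^sub>C (x * y)"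
    unfolding scaleC_poly_mapping_def by (subst (1 2) mult.assoc [symmetric]) (simp only: central)
qed

end

type_synonym 'a free_algebra = "'a free_monoid \<Rightarrow>\<^sub>0 complex"

definition free_gen :: "'a \<Rightarrow> 'a free_algebra"
  where "free_gen x = Poly_Mapping.single (Word [x]) 1"


section \<open>Algebras given by generators and relations\<close>

inductive_set two_sided_ideal :: "'a::ring_1 set \<Rightarrow> 'a set" for S where
  zero: "0 \<in> two_sided_ideal S"
| base: "x \<in> S \<Longrightarrow> x \<in> two_sided_ideal S"
| add: "x \<in> two_sided_ideal S \<Longrightarrow> y \<in> two_sided_ideal S \<Longrightarrow> x + y \<in> two_sided_ideal S"
| left: "x \<in> two_sided_ideal S \<Longrightarrow> r * x \<in> two_sided_ideal S"
| right: "x \<in> two_sided_ideal S \<Longrightarrow> x * r \<in> two_sided_ideal S"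

lemma two_sided_ideal_uminus: "x \<in> two_sided_ideal S \<Longrightarrow> - x \<in> two_sided_ideal S"
  using two_sided_ideal.left [of x S "- 1"] by simp

definition const_coeff :: "'a free_algebra \<Rightarrow> complex"
  where "const_coeff p = Poly_Mapping.lookup p 0"

lemma free_monoid_add_eq_0_iff: "(k::'a free_monoid) + l = 0 \<longleftrightarrow> k = 0 \<and> l = 0"
  by (cases k; cases l) (simp add: zero_free_monoid_def)

lemma const_coeff_simps [simp]:
  "const_coeff 0 = 0"
  "const_coeff 1 = 1"
  "const_coeff (p + q) = const_coeff p + const_coeff q"
  "const_coeff (p - q) = const_coeff p - const_coeff q"
  "const_coeff (- p) = - const_coeff p"
  "const_coeff (free_gen x) = 0"
  by (simp_all add: const_coeff_def lookup_add lookup_minus lookup_one free_gen_def lookup_single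
      zero_free_monoid_def)

lemma const_coeff_mult [simp]: "const_coeff (p * q) = const_coeff p * const_coeff q"
proof (induction p rule: poly_mapping_single_sum_induct)
  case (single k v)
  show ?case
  proof (induction q rule: poly_mapping_single_sum_induct)
    case (single l w)
    show ?case
      by (auto simp: const_coeff_def mult_single lookup_single when_def free_monoid_add_eq_0_iff)
  qed (simp_all only: const_coeff_simps mult_zero_right distrib_left)
qed (simp_all only: const_coeff_simps mult_zero_left distrib_right)

lemma const_coeff_scaleC [simp]: "const_coeff (c *\<^sub>C p) = c * const_coeff p"
  by (simp add: scaleC_poly_mapping_def) (simp add: const_coeff_def scaleC_complex_def)

lemma const_coeff_power [simp]: "const_coeff (p ^ n) = const_coeff p ^ n"
  by (induction n) simp_all

text \<open>A type of class \<open>presentation\<close> is a set of generators together with a set of relators;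
  a relation \<open>l = r\<close> is encoded by the relator \<open>l - r\<close>.
  Relators must have vanishing constant term: the library requires \<open>0 \<noteq> 1\<close> in \<^class>\<open>ring_1\<close>, and
  this condition, which holds for the presentations below, ensures that the quotient is nonzero.\<close>

class presentation =
  fixes relators :: "'a free_algebra set"
  assumes const_coeff_relator: "r \<in> relators \<Longrightarrow> const_coeff r = 0"

lemma const_coeff_ideal: "x \<in> two_sided_ideal relators \<Longrightarrow> const_coeff x = 0"
  by (induction rule: two_sided_ideal.induct) (simp_all add: const_coeff_relator)

definition rel_cong :: "'a::presentation free_algebra \<Rightarrow> 'a free_algebra \<Rightarrow> bool"
  where "rel_cong x y \<longleftrightarrow> x - y \<in> two_sided_ideal relators"

lemma equivp_rel_cong:
  "equivp (rel_cong :: 'a::presentation free_algebra \<Rightarrow> 'a free_algebra \<Rightarrow> bool)"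
proof (rule equivpI)
  show "reflp (rel_cong :: 'a free_algebra \<Rightarrow> 'a free_algebra \<Rightarrow> bool)"
    by (simp add: reflp_def rel_cong_def two_sided_ideal.zero)
  show "symp (rel_cong :: 'a free_algebra \<Rightarrow> 'a free_algebra \<Rightarrow> bool)"
  proof (rule sympI)
    fix x y :: "'a free_algebra"
    assume "rel_cong x y"
    then have "- (x - y) \<in> two_sided_ideal relators"
      unfolding rel_cong_def by (rule two_sided_ideal_uminus)
    then show "rel_cong y x"
      unfolding rel_cong_def by (simp only: minus_diff_eq)
  qed
  show "transp (rel_cong :: 'a free_algebra \<Rightarrow> 'a free_algebra \<Rightarrow> bool)"
  proof (rule transpI)
    fix x y z :: "'a free_algebra"
    assume "rel_cong x y" "rel_cong y z"
    then have "(x - y) + (y - z) \<in> two_sided_ideal relators"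
      unfolding rel_cong_def by (rule two_sided_ideal.add)
    then show "rel_cong x z"
      unfolding rel_cong_def by simp
  qed
qed

quotient_type (overloaded) 'a presented_algebra = "'a::presentation free_algebra" / rel_cong
  by (rule equivp_rel_cong)

instantiation presented_algebra :: (presentation) complex_algebra_1
begin

lift_definition zero_presented_algebra :: "'a presented_algebra" is 0 .
lift_definition one_presented_algebra :: "'a presented_algebra" is 1 .

lift_definition plus_presented_algebra ::
  "'a presented_algebra \<Rightarrow> 'a presented_algebra \<Rightarrow> 'a presented_algebra" is "(+)"
proof -
  fix a b c d :: "'a free_algebra"
  assume "rel_cong a b" "rel_cong c d"
  then have "(a - b) + (c - d) \<in> two_sided_ideal relators"
    unfolding rel_cong_def by (rule two_sided_ideal.add)
  then show "rel_cong (a + c) (b + d)"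
    unfolding rel_cong_def by (simp only: add_diff_add)
qed

lift_definition uminus_presented_algebra ::
  "'a presented_algebra \<Rightarrow> 'a presented_algebra" is uminus
proof -
  fix a b :: "'a free_algebra"
  assume "rel_cong a b"
  then have "- (a - b) \<in> two_sided_ideal relators"
    unfolding rel_cong_def by (rule two_sided_ideal_uminus)
  then show "rel_cong (- a) (- b)"
    unfolding rel_cong_def by (simp only: minus_diff_minus)
qed

lift_definition minus_presented_algebra ::
  "'a presented_algebra \<Rightarrow> 'a presented_algebra \<Rightarrow> 'a presented_algebra" is "(-)"
proof -
  fix a b c d :: "'a free_algebra"
  assume "rel_cong a b" "rel_cong c d"
  then have "(a - b) + - (c - d) \<in> two_sided_ideal relators"
    unfolding rel_cong_def by (intro two_sided_ideal.add two_sided_ideal_uminus)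
  then show "rel_cong (a - c) (b - d)"
    unfolding rel_cong_def by (simp add: algebra_simps)
qed

lift_definition times_presented_algebra ::
  "'a presented_algebra \<Rightarrow> 'a presented_algebra \<Rightarrow> 'a presented_algebra" is "(*)"
proof -
  fix a b c d :: "'a free_algebra"
  assume "rel_cong a b" "rel_cong c d"
  then have "(a - b) * c + b * (c - d) \<in> two_sided_ideal relators"
    unfolding rel_cong_def
    by (intro two_sided_ideal.add two_sided_ideal.left two_sided_ideal.right)
  then show "rel_cong (a * c) (b * d)"
    unfolding rel_cong_def by (simp add: algebra_simps)
qed

lift_definition scaleC_presented_algebra ::
  "complex \<Rightarrow> 'a presented_algebra \<Rightarrow> 'a presented_algebra" is scaleC
proof -
  fix c :: complex and a b :: "'a free_algebra"
  assume "rel_cong a b"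
  then have "(c *\<^sub>C 1) * (a - b) \<in> two_sided_ideal relators"
    unfolding rel_cong_def by (rule two_sided_ideal.left)
  then show "rel_cong (c *\<^sub>C a) (c *\<^sub>C b)"
    unfolding rel_cong_def
    by (simp add: mult_scaleC_left complex_vector.scale_right_diff_distrib)
qed

instance
proof
  fix a b c :: "'a presented_algebra" and k l :: complex
  note refl = equivp_reflp [OF equivp_rel_cong]
  show "a + b + c = a + (b + c)" by transfer (simp add: refl add.assoc)
  show "a + b = b + a" by transfer (simp add: refl add.commute)
  show "0 + a = a" by transfer (simp add: refl)
  show "- a + a = 0" by transfer (simp add: refl)
  show "a - b = a + - b" by transfer (simp add: refl)
  show "a * b * c = a * (b * c)" by transfer (simp add: refl mult.assoc)
  show "1 * a = a" "a * 1 = a" by (transfer, simp add: refl)+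
  show "(a + b) * c = a * c + b * c" by transfer (simp add: refl distrib_right)
  show "a * (b + c) = a * b + a * c" by transfer (simp add: refl distrib_left)
  show "(0::'a presented_algebra) \<noteq> 1"
  proof (transfer, rule notI)
    assume "rel_cong 0 (1 :: 'a free_algebra)"
    from const_coeff_ideal [OF this [unfolded rel_cong_def]] show False
      by simp
  qed
  show "k *\<^sub>C (a + b) = k *\<^sub>C a + k *\<^sub>C b" by transfer (simp add: refl scaleC_add_right)
  show "(k + l) *\<^sub>C a = k *\<^sub>C a + l *\<^sub>C a" by transfer (simp add: refl scaleC_add_left)
  show "k *\<^sub>C l *\<^sub>C a = (k * l) *\<^sub>C a" by transfer (simp add: refl scaleC_scaleC)
  show "1 *\<^sub>C a = a" by transfer (simp add: refl scaleC_one)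
  show "k *\<^sub>C a * b = k *\<^sub>C (a * b)" by transfer (simp add: refl mult_scaleC_left)
  show "a * k *\<^sub>C b = k *\<^sub>C (a * b)" by transfer (simp add: refl mult_scaleC_right)
qed

end

lift_definition gen :: "'a::presentation \<Rightarrow> 'a presented_algebra" is free_gen .


section \<open>The universal enveloping algebra of $sl_3$\<close>

typedef sl3 = "{A :: complex^3^3. trace A = 0}"
  by (rule exI [of _ 0]) (simp add: trace_def)

setup_lifting type_definition_sl3

lift_definition sl3_add :: "sl3 \<Rightarrow> sl3 \<Rightarrow> sl3" is "(+)"
  by (simp add: trace_add)

lift_definition sl3_scale :: "complex \<Rightarrow> sl3 \<Rightarrow> sl3" is "\<lambda>c A. \<chi> i j. c * A $ i $ j"
  by (simp add: trace_def sum_distrib_left [symmetric])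

lift_definition sl3_bracket :: "sl3 \<Rightarrow> sl3 \<Rightarrow> sl3" is "\<lambda>A B. A ** B - B ** A"
  by (subst trace_sub, subst trace_mul_sym, simp)

lift_definition sl3_e :: "3 \<Rightarrow> 3 \<Rightarrow> sl3"
  is "\<lambda>i j. \<chi> k l. (if k = i \<and> l = j then 1 else 0) - (if i = j \<and> k = l then 1 / 3 else 0)"
proof -
  fix i j :: 3
  show "trace (\<chi> k l. (if k = i \<and> l = j then 1 else 0) -
      (if i = j \<and> k = l then 1 / 3 else (0::complex))) = 0"
    by (cases "i = j") (auto simp: trace_def sum_subtractf intro!: sum.neutral)
qed

instantiation sl3 :: presentation
begin
definition relators_sl3 :: "sl3 free_algebra set" where
  "relators_sl3 =
    {free_gen (sl3_add A B) - (free_gen A + free_gen B) | A B. True} \<union>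
    {free_gen (sl3_scale c A) - c *\<^sub>C free_gen A | c A. True} \<union>
    {free_gen (sl3_bracket A B) - commutator (free_gen A) (free_gen B) | A B. True}"
instance
  by standard (unfold relators_sl3_def commutator_def, elim UnE, auto)
end

text \<open>The tensor algebra of the vector space $sl_3$ is the free algebra on the set $sl_3$ modulo
  linearity of the generators, so that this is its quotient by $[A, B] - (A \otimes B - B \otimes A)$.\<close>

type_synonym U_sl3 = "sl3 presented_algebra"

definition U_e :: "3 \<Rightarrow> 3 \<Rightarrow> U_sl3"
  where "U_e i j = gen (sl3_e i j)"

definition U_H1 :: U_sl3 where "U_H1 = (1/2) *\<^sub>C (U_e 1 1 - U_e 2 2)"
definition U_H2 :: U_sl3 where "U_H2 = (1/2) *\<^sub>C (U_e 2 2 - U_e 3 3)"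
definition U_C2 :: U_sl3 where "U_C2 = (\<Sum>i\<in>UNIV. \<Sum>j\<in>UNIV. U_e i j * U_e j i)"
definition U_C3 :: U_sl3
  where "U_C3 = (\<Sum>i\<in>UNIV. \<Sum>j\<in>UNIV. \<Sum>k\<in>UNIV. U_e i j * U_e j k * U_e k i)"
definition U_J :: U_sl3
  where "U_J = (1/4) *\<^sub>C ((U_e 1 1 - U_e 2 2)^2 + 2 * (U_e 1 1 - U_e 2 2)) + U_e 2 1 * U_e 1 2"
definition U_Jbar :: U_sl3
  where "U_Jbar = (1/4) *\<^sub>C ((U_e 1 1 - U_e 3 3)^2 + 2 * (U_e 1 1 - U_e 3 3)) + U_e 3 1 * U_e 1 3"
definition U_K :: U_sl3 where "U_K = commutator U_J U_Jbar"

definition cartan_centralizer :: "U_sl3 set"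
  where "cartan_centralizer = {x. commutator x U_H1 = 0 \<and> commutator x U_H2 = 0}"


section \<open>The algebra given by the defining relations\<close>

datatype zgen = GH1 | GH2 | GC2 | GC3 | GJ | GJbar | GK

abbreviation "z_H1 \<equiv> free_gen GH1"
abbreviation "z_H2 \<equiv> free_gen GH2"
abbreviation "z_C2 \<equiv> free_gen GC2"
abbreviation "z_C3 \<equiv> free_gen GC3"
abbreviation "z_J \<equiv> free_gen GJ"
abbreviation "z_Jbar \<equiv> free_gen GJbar"
abbreviation "z_K \<equiv> free_gen GK"

definition z_h :: "zgen free_algebra" where "z_h = z_H2"
definition z_y :: "zgen free_algebra" where "z_y = (1/3) *\<^sub>C (2 * z_H1 + z_H2)"
definition z_a :: "zgen free_algebra" where "z_a = z_h^2 + 3 * z_y^2 + z_C2"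

definition z_b_plus :: "zgen free_algebra" where
  "z_b_plus = (3 * z_y - z_h) *
    ((1/4) *\<^sub>C ((2 - z_y - z_h) * z_C2) - (1/3) *\<^sub>C z_C3
      + (1/8) *\<^sub>C ((z_y - 2 + z_h) * (z_y + 2 + z_h) * (z_y + z_h)))"

definition z_b_minus :: "zgen free_algebra" where
  "z_b_minus = (3 * z_y + z_h) *
    ((1/4) *\<^sub>C ((2 - z_y + z_h) * z_C2) - (1/3) *\<^sub>C z_C3
      + (1/8) *\<^sub>C ((z_y - 2 - z_h) * (z_y + 2 - z_h) * (z_y - z_h)))"

definition z_cubic_lhs :: "zgen free_algebra" where
  "z_cubic_lhs =
    2 * anticommutator (z_J^2) z_Jbar + 2 * anticommutator z_J (z_Jbar^2) - z_K^2 - 4 * (z_J + z_Jbar)^2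
    - z_a * anticommutator z_J z_Jbar + 2 * (z_b_minus + z_a) * z_J + 2 * (z_b_plus + z_a) * z_Jbar"

definition z_cubic_rhs :: "zgen free_algebra" where
  "z_cubic_rhs =
    (1/2) *\<^sub>C ((z_y^2 + z_h^2)^2 * (1 - z_C2)) - (1/8) *\<^sub>C (z_h^2 - z_y^2)^3 + 2 * z_h^2 * z_y^2
    - ((1/3) *\<^sub>C z_C3 + 2 * z_y + z_y * z_C2) * ((1/3) *\<^sub>C z_C3 + 2 * z_y + z_y * z_C2 - z_C2)
    - (1/6) *\<^sub>C (z_y * (3 * z_h^2 - 11 * z_y^2) * (3 * z_C2 - 2 * z_C3))
    + (1/8) *\<^sub>C (z_C2 * (z_h^2 + 3 * z_y^2) * (5 * z_h^2 - z_y^2 + 4))"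

instantiation zgen :: presentation
begin
definition relators_zgen :: "zgen free_algebra set" where
  "relators_zgen =
    {commutator (free_gen z) (free_gen g) | z g. z \<in> {GH1, GH2, GC2, GC3}} \<union>
    {z_K - commutator z_J z_Jbar,
     commutator z_J z_K - (2 * z_J^2 + 2 * anticommutator z_J z_Jbar - z_a * z_J + z_b_plus),
     commutator z_K z_Jbar - (2 * z_Jbar^2 + 2 * anticommutator z_J z_Jbar - z_a * z_Jbar + z_b_minus),
     z_cubic_lhs - z_cubic_rhs}"
instance
proof
  have "const_coeff z_h = 0" "const_coeff z_y = 0"
    by (simp_all add: z_h_def z_y_def)
  then have "const_coeff z_b_plus = 0" "const_coeff z_b_minus = 0" "const_coeff z_a = 0"
    "const_coeff z_cubic_rhs = 0"
    by (simp_all add: z_b_plus_def z_b_minus_def z_a_def z_cubic_rhs_def)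
  then have "const_coeff z_cubic_lhs = 0" and *: "const_coeff z_cubic_rhs = 0"
    and **: "const_coeff z_b_plus = 0" "const_coeff z_b_minus = 0"
    by (simp_all add: z_cubic_lhs_def anticommutator_def)
  then show "const_coeff r = 0" if "r \<in> relators" for r :: "zgen free_algebra"
    using that
    unfolding relators_zgen_def commutator_def anticommutator_def by (elim UnE insertE) auto
qed
end

type_synonym Z_algebra = "zgen presented_algebra"

definition basis_exponents :: "(nat \<times> nat \<times> nat \<times> nat \<times> nat \<times> nat \<times> nat) set"
  where "basis_exponents = {(\<alpha>, \<beta>, c, d, i, j, k). k \<in> {0, 1}}"

fun basis_monomial :: "nat \<times> nat \<times> nat \<times> nat \<times> nat \<times> nat \<times> nat \<Rightarrow> U_sl3"
  where "basis_monomial (\<alpha>, \<beta>, c, d, i, j, k) =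
    U_H1^\<alpha> * U_H2^\<beta> * U_C2^c * U_C3^d * U_J^i * U_Jbar^j * U_K^k"

end

theory Submission
  imports Defs
begin

text \<open>The defining relations are identities in the enveloping algebra and are checked by rewriting
  both sides to Poincare--Birkhoff--Witt normal form. Modulo words of smaller degree the generators
  of the presented algebra commute, and the cubic relation eliminates \<open>K\<^sup>2\<close>, so the presented
  algebra is spanned by the monomials. An element of the centralizer is a combination of words of
  weight zero; such a word reduces, up to shorter words of weight zero, to a product of Cartan
  elements, \<open>e\<^sub>i\<^sub>j e\<^sub>j\<^sub>i\<close>, \<open>e\<^sub>3\<^sub>1 e\<^sub>1\<^sub>2 e\<^sub>2\<^sub>3\<close> and \<open>e\<^sub>3\<^sub>2 e\<^sub>2\<^sub>1 e\<^sub>1\<^sub>3\<close>, all of which are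
  obtained from the generators. Finally, the monomials are independent because of their action on
  the weight spaces of generic Gelfand--Tsetlin modules: there the Cartan elements, \<open>C\<^sub>2\<close> and \<open>C\<^sub>3\<close>
  act by arbitrary scalars, \<open>J\<close> is diagonal with eigenvalues \<open>(t\<^sup>2 - 1) / 4\<close> and \<open>Jbar\<close> is
  tridiagonal, so that the coefficient of the longest shift is a combination of polynomials in \<open>t\<close>
  of pairwise distinct degrees.\<close>

section \<open>Normal forms in algebras with straightening rules\<close>

text \<open>One independence statement settles two claims. The monomials span the presented algebra,
  so as soon as their images in \<open>U_sl3\<close> are independent the map is injective, that is,
  the listed relations are complete. Normal forms work in one direction only, as proofs of equality:
  a difference that rewrites to zero is zero, by the commutation rules alone. Telling elements apart
  is the task of the modules. For this the scalars of the four commuting elements and t have to vary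
  independently over infinite sets, which is why patterns with complex entries (x, y, z) are taken,
  restricted only by x - y not being an integer, and x - z as well in the final evaluation. In the
  centralizer the obstacle is that words in the matrix units are dependent, so the weights of the
  words in an expression of an element cannot be read off from the element; a polynomial in the
  adjoint action of H1 + i H2 cuts out the part of weight zero. Shorter words are tracked together
  with their weight, so that the corrections made when a word of weight zero is reordered have
  weight zero again and induction applies to them.\<close>

type_synonym npoly = "(int \<times> nat list) list"

fun word_less :: "nat list \<Rightarrow> nat list \<Rightarrow> bool" where
  "word_less [] [] = False"
| "word_less [] (b # w) = True"
| "word_less (a # v) [] = False"
| "word_less (a # v) (b # w) = (a < b \<or> a = b \<and> word_less v w)"

text \<open>A merge for lists sorted by \<open>word_less\<close>. Its value is right for arbitrary
  lists; sortedness only makes equal words meet, so that they cancel.\<close>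

fun np_add :: "npoly \<Rightarrow> npoly \<Rightarrow> npoly" where
  "np_add [] q = q"
| "np_add (s # p) [] = s # p"
| "np_add ((c, v) # p) ((d, w) # q) =
    (if v = w then (if c + d = 0 then np_add p q else (c + d, v) # np_add p q)
     else if word_less v w then (c, v) # np_add p ((d, w) # q)
     else (d, w) # np_add ((c, v) # p) q)"

definition np_scale :: "int \<Rightarrow> npoly \<Rightarrow> npoly"
  where "np_scale c p = map (\<lambda>(d, w). (c * d, w)) p"

fun np_bind :: "npoly \<Rightarrow> (nat list \<Rightarrow> npoly) \<Rightarrow> npoly" where
  "np_bind [] f = []"
| "np_bind ((c, w) # p) f = np_add (np_scale c (f w)) (np_bind p f)"

fun np_inserts :: "(nat list \<Rightarrow> nat \<Rightarrow> npoly) \<Rightarrow> npoly \<Rightarrow> nat list \<Rightarrow> npoly" where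
  "np_inserts f p [] = p"
| "np_inserts f p (l # v) = np_bind (np_inserts f p v) (\<lambda>w. f w l)"

text \<open>Words are stored in reverse, so that appending a letter on the right is a \<open>Cons\<close>. The first
  number bounds the recursion depth; when it is exhausted the result is merely not sorted.\<close>

primrec np_insert :: "(nat \<Rightarrow> nat \<Rightarrow> npoly) \<Rightarrow> nat \<Rightarrow> nat list \<Rightarrow> nat \<Rightarrow> npoly" where
  "np_insert br 0 w l = [(1, l # w)]"
| "np_insert br (Suc n) w l =
    (case w of [] \<Rightarrow> [(1, [l])]
     | a # w' \<Rightarrow> if a \<le> l then [(1, l # w)]
        else np_add (np_bind (np_insert br n w' l) (\<lambda>v. np_insert br n v a))
                    (np_bind (br a l) (\<lambda>v. np_inserts (np_insert br n) [(1, w')] v)))"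

section \<open>Expressions and the computation of their normal forms\<close>

datatype nexp = NVar nat | NConst int
  | NAdd nexp nexp (infixl \<open>\<oplus>\<close> 65) | NSub nexp nexp (infixl \<open>\<ominus>\<close> 65)
  | NMul nexp nexp (infixl \<open>\<odot>\<close> 70) | NDiv nexp int (infixl \<open>\<oslash>\<close> 70)

definition frac_add :: "int \<times> npoly \<Rightarrow> int \<times> npoly \<Rightarrow> int \<times> npoly" where
  "frac_add s t = (case s of (d, p) \<Rightarrow> case t of (e, q) \<Rightarrow>
    let g = gcd d e; a = e div g; b = d div g in (d * a, np_add (np_scale a p) (np_scale b q)))"

text \<open>A pair \<open>(d, p)\<close> stands for the quotient of \<open>p\<close> by the common denominator \<open>d\<close>.\<close>

primrec nf :: "(nat \<Rightarrow> nat \<Rightarrow> npoly) \<Rightarrow> nat \<Rightarrow> nexp \<Rightarrow> int \<times> npoly" where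
  "nf br n (NVar i) = (1, [(1, [i])])"
| "nf br n (NConst c) = (1, if c = 0 then [] else [(c, [])])"
| "nf br n (s \<oplus> t) = frac_add (nf br n s) (nf br n t)"
| "nf br n (s \<ominus> t) = frac_add (nf br n s) (map_prod id (np_scale (- 1)) (nf br n t))"
| "nf br n (s \<odot> t) = (case nf br n s of (d, p) \<Rightarrow> case nf br n t of (e, q) \<Rightarrow>
    (d * e, np_bind q (\<lambda>v. np_inserts (np_insert br n) p v)))"
| "nf br n (s \<oslash> k) = (if k = 0 then (1, []) else map_prod ((*) k) id (nf br n s))"

primrec nexp_val :: "(nat \<Rightarrow> 'a::complex_algebra_1) \<Rightarrow> nexp \<Rightarrow> 'a" where
  "nexp_val x (NVar i) = x i"
| "nexp_val x (NConst c) = of_int c"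
| "nexp_val x (s \<oplus> t) = nexp_val x s + nexp_val x t"
| "nexp_val x (s \<ominus> t) = nexp_val x s - nexp_val x t"
| "nexp_val x (s \<odot> t) = nexp_val x s * nexp_val x t"
| "nexp_val x (s \<oslash> k) = (1 / of_int k) *\<^sub>C nexp_val x s"

primrec word_val :: "(nat \<Rightarrow> 'a::ring_1) \<Rightarrow> nat list \<Rightarrow> 'a" where
  "word_val x [] = 1"
| "word_val x (a # w) = word_val x w * x a"

definition np_val :: "(nat \<Rightarrow> 'a::ring_1) \<Rightarrow> npoly \<Rightarrow> 'a"
  where "np_val x p = (\<Sum>(c, w)\<leftarrow>p. of_int c * word_val x w)"

lemma of_int_eq_scaleC: "of_int n = of_int n *\<^sub>C (1::'a::complex_algebra_1)"
proof -
  have "of_nat n = of_nat n *\<^sub>C (1::'a)" for n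
    by (induction n) (simp_all add: scaleC_add_left scaleC_one)
  then show ?thesis
    by (cases n rule: int_cases2) simp_all
qed

lemma numeral_eq_scaleC: "numeral n = numeral n *\<^sub>C (1::'a::complex_algebra_1)"
  using of_int_eq_scaleC [of "numeral n"] by simp

lemma np_val_simps [simp]:
  "np_val x [] = 0"
  "np_val x ((c, w) # p) = of_int c * word_val x w + np_val x p"
  by (simp_all add: np_val_def)

lemma np_val_add [simp]: "np_val x (np_add p q) = np_val x p + np_val x q"
proof (induction p q rule: np_add.induct)
  case (3 c v p d w q)
  have "c + d = 0 \<Longrightarrow> of_int c * z + of_int d * z = (0 :: 'a)" for z
    by (metis distrib_right mult_zero_left of_int_0 of_int_add)
  with 3 show ?case
    by (auto simp: algebra_simps)
qed auto

lemma np_val_scale [simp]: "np_val x (np_scale c p) = of_int c * np_val x p"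
proof (induction p)
  case (Cons t p)
  have "of_int c * (of_int d * z) = of_int (c * d) * (z :: 'a)" for d z
    by (simp add: mult.assoc)
  with Cons show ?case
    by (cases t) (simp add: np_scale_def distrib_left mult.assoc)
qed (simp add: np_scale_def)

lemma np_val_bind:
  assumes "\<And>w. np_val x (f w) = word_val x w * z"
  shows "np_val x (np_bind p f) = np_val x p * z"
  by (induction p) (auto simp: assms algebra_simps)

lemma np_val_bind_left:
  assumes "\<And>w. np_val x (f w) = z * word_val x w"
  shows "np_val x (np_bind p f) = z * np_val x p"
proof (induction p)
  case (Cons t p)
  obtain c w where t: "t = (c, w)" by (cases t)
  have "of_int c * (z * word_val x w) = z * (of_int c * word_val x w)"
    by (metis mult.assoc mult_of_int_commute)
  with Cons show ?case by (simp add: t assms distrib_left)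
qed simp

lemma np_val_inserts:
  assumes "\<And>w l. np_val x (f w l) = word_val x w * x l"
  shows "np_val x (np_inserts f p v) = np_val x p * word_val x v"
proof (induction v)
  case (Cons l v)
  have "np_val x (np_bind (np_inserts f p v) (\<lambda>w. f w l)) = np_val x (np_inserts f p v) * x l"
    by (rule np_val_bind) (rule assms)
  with Cons show ?case by (simp add: mult.assoc)
qed simp

locale straightening =
  fixes x :: "nat \<Rightarrow> 'a::complex_algebra_1" and br :: "nat \<Rightarrow> nat \<Rightarrow> npoly"
  assumes straighten: "l < a \<Longrightarrow> x a * x l = x l * x a + np_val x (br a l)"
begin

text \<open>For l < a the word v a l is replaced by v l a plus v [a, l]. This is an identity at
  every depth, so the value is also right when the recursion bound stops the sorting early.\<close>

lemma np_val_insert: "np_val x (np_insert br n w l) = word_val x w * x l"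
proof (induction n arbitrary: w l)
  case (Suc n)
  show ?case
  proof (cases w)
    case (Cons a v)
    show ?thesis
    proof (cases "a \<le> l")
      case False
      have "np_val x (np_bind (np_insert br n v l) (\<lambda>v. np_insert br n v a)) =
          word_val x v * x l * x a"
        by (subst np_val_bind) (simp_all add: Suc)
      moreover have "np_val x (np_bind (br a l) (\<lambda>u. np_inserts (np_insert br n) [(1, v)] u)) =
          word_val x v * np_val x (br a l)"
        by (rule np_val_bind_left) (simp add: np_val_inserts Suc)
      ultimately show ?thesis
        using False straighten [of l a] by (simp add: Cons algebra_simps)
    qed (simp add: Cons)
  qed simp
qed simp

lemma np_val_frac_add:
  assumes "fst s \<noteq> 0" "fst t \<noteq> 0"
    and "of_int (fst s) * a = np_val x (snd s)" "of_int (fst t) * b = np_val x (snd t)"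
  shows "fst (frac_add s t) \<noteq> 0 \<and> of_int (fst (frac_add s t)) * (a + b) = np_val x (snd (frac_add s t))"
proof -
  obtain d p e q where st: "s = (d, p)" "t = (e, q)" by fastforce
  define g where "g = gcd d e"
  obtain k l where kl: "d = g * k" "e = g * l" using g_def by (metis dvdE gcd_dvd1 gcd_dvd2)
  then have g: "g \<noteq> 0" "k \<noteq> 0" "l \<noteq> 0" using assms st by auto
  then have kl': "d div g = k" "e div g = l" using kl by simp_all
  have "of_int (d * l) * (a + b) = of_int l * (of_int d * a) + of_int k * (of_int e * b)"
  proof -
    have "of_int (d * l) = (of_int l * of_int d :: 'a)" "of_int (d * l) = (of_int k * of_int e :: 'a)"
      unfolding of_int_mult [symmetric] by (rule arg_cong [of _ _ of_int], simp add: kl)+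
    then have "of_int (d * l) * a = of_int l * (of_int d * a)"
      "of_int (d * l) * b = of_int k * (of_int e * b)"
      by (metis mult.assoc)+
    then show ?thesis by (simp only: distrib_left)
  qed
  moreover have "frac_add s t = (d * l, np_add (np_scale l p) (np_scale k q))"
    by (simp add: st frac_add_def Let_def kl' g_def [symmetric])
  moreover have "d * l \<noteq> 0" using assms(1) g by (simp add: st)
  ultimately show ?thesis using assms(3,4) by (simp only: st fst_conv snd_conv np_val_add np_val_scale) simp
qed

text \<open>Clearing the denominator keeps all coefficients integral, hence computable; that it is
  nonzero allows the division afterwards.\<close>

lemma np_val_nf: "fst (nf br n t) \<noteq> 0 \<and> of_int (fst (nf br n t)) * nexp_val x t = np_val x (snd (nf br n t))"
proof (induction t)
  case (NAdd s t)
  then show ?case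
    using np_val_frac_add [of "nf br n s" "nf br n t" "nexp_val x s" "nexp_val x t"] by simp
next
  case (NSub s t)
  then show ?case
    using np_val_frac_add [of "nf br n s" "map_prod id (np_scale (- 1)) (nf br n t)" "nexp_val x s" "- nexp_val x t"]
    by simp
next
  case (NMul s t)
  obtain d p e q where st: "nf br n s = (d, p)" "nf br n t = (e, q)" by fastforce
  have "of_int (d * e) * (a * b) = (of_int d * a) * (of_int e * (b :: 'a))" for a b
    by (metis mult.assoc mult_of_int_commute of_int_mult)
  moreover have "np_val x (np_bind q (\<lambda>v. np_inserts (np_insert br n) p v)) = np_val x p * np_val x q"
    by (rule np_val_bind_left) (simp add: np_val_inserts np_val_insert)
  ultimately show ?case using NMul by (simp add: st)
next
  case (NDiv s k)
  have "of_int k * (of_int d * ((1 / of_int k) *\<^sub>C z)) = of_int d * (z :: 'a)" if "k \<noteq> 0" for d z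
  proof -
    have "of_int (k * d) * ((1 / of_int k) *\<^sub>C z) = of_int d * z"
      using that by (simp add: of_int_eq_scaleC [where 'a = 'a] mult_scaleC_left scaleC_scaleC
          del: of_int_mult) simp
    then show ?thesis by (simp add: mult.assoc)
  qed
  \<comment> \<open>For k = 0 both sides vanish: \<open>1 / 0 = 0\<close> on the side of
    \<open>nexp_val\<close>, and \<open>nf\<close> returns the empty list.\<close>
  with NDiv show ?case by (auto simp: mult.assoc)
qed simp_all

text \<open>The certificate behind every identity in the enveloping algebra that is proved by
  computation. Only this implication is claimed, so it does not matter whether normal forms are
  unique.\<close>

lemma nexp_val_eqI:
  assumes "snd (nf br n (s \<ominus> t)) = []"
  shows "nexp_val x s = nexp_val x t"
proof -
  define d where "d = fst (nf br n (s \<ominus> t))"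
  have "d \<noteq> 0" "of_int d * (nexp_val x s - nexp_val x t) = 0"
    using np_val_nf [of n "s \<ominus> t"] assms by (auto simp: d_def)
  then have "(1 / of_int d) *\<^sub>C (of_int d *\<^sub>C 1 * (nexp_val x s - nexp_val x t)) = 0"
    using of_int_eq_scaleC [of d, where 'a = 'a] by simp
  then show ?thesis
    using \<open>d \<noteq> 0\<close> by (simp add: mult_scaleC_left scaleC_scaleC scaleC_one)
qed

end

section \<open>Universal properties\<close>

lemma complex_algebra_hom_simps:
  assumes "complex_algebra_hom f"
  shows "f (x + y) = f x + f y" "f (c *\<^sub>C x) = c *\<^sub>C f x" "f (x * y) = f x * f y" "f 1 = 1"
    and "f 0 = 0" "f (- x) = - f x" "f (x - y) = f x - f y" "f (x ^ n) = f x ^ n"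
    and "f (numeral k) = numeral k"
proof -
  note hom = assms [unfolded complex_algebra_hom_def]
  show add: "f (x + y) = f x + f y" for x y using hom by blast
  show sc: "f (c *\<^sub>C x) = c *\<^sub>C f x" for c x using hom by blast
  show mult: "f (x * y) = f x * f y" for x y using hom by blast
  show one: "f 1 = 1" using hom by blast
  show zero: "f 0 = 0" using add [of 0 0] by simp
  show minus: "f (- x) = - f x" for x using add [of x "- x"] zero
    by (metis add.right_inverse neg_eq_iff_add_eq_0 minus_unique)
  show "f (x - y) = f x - f y" for x y
    using add [of x "- y"] minus by simp
  show "f (x ^ n) = f x ^ n" by (induction n) (simp_all add: one mult)
  have "f (of_nat n) = of_nat n" for n
    by (induction n) (simp_all add: zero one add)
  from this [of "numeral k"] show "f (numeral k) = numeral k" by simp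
qed

fun free_word_val :: "('a \<Rightarrow> 'b::ring_1) \<Rightarrow> 'a free_monoid \<Rightarrow> 'b"
  where "free_word_val f (Word w) = prod_list (map f w)"

lemma free_word_val_add: "free_word_val f (v + w) = free_word_val f v * free_word_val f w"
  by (cases v; cases w) simp

lemma free_word_val_0 [simp]: "free_word_val f 0 = 1"
  by (simp add: zero_free_monoid_def)

definition free_lift :: "('a \<Rightarrow> 'b::complex_algebra_1) \<Rightarrow> 'a free_algebra \<Rightarrow> 'b"
  where "free_lift f p = (\<Sum>w\<in>Poly_Mapping.keys p. Poly_Mapping.lookup p w *\<^sub>C free_word_val f w)"

lemma free_lift_superset:
  assumes "finite S" "Poly_Mapping.keys p \<subseteq> S"
  shows "free_lift f p = (\<Sum>w\<in>S. Poly_Mapping.lookup p w *\<^sub>C free_word_val f w)"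
  unfolding free_lift_def by (rule sum.mono_neutral_left) (use assms in \<open>auto simp: in_keys_iff\<close>)

lemma free_lift_single [simp]:
  "free_lift f (Poly_Mapping.single w c) = c *\<^sub>C free_word_val f w"
  by (subst free_lift_superset [of "{w}"]) auto

lemma free_lift_add: "free_lift f (p + q) = free_lift f p + free_lift f q"
proof -
  let ?S = "Poly_Mapping.keys p \<union> Poly_Mapping.keys q"
  have "free_lift f r = (\<Sum>w\<in>?S. Poly_Mapping.lookup r w *\<^sub>C free_word_val f w)"
    if "r \<in> {p, q, p + q}" for r
    using that Poly_Mapping.keys_add [of p q] by (intro free_lift_superset) auto
  then show ?thesis
    by (simp add: lookup_add scaleC_add_left sum.distrib)
qed

lemma free_lift_0 [simp]: "free_lift f 0 = 0"
  by (simp add: free_lift_def)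

lemma free_lift_mult: "free_lift f (p * q) = free_lift f p * free_lift f q"
proof (induction p rule: poly_mapping_single_sum_induct)
  case (single v c)
  show ?case
    by (induction q rule: poly_mapping_single_sum_induct)
      (simp_all add: mult_single free_word_val_add mult_scaleC_left mult_scaleC_right scaleC_scaleC
        mult.commute free_lift_add distrib_left)
qed (simp_all add: free_lift_add distrib_right)

lemma free_lift_hom: "complex_algebra_hom (free_lift f)"
  unfolding complex_algebra_hom_def
proof (intro conjI allI)
  show "free_lift f 1 = 1"
    using free_lift_single [of f 0 1] by (simp add: scaleC_one)
  show "free_lift f (c *\<^sub>C p) = c *\<^sub>C free_lift f p" for c p
    by (simp add: scaleC_poly_mapping_def free_lift_mult scaleC_complex_def mult_scaleC_left)
qed (rule free_lift_add free_lift_mult)+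

lemma free_lift_gen [simp]: "free_lift f (free_gen a) = f a"
  by (simp add: free_gen_def scaleC_one)

lemma ideal_kernel:
  assumes "complex_algebra_hom f" "\<And>r. r \<in> S \<Longrightarrow> f r = 0" "x \<in> two_sided_ideal S"
  shows "f x = 0"
  using assms(3)
  by (induction rule: two_sided_ideal.induct) (simp_all add: complex_algebra_hom_simps [OF assms(1)] assms(2))

definition presented_class :: "'a::presentation free_algebra \<Rightarrow> 'a presented_algebra"
  where "presented_class = abs_presented_algebra"

lemma presented_class_hom: "complex_algebra_hom presented_class"
  unfolding complex_algebra_hom_def presented_class_def
  by (simp add: plus_presented_algebra.abs_eq times_presented_algebra.abs_eq
      scaleC_presented_algebra.abs_eq one_presented_algebra_def)

lemma presented_class_gen: "presented_class (free_gen a) = gen a"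
  by (simp add: presented_class_def gen.abs_eq)

lemma presented_class_surj: "\<exists>p. x = presented_class p"
  unfolding presented_class_def by (metis Quotient_abs_rep Quotient_presented_algebra)

lemma presented_class_eq_iff:
  "presented_class p = presented_class q \<longleftrightarrow> p - q \<in> two_sided_ideal relators"
  unfolding presented_class_def presented_algebra.abs_eq_iff rel_cong_def ..

lemma presented_class_relator: "r \<in> relators \<Longrightarrow> presented_class r = 0"
  using presented_class_eq_iff [of r 0] complex_algebra_hom_simps(5) [OF presented_class_hom]
  by (simp add: two_sided_ideal.base)

lemma presented_lift_ex:
  fixes f :: "'a::presentation \<Rightarrow> 'b::complex_algebra_1"
  assumes "\<And>r. r \<in> relators \<Longrightarrow> free_lift f r = 0"
  obtains \<phi> where "complex_algebra_hom \<phi>" "\<And>a. \<phi> (gen a) = f a"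
proof -
  define \<phi> where "\<phi> x = free_lift f (rep_presented_algebra x)" for x
  have \<phi>: "\<phi> (presented_class p) = free_lift f p" for p
  proof -
    have "presented_class (rep_presented_algebra (presented_class p)) = presented_class p"
      unfolding presented_class_def by (metis Quotient_abs_rep Quotient_presented_algebra)
    then have "rep_presented_algebra (presented_class p) - p \<in> two_sided_ideal relators"
      by (simp add: presented_class_eq_iff)
    from ideal_kernel [OF free_lift_hom assms this] show ?thesis
      by (simp add: \<phi>_def complex_algebra_hom_simps [OF free_lift_hom])
  qed
  have "complex_algebra_hom \<phi>"
    unfolding complex_algebra_hom_def
  proof (intro conjI allI)
    fix x y :: "'a presented_algebra" and c
    obtain p q where "x = presented_class p" "y = presented_class q"
      using presented_class_surj by metis
    then show "\<phi> (x + y) = \<phi> x + \<phi> y" "\<phi> (c *\<^sub>C x) = c *\<^sub>C \<phi> x" "\<phi> (x * y) = \<phi> x * \<phi> y"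
      by (simp_all add: \<phi> complex_algebra_hom_simps [OF free_lift_hom]
          complex_algebra_hom_simps [OF presented_class_hom, symmetric])
    show "\<phi> 1 = 1"
      using \<phi> [of 1] by (simp add: complex_algebra_hom_simps [OF free_lift_hom]
          complex_algebra_hom_simps [OF presented_class_hom])
  qed
  moreover have "\<phi> (gen a) = f a" for a
    using \<phi> [of "free_gen a"] by (simp add: presented_class_gen)
  ultimately show ?thesis by (rule that)
qed

lemma presented_words_span:
  "(x :: 'a::presentation presented_algebra) \<in> complex_vector.span (range (\<lambda>w. prod_list (map gen w)))"
proof -
  let ?S = "complex_vector.span (range (\<lambda>w. prod_list (map gen w) :: 'a presented_algebra))"
  obtain p where x: "x = presented_class p" using presented_class_surj by blast
  have word: "presented_class (Poly_Mapping.single (Word w) 1) = prod_list (map gen w)"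
    for w :: "'a list"
  proof (induction w)
    case Nil
    show ?case
      using complex_algebra_hom_simps(4) [OF presented_class_hom]
      by (simp add: zero_free_monoid_def [symmetric])
  next
    case (Cons a w)
    have "Poly_Mapping.single (Word (a # w)) 1 = free_gen a * Poly_Mapping.single (Word w) (1::complex)"
      by (simp add: free_gen_def mult_single)
    then show ?case
      by (simp add: complex_algebra_hom_simps [OF presented_class_hom] presented_class_gen Cons)
  qed
  have "presented_class p \<in> ?S"
  proof (induction p rule: poly_mapping_single_sum_induct)
    case zero
    show ?case
      by (simp add: complex_algebra_hom_simps [OF presented_class_hom] complex_vector.span_zero)
  next
    case (single k v)
    obtain w where k: "k = Word w" by (cases k)
    have "Poly_Mapping.single k v = v *\<^sub>C Poly_Mapping.single k (1::complex)"
      by (simp add: scaleC_poly_mapping_def mult_single scaleC_complex_def)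
    then have "presented_class (Poly_Mapping.single k v) = v *\<^sub>C prod_list (map gen w)"
      by (simp add: complex_algebra_hom_simps [OF presented_class_hom] k word)
    then show ?case
      by (simp add: complex_vector.span_scale complex_vector.span_base)
  next
    case (sum f g)
    then show ?case
      by (simp add: complex_algebra_hom_simps [OF presented_class_hom] complex_vector.span_add)
  qed
  then show ?thesis by (simp add: x)
qed

lemma presented_commute:
  assumes "\<And>a. c * gen a = gen a * c"
  shows "c * x = x * (c :: 'a::presentation presented_algebra)"
proof -
  have words: "c * prod_list (map gen w) = prod_list (map gen w) * c" for w :: "'a list"
    by (induction w) (simp_all add: assms, metis assms mult.assoc)
  from presented_words_span [of x] show ?thesis
  proof (induction rule: complex_vector.span_induct_alt)
    case (step k v y)
    then show ?case
      using words by (auto simp: distrib_left distrib_right mult_scaleC_left mult_scaleC_right)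
  qed simp
qed

section \<open>The structure of the enveloping algebra\<close>

lemma U_relators:
  "gen (sl3_add A B) = gen A + gen B"
  "gen (sl3_scale c A) = c *\<^sub>C gen A"
  "gen (sl3_bracket A B) = commutator (gen A) (gen B)"
proof -
  note hom = complex_algebra_hom_simps [OF presented_class_hom]
  have "free_gen (sl3_add A B) - (free_gen A + free_gen B) \<in> relators"
    "free_gen (sl3_scale c A) - c *\<^sub>C free_gen A \<in> relators"
    "free_gen (sl3_bracket A B) - commutator (free_gen A) (free_gen B) \<in> relators"
    unfolding relators_sl3_def by blast+
  from this [THEN presented_class_relator]
  show "gen (sl3_add A B) = gen A + gen B"
    "gen (sl3_scale c A) = c *\<^sub>C gen A"
    "gen (sl3_bracket A B) = commutator (gen A) (gen B)"
    by (simp_all add: hom presented_class_gen commutator_def)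
qed

text \<open>Written as a multiple of a generator, so that the scaling relation immediately sends it
  to 0.\<close>

definition sl3_zero :: sl3 where "sl3_zero = sl3_scale 0 (sl3_e 1 2)"

lemma gen_sl3_zero: "gen sl3_zero = 0"
  by (simp add: sl3_zero_def U_relators)

lemma gen_sl3_e: "gen (sl3_e i j) = U_e i j"
  by (simp add: U_e_def)

definition mat_unit :: "3 \<Rightarrow> 3 \<Rightarrow> complex^3^3"
  where "mat_unit i j = (\<chi> a b. if a = i \<and> b = j then 1 else 0)"

lemma mat_unit_mult: "mat_unit i j ** mat_unit k l = (if j = k then mat_unit i l else 0)"
proof -
  have "(\<Sum>c\<in>UNIV. (if a = i \<and> c = j then 1 else 0) * (if c = k \<and> b = l then 1 else (0::complex))) =
      (\<Sum>c\<in>UNIV. if c = j then (if a = i \<and> j = k \<and> b = l then 1 else 0) else 0)" for a b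
    by (intro sum.cong) auto
  then show ?thesis
    by (auto simp: mat_unit_def matrix_matrix_mult_def vec_eq_iff)
qed

lemma Rep_sl3_e: "Rep_sl3 (sl3_e i j) = mat_unit i j - mat (if i = j then 1 / 3 else 0)"
  by (simp add: sl3_e.rep_eq vec_eq_iff mat_def mat_unit_def)

lemma matrix_diff_left: "(A - B) ** C = A ** C - B ** (C :: complex^3^3)"
  by (simp add: matrix_matrix_mult_def vec_eq_iff left_diff_distrib sum_subtractf)

lemma matrix_diff_right: "C ** (A - B) = C ** A - C ** (B :: complex^3^3)"
  by (simp add: matrix_matrix_mult_def vec_eq_iff right_diff_distrib sum_subtractf)

lemma mat_scalar_commutes: "mat c ** A = A ** mat (c :: complex)"
proof -
  have "(\<Sum>k\<in>UNIV. (if i = k then c else 0) * A $ k $ j) = (\<Sum>k\<in>UNIV. if k = i then c * A $ i $ j else 0)"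
    "(\<Sum>k\<in>UNIV. A $ i $ k * (if k = j then c else 0)) = (\<Sum>k\<in>UNIV. if k = j then c * A $ i $ j else 0)"
    for i j by (intro sum.cong; auto)+
  then show ?thesis
    by (simp add: vec_eq_iff matrix_matrix_mult_def mat_def)
qed

text \<open>The scalar parts of the e_ij are central, so the bracket is that of the matrix units. On
  the right a correction by 1/3 occurs only if j = k and i = l, and then the two corrections
  cancel.\<close>

lemma sl3_bracket_e:
  "sl3_bracket (sl3_e i j) (sl3_e k l) =
    sl3_add (if j = k then sl3_e i l else sl3_zero)
      (sl3_scale (- 1) (if l = i then sl3_e k j else sl3_zero))"
proof -
  have "(A - mat a) ** (B - mat b) - (B - mat b) ** (A - mat a) = A ** B - B ** A"
    for A B :: "complex^3^3" and a b
    using mat_scalar_commutes [of a B] mat_scalar_commutes [of b A] mat_scalar_commutes [of a "mat b"]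
    by (simp add: matrix_diff_left matrix_diff_right)
  moreover have "Rep_sl3 sl3_zero = 0"
    by (simp add: sl3_zero_def sl3_scale.rep_eq vec_eq_iff)
  ultimately have "Rep_sl3 (sl3_bracket (sl3_e i j) (sl3_e k l)) = Rep_sl3
      (sl3_add (if j = k then sl3_e i l else sl3_zero)
      (sl3_scale (- 1) (if l = i then sl3_e k j else sl3_zero)))"
    by (auto simp: sl3_bracket.rep_eq sl3_add.rep_eq sl3_scale.rep_eq Rep_sl3_e mat_unit_mult
        vec_eq_iff)
  then show ?thesis by (simp add: Rep_sl3_inject)
qed

lemma U_e_commute:
  "U_e i j * U_e k l = U_e k l * U_e i j + (if j = k then U_e i l else 0) - (if l = i then U_e k j else 0)"
proof -
  have "gen (sl3_bracket (sl3_e i j) (sl3_e k l)) =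
      (if j = k then U_e i l else 0) - (if l = i then U_e k j else 0)"
    by (subst sl3_bracket_e) (simp add: U_relators gen_sl3_zero gen_sl3_e scaleC_one)
  then show ?thesis
    by (simp add: U_relators commutator_def gen_sl3_e algebra_simps)
qed

lemma U_e_trace: "U_e 3 3 = - U_e 1 1 - U_e 2 2"
proof -
  have "Rep_sl3 (sl3_add (sl3_add (sl3_e 1 1) (sl3_e 2 2)) (sl3_e 3 3)) = Rep_sl3 sl3_zero"
    by (simp add: sl3_zero_def sl3_add.rep_eq sl3_scale.rep_eq sl3_e.rep_eq vec_eq_iff forall_3)
  then have "gen (sl3_add (sl3_add (sl3_e 1 1) (sl3_e 2 2)) (sl3_e 3 3)) = gen sl3_zero"
    by (simp add: Rep_sl3_inject)
  then have "U_e 1 1 + U_e 2 2 + U_e 3 3 = 0"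
    by (simp only: U_relators gen_sl3_zero gen_sl3_e)
  then show ?thesis
    by (metis add.commute add_diff_cancel_left' diff_0 diff_diff_eq)
qed

text \<open>The corrections by 1/3 in the diagonal e_ii add up to a third of the trace of A times
  the identity matrix, which is 0.\<close>

lemma gen_sl3_expand: "gen A = (\<Sum>i\<in>UNIV. \<Sum>j\<in>UNIV. Rep_sl3 A $ i $ j *\<^sub>C U_e i j)"
proof -
  let ?s = "\<lambda>i j. sl3_scale (Rep_sl3 A $ i $ j) (sl3_e i j)"
  have tr: "trace (Rep_sl3 A) = 0" using Rep_sl3 [of A] by simp
  then have tr: "Rep_sl3 A $ 3 $ 3 = - Rep_sl3 A $ 1 $ 1 - Rep_sl3 A $ 2 $ 2"
    by (simp add: trace_def sum_3 algebra_simps eq_neg_iff_add_eq_0)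
  have "Rep_sl3 A = Rep_sl3 (sl3_add (sl3_add (sl3_add (?s 1 1) (?s 1 2)) (?s 1 3))
      (sl3_add (sl3_add (sl3_add (?s 2 1) (?s 2 2)) (?s 2 3))
      (sl3_add (sl3_add (?s 3 1) (?s 3 2)) (?s 3 3))))"
    by (simp add: sl3_add.rep_eq sl3_scale.rep_eq sl3_e.rep_eq vec_eq_iff forall_3 tr field_simps)
  then have "A = sl3_add (sl3_add (sl3_add (?s 1 1) (?s 1 2)) (?s 1 3))
      (sl3_add (sl3_add (sl3_add (?s 2 1) (?s 2 2)) (?s 2 3))
      (sl3_add (sl3_add (?s 3 1) (?s 3 2)) (?s 3 3)))"
    by (simp only: Rep_sl3_inject)
  from arg_cong [OF this, of gen] show ?thesis
    by (simp add: U_relators gen_sl3_e sum_3 add.assoc)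
qed

text \<open>Lowering operators, Cartan elements and raising operators, in this order; the table
  \<open>sl3_br\<close> lists the brackets of the letter \<open>a\<close> with the letters \<open>b < a\<close>.\<close>

definition U_index :: "nat \<Rightarrow> 3 \<times> 3" where
  "U_index i = [(2, 1), (3, 1), (3, 2), (1, 1), (2, 2), (1, 2), (1, 3), (2, 3)] ! i"

text \<open>The value 0 beyond the eight letters makes the straightening rule hold for all indices.
  e_33 has no letter because it is - e_11 - e_22.\<close>

definition U_letter :: "nat \<Rightarrow> U_sl3" where
  "U_letter i = (if i < 8 then case U_index i of (k, l) \<Rightarrow> U_e k l else 0)"

lemma U_letter_simps:
  "U_letter 0 = U_e 2 1" "U_letter 1 = U_e 3 1" "U_letter 2 = U_e 3 2" "U_letter 3 = U_e 1 1"
  "U_letter 4 = U_e 2 2" "U_letter 5 = U_e 1 2" "U_letter 6 = U_e 1 3" "U_letter 7 = U_e 2 3"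
  "U_letter (Suc 0) = U_e 3 1"
  by (simp_all add: U_letter_def U_index_def)

definition sl3_br :: "nat \<Rightarrow> nat \<Rightarrow> npoly" where
  "sl3_br a b = (if a < 8 then
   [[],
    [[]],
    [[(1, [1])], []],
    [[(-1, [0])], [(-1, [1])], []],
    [[(1, [0])], [], [(-1, [2])], []],
    [[(1, [3]), (-1, [4])], [(-1, [2])], [], [(-1, [5])], [(1, [5])]],
    [[(-1, [7])], [(2, [3]), (1, [4])], [(1, [5])], [(-1, [6])], [], []],
    [[], [(1, [0])], [(1, [3]), (2, [4])], [], [(-1, [7])], [(-1, [6])], []]] ! a ! b else [])"

interpretation U: straightening U_letter sl3_br
proof
  fix a l :: nat assume "l < a"
  show "U_letter a * U_letter l = U_letter l * U_letter a + np_val U_letter (sl3_br a l)"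
  proof (cases "a < 8")
    case True
    let ?r = "\<lambda>a l. case U_index a of (i, j) \<Rightarrow> case U_index l of (k, m) \<Rightarrow>
      (if j = k then U_e i m else 0) - (if m = i then U_e k j else 0)"
    have "\<forall>a\<in>{0,1,2,3,4,5,6,7}. \<forall>l\<in>{0,1,2,3,4,5,6}. l < a \<longrightarrow> ?r a l = np_val U_letter (sl3_br a l)"
      by (simp add: U_index_def U_letter_simps sl3_br_def U_e_trace mult_2)
    moreover have "a \<in> {0,1,2,3,4,5,6,7}" "l \<in> {0,1,2,3,4,5,6}"
      using True \<open>l < a\<close> by auto
    ultimately have "?r a l = np_val U_letter (sl3_br a l)"
      using \<open>l < a\<close> by blast
    moreover obtain i j k m where "U_index a = (i, j)" "U_index l = (k, m)"
      by (metis surj_pair)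
    ultimately show ?thesis
      using U_e_commute [of i j k m] True \<open>l < a\<close> by (simp add: U_letter_def add_diff_eq)
  qed (simp add: U_letter_def sl3_br_def)
qed

section \<open>The defining relations hold in the enveloping algebra\<close>

definition "n_e33 = NConst 0 \<ominus> NVar 3 \<ominus> NVar 4"

definition "n_H1 = (NVar 3 \<ominus> NVar 4) \<oslash> 2"
definition "n_h = (NVar 4 \<ominus> n_e33) \<oslash> 2"
text \<open>The trace relation turns (2 e_11 - e_22 - e_33) / 6 into e_11 / 2.\<close>

definition "n_y = NVar 3 \<oslash> 2"
definition "n_C2 = (NVar 3 \<odot> NVar 3 \<oplus> NVar 5 \<odot> NVar 0 \<oplus> NVar 6 \<odot>
  NVar 1) \<oplus> (NVar 0 \<odot> NVar 5 \<oplus> NVar 4 \<odot> NVar 4 \<oplus> NVar 7 \<odot>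
  NVar 2) \<oplus> (NVar 1 \<odot> NVar 6 \<oplus> NVar 2 \<odot> NVar 7 \<oplus> n_e33 \<odot>
  n_e33)"
definition "n_C3 = ((NVar 3 \<odot> NVar 3 \<odot> NVar 3 \<oplus> NVar 3 \<odot> NVar 5 \<odot>
  NVar 0 \<oplus> NVar 3 \<odot> NVar 6 \<odot> NVar 1) \<oplus> (NVar 5 \<odot> NVar 0 \<odot>
  NVar 3 \<oplus> NVar 5 \<odot> NVar 4 \<odot> NVar 0 \<oplus> NVar 5 \<odot> NVar 7 \<odot> NVar
  1) \<oplus> (NVar 6 \<odot> NVar 1 \<odot> NVar 3 \<oplus> NVar 6 \<odot> NVar 2 \<odot> NVar 0
  \<oplus> NVar 6 \<odot> n_e33 \<odot> NVar 1)) \<oplus> ((NVar 0 \<odot> NVar 3 \<odot> NVar 5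
  \<oplus> NVar 0 \<odot> NVar 5 \<odot> NVar 4 \<oplus> NVar 0 \<odot> NVar 6 \<odot> NVar 2)
  \<oplus> (NVar 4 \<odot> NVar 0 \<odot> NVar 5 \<oplus> NVar 4 \<odot> NVar 4 \<odot> NVar 4
  \<oplus> NVar 4 \<odot> NVar 7 \<odot> NVar 2) \<oplus> (NVar 7 \<odot> NVar 1 \<odot> NVar 5
  \<oplus> NVar 7 \<odot> NVar 2 \<odot> NVar 4 \<oplus> NVar 7 \<odot> n_e33 \<odot> NVar 2))
  \<oplus> ((NVar 1 \<odot> NVar 3 \<odot> NVar 6 \<oplus> NVar 1 \<odot> NVar 5 \<odot> NVar 7
  \<oplus> NVar 1 \<odot> NVar 6 \<odot> n_e33) \<oplus> (NVar 2 \<odot> NVar 0 \<odot> NVar 6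
  \<oplus> NVar 2 \<odot> NVar 4 \<odot> NVar 7 \<oplus> NVar 2 \<odot> NVar 7 \<odot> n_e33)
  \<oplus> (n_e33 \<odot> NVar 1 \<odot> NVar 6 \<oplus> n_e33 \<odot> NVar 2 \<odot> NVar 7
  \<oplus> n_e33 \<odot> n_e33 \<odot> n_e33))"
definition "n_J =
  ((NVar 3 \<ominus> NVar 4) \<odot> (NVar 3 \<ominus> NVar 4) \<oplus> NConst 2 \<odot> (NVar 3 \<ominus> NVar 4)) \<oslash> 4
    \<oplus> NVar 0 \<odot> NVar 5"
definition "n_Jbar =
  ((NVar 3 \<ominus> n_e33) \<odot> (NVar 3 \<ominus> n_e33) \<oplus> NConst 2 \<odot> (NVar 3 \<ominus> n_e33)) \<oslash> 4
    \<oplus> NVar 1 \<odot> NVar 6"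
definition "n_K = NVar 1 \<odot> NVar 5 \<odot> NVar 7 \<ominus> NVar 2 \<odot> NVar 0 \<odot> NVar 6"
definition "n_a = n_h \<odot> n_h \<oplus> NConst 3 \<odot> (n_y \<odot> n_y) \<oplus> n_C2"
definition "n_b_plus = (NConst 3 \<odot> n_y \<ominus> n_h) \<odot>
  ((NConst 2 \<ominus> n_y \<ominus> n_h) \<odot> n_C2 \<oslash> 4 \<ominus> n_C3 \<oslash> 3
    \<oplus> (n_y \<ominus> NConst 2 \<oplus> n_h) \<odot> (n_y \<oplus> NConst 2 \<oplus> n_h) \<odot> (n_y \<oplus> n_h) \<oslash> 8)"
definition "n_b_minus = (NConst 3 \<odot> n_y \<oplus> n_h) \<odot>
  ((NConst 2 \<ominus> n_y \<oplus> n_h) \<odot> n_C2 \<oslash> 4 \<ominus> n_C3 \<oslash> 3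
    \<oplus> (n_y \<ominus> NConst 2 \<ominus> n_h) \<odot> (n_y \<oplus> NConst 2 \<ominus> n_h) \<odot> (n_y \<ominus> n_h) \<oslash> 8)"

definition U_y :: U_sl3 where "U_y = (1/2) *\<^sub>C U_e 1 1"
definition U_a :: U_sl3 where "U_a = U_H2^2 + 3 * U_y^2 + U_C2"
definition U_b_plus :: U_sl3 where
  "U_b_plus = (3 * U_y - U_H2) *
    ((1/4) *\<^sub>C ((2 - U_y - U_H2) * U_C2) - (1/3) *\<^sub>C U_C3
      + (1/8) *\<^sub>C ((U_y - 2 + U_H2) * (U_y + 2 + U_H2) * (U_y + U_H2)))"
definition U_b_minus :: U_sl3 where
  "U_b_minus = (3 * U_y + U_H2) *
    ((1/4) *\<^sub>C ((2 - U_y + U_H2) * U_C2) - (1/3) *\<^sub>C U_C3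
      + (1/8) *\<^sub>C ((U_y - 2 - U_H2) * (U_y + 2 - U_H2) * (U_y - U_H2)))"

lemma n_e33_val [simp]: "nexp_val U_letter n_e33 = U_e 3 3"
  by (simp add: n_e33_def U_letter_simps U_e_trace)

lemma nexp_vals [simp]:
  "nexp_val U_letter n_H1 = U_H1" "nexp_val U_letter n_h = U_H2" "nexp_val U_letter n_y = U_y"
  by (simp_all add: n_H1_def n_h_def n_y_def U_H1_def U_y_def U_H2_def U_letter_simps)

text \<open>The recursion bound 30 is large enough for all computations of this section. Too small a
  bound could only leave a nonempty list, never prove a false equality.\<close>

lemma n_y_eq: "snd (nf sl3_br 30 (n_y \<ominus> (NConst 2 \<odot> n_H1 \<oplus> n_h) \<oslash> 3)) = []"
  by code_simp

lemma U_y_eq: "U_y = (1/3) *\<^sub>C (2 * U_H1 + U_H2)"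
  using U.nexp_val_eqI [OF n_y_eq] by simp

lemma nexp_val_C [simp]: "nexp_val U_letter n_C2 = U_C2" "nexp_val U_letter n_C3 = U_C3"
  by (simp_all add: n_C2_def n_C3_def U_C2_def U_C3_def sum_3 U_letter_simps add.assoc)

lemma nexp_val_J [simp]: "nexp_val U_letter n_J = U_J" "nexp_val U_letter n_Jbar = U_Jbar"
  by (simp_all add: n_J_def n_Jbar_def U_J_def U_Jbar_def U_letter_simps power2_eq_square)

lemma n_K_eq: "snd (nf sl3_br 30 (n_K \<ominus> (n_J \<odot> n_Jbar \<ominus> n_Jbar \<odot> n_J))) = []"
  by code_simp

lemma nexp_val_K [simp]: "nexp_val U_letter n_K = U_K"
  using U.nexp_val_eqI [OF n_K_eq] by (simp add: U_K_def commutator_def)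

lemma U_K_eq: "U_K = U_e 3 1 * U_e 1 2 * U_e 2 3 - U_e 3 2 * U_e 2 1 * U_e 1 3"
  using nexp_val_K by (simp add: n_K_def U_letter_simps)

lemma nexp_val_ab [simp]:
  "nexp_val U_letter n_a = U_a" "nexp_val U_letter n_b_plus = U_b_plus"
  "nexp_val U_letter n_b_minus = U_b_minus"
  by (simp_all add: n_a_def n_b_plus_def n_b_minus_def U_a_def U_b_plus_def U_b_minus_def power2_eq_square)

lemma n_JK: "snd (nf sl3_br 30 (n_J \<odot> n_K \<ominus> n_K \<odot> n_J \<ominus>
    (NConst 2 \<odot> (n_J \<odot> n_J) \<oplus> NConst 2 \<odot> (n_J \<odot> n_Jbar \<oplus> n_Jbar \<odot> n_J) \<ominus> n_a \<odot> n_J \<oplus> n_b_plus))) = []"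
  by code_simp

lemma n_KJbar: "snd (nf sl3_br 30 (n_K \<odot> n_Jbar \<ominus> n_Jbar \<odot> n_K \<ominus>
    (NConst 2 \<odot> (n_Jbar \<odot> n_Jbar) \<oplus> NConst 2 \<odot> (n_J \<odot> n_Jbar \<oplus> n_Jbar \<odot> n_J) \<ominus> n_a \<odot> n_Jbar \<oplus> n_b_minus))) = []"
  by code_simp

lemma U_JK: "commutator U_J U_K = 2 * U_J^2 + 2 * anticommutator U_J U_Jbar - U_a * U_J + U_b_plus"
  using U.nexp_val_eqI [OF n_JK] by (simp add: commutator_def anticommutator_def power2_eq_square)

lemma U_KJbar:
  "commutator U_K U_Jbar = 2 * U_Jbar^2 + 2 * anticommutator U_J U_Jbar - U_a * U_Jbar + U_b_minus"
  using U.nexp_val_eqI [OF n_KJbar] by (simp add: commutator_def anticommutator_def power2_eq_square)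

definition "n_cubic_lhs =
  NConst 2 \<odot> (n_J \<odot> n_J \<odot> n_Jbar \<oplus> n_Jbar \<odot> (n_J \<odot> n_J))
    \<oplus> NConst 2 \<odot> (n_J \<odot> (n_Jbar \<odot> n_Jbar) \<oplus> n_Jbar \<odot> n_Jbar \<odot> n_J) \<ominus> n_K \<odot> n_K
    \<ominus> NConst 4 \<odot> ((n_J \<oplus> n_Jbar) \<odot> (n_J \<oplus> n_Jbar))
    \<ominus> n_a \<odot> (n_J \<odot> n_Jbar \<oplus> n_Jbar \<odot> n_J)
    \<oplus> NConst 2 \<odot> (n_b_minus \<oplus> n_a) \<odot> n_J \<oplus> NConst 2 \<odot> (n_b_plus \<oplus> n_a) \<odot> n_Jbar"

definition "n_cubic_rhs = (let yy = n_y \<odot> n_y; hh = n_h \<odot> n_h;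
    t = n_C3 \<oslash> 3 \<oplus> NConst 2 \<odot> n_y \<oplus> n_y \<odot> n_C2 in
  (yy \<oplus> hh) \<odot> (yy \<oplus> hh) \<odot> (NConst 1 \<ominus> n_C2) \<oslash> 2
    \<ominus> (hh \<ominus> yy) \<odot> ((hh \<ominus> yy) \<odot> (hh \<ominus> yy)) \<oslash> 8
    \<oplus> NConst 2 \<odot> hh \<odot> yy
    \<ominus> t \<odot> (t \<ominus> n_C2)
    \<ominus> n_y \<odot> (NConst 3 \<odot> hh \<ominus> NConst 11 \<odot> yy) \<odot> (NConst 3 \<odot> n_C2 \<ominus> NConst 2 \<odot> n_C3) \<oslash> 6
    \<oplus> n_C2 \<odot> (hh \<oplus> NConst 3 \<odot> yy) \<odot> (NConst 5 \<odot> hh \<ominus> yy \<oplus> NConst 4) \<oslash> 8)"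

definition U_cubic_lhs :: U_sl3 where
  "U_cubic_lhs =
    2 * anticommutator (U_J^2) U_Jbar + 2 * anticommutator U_J (U_Jbar^2) - U_K^2 - 4 * (U_J + U_Jbar)^2
    - U_a * anticommutator U_J U_Jbar + 2 * (U_b_minus + U_a) * U_J + 2 * (U_b_plus + U_a) * U_Jbar"

definition U_cubic_rhs :: U_sl3 where
  "U_cubic_rhs =
    (1/2) *\<^sub>C ((U_y^2 + U_H2^2)^2 * (1 - U_C2)) - (1/8) *\<^sub>C (U_H2^2 - U_y^2)^3 + 2 * U_H2^2 * U_y^2
    - ((1/3) *\<^sub>C U_C3 + 2 * U_y + U_y * U_C2) * ((1/3) *\<^sub>C U_C3 + 2 * U_y + U_y * U_C2 - U_C2)
    - (1/6) *\<^sub>C (U_y * (3 * U_H2^2 - 11 * U_y^2) * (3 * U_C2 - 2 * U_C3))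
    + (1/8) *\<^sub>C (U_C2 * (U_H2^2 + 3 * U_y^2) * (5 * U_H2^2 - U_y^2 + 4))"

lemma nexp_val_cubic:
  "nexp_val U_letter n_cubic_lhs = U_cubic_lhs" "nexp_val U_letter n_cubic_rhs = U_cubic_rhs"
  by (simp_all add: n_cubic_lhs_def n_cubic_rhs_def U_cubic_lhs_def U_cubic_rhs_def
      anticommutator_def power2_eq_square power3_eq_cube Let_def mult.assoc)

lemma n_cubic: "snd (nf sl3_br 30 (n_cubic_lhs \<ominus> n_cubic_rhs)) = []"
  by code_simp

lemma U_cubic: "U_cubic_lhs = U_cubic_rhs"
  using U.nexp_val_eqI [OF n_cubic] by (simp add: nexp_val_cubic)

text \<open>The Casimir elements with lowering operators on the left. In this shape C2 can be solved
  for e_32 e_23 and C3 for the sum of the two cubic products, and both are easy to apply to a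
  Gelfand--Tsetlin pattern.\<close>

definition "n_C2_nf = NConst 2 \<odot> (NVar 0 \<odot> NVar 5 \<oplus> NVar 1 \<odot> NVar 6 \<oplus> NVar 2 \<odot> NVar 7)
  \<oplus> NConst 2 \<odot> (NConst 2 \<odot> NVar 3 \<oplus> NVar 3 \<odot> NVar 3 \<oplus> NVar 3 \<odot> NVar 4 \<oplus> NVar 4 \<oplus> NVar 4 \<odot> NVar 4)"

definition "n_C3_nf =
  NConst 3 \<odot> (NVar 1 \<odot> NVar 5 \<odot> NVar 7 \<oplus> NVar 2 \<odot> NVar 0 \<odot> NVar 6)
  \<oplus> NConst 3 \<odot> ((NVar 3 \<oplus> NVar 4 \<oplus> NConst 2) \<odot> (NVar 0 \<odot> NVar 5)
    \<ominus> NVar 4 \<odot> (NVar 1 \<odot> NVar 6) \<ominus> NVar 3 \<odot> (NVar 2 \<odot> NVar 7))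
  \<oplus> NConst 3 \<odot> (NVar 3 \<odot> (NConst 2 \<oplus> NVar 3 \<ominus> NVar 3 \<odot> NVar 4 \<ominus> NVar 4 \<ominus> NVar 4 \<odot> NVar 4))"

lemma n_C_nf:
  "snd (nf sl3_br 30 (n_C2 \<ominus> n_C2_nf)) = []" "snd (nf sl3_br 30 (n_C3 \<ominus> n_C3_nf)) = []"
  by code_simp+

lemma U_C2_eq: "U_C2 = 2 * (U_e 2 1 * U_e 1 2 + U_e 3 1 * U_e 1 3 + U_e 3 2 * U_e 2 3)
    + 2 * (2 * U_e 1 1 + U_e 1 1 * U_e 1 1 + U_e 1 1 * U_e 2 2 + U_e 2 2 + U_e 2 2 * U_e 2 2)"
  using U.nexp_val_eqI [OF n_C_nf(1)] by (simp add: n_C2_nf_def U_letter_simps)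

lemma U_C3_eq: "U_C3 = 3 * (U_e 3 1 * U_e 1 2 * U_e 2 3 + U_e 3 2 * U_e 2 1 * U_e 1 3)
    + 3 * ((U_e 1 1 + U_e 2 2 + 2) * (U_e 2 1 * U_e 1 2)
      - U_e 2 2 * (U_e 3 1 * U_e 1 3) - U_e 1 1 * (U_e 3 2 * U_e 2 3))
    + 3 * (U_e 1 1 * (2 + U_e 1 1 - U_e 1 1 * U_e 2 2 - U_e 2 2 - U_e 2 2 * U_e 2 2))"
  using U.nexp_val_eqI [OF n_C_nf(2)] by (simp add: n_C3_nf_def U_letter_simps)

lemma n_C_central:
  "\<forall>c\<in>set [n_C2, n_C3]. \<forall>i\<in>set [0, 1, 2, 3, 4, 5, 6, 7]. snd (nf sl3_br 30 (c \<odot> NVar i \<ominus> NVar i \<odot> c)) = []"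
  by code_simp

lemma n_H_commute:
  "\<forall>c\<in>set [n_H1, n_h]. \<forall>t\<in>set [n_J, n_Jbar, n_K, n_H1, n_h]. snd (nf sl3_br 30 (c \<odot> t \<ominus> t \<odot> c)) = []"
  by code_simp

lemma U_C_central:
  assumes "c \<in> {U_C2, U_C3}"
  shows "c * x = x * c"
proof -
  have letter: "c * U_letter i = U_letter i * c" if "i \<in> {0, 1, 2, 3, 4, 5, 6, 7}" for i
    using assms n_C_central that
      U.nexp_val_eqI [of 30 "n_C2 \<odot> NVar i" "NVar i \<odot> n_C2"]
      U.nexp_val_eqI [of 30 "n_C3 \<odot> NVar i" "NVar i \<odot> n_C3"] by auto
  have e: "c * U_e i j = U_e i j * c" for i j
  proof -
    have "c * U_e 3 3 = U_e 3 3 * c"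
      using letter [of 3] letter [of 4] by (simp add: U_e_trace U_letter_simps algebra_simps)
    then show ?thesis
      using exhaust_3 [of i] exhaust_3 [of j] letter [of 0] letter [of 1] letter [of 2]
        letter [of 3] letter [of 4] letter [of 5] letter [of 6] letter [of 7]
      by (elim disjE) (simp_all add: U_letter_simps)
  qed
  show ?thesis
    by (rule presented_commute)
      (simp add: gen_sl3_expand sum_distrib_left sum_distrib_right mult_scaleC_left mult_scaleC_right e)
qed

lemma U_H_commute:
  assumes "c \<in> {U_H1, U_H2}" "t \<in> {U_J, U_Jbar, U_K, U_H1, U_H2}"
  shows "c * t = t * c"
proof -
  have "c \<in> nexp_val U_letter ` set [n_H1, n_h]" "t \<in> nexp_val U_letter ` set [n_J, n_Jbar, n_K, n_H1, n_h]"
    using assms by auto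
  then obtain c' t' where c': "c' \<in> set [n_H1, n_h]" "c = nexp_val U_letter c'"
    and t': "t' \<in> set [n_J, n_Jbar, n_K, n_H1, n_h]" "t = nexp_val U_letter t'"
    by blast
  then have "snd (nf sl3_br 30 (c' \<odot> t' \<ominus> t' \<odot> c')) = []"
    using n_H_commute by blast
  from U.nexp_val_eqI [OF this] c' t' show ?thesis by simp
qed

section \<open>Generic Gelfand--Tsetlin modules\<close>

text \<open>All functions on \<open>'p\<close> are allowed, without a support condition. An operator
  is then given by its rows, that is, by a formula for the new value at a point in terms of values
  at shifted points.\<close>

typedef 'p lin_op = "{F :: ('p \<Rightarrow> complex) \<Rightarrow> 'p \<Rightarrow> complex.
    (\<forall>f g. F (\<lambda>x. f x + g x) = (\<lambda>x. F f x + F g x)) \<and> (\<forall>c f. F (\<lambda>x. c * f x) = (\<lambda>x. c * F f x))}"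
  morphisms lin_app Lin_op
  by (rule exI [of _ "\<lambda>f. f"]) simp

setup_lifting type_definition_lin_op

instantiation lin_op :: (type) complex_algebra_1
begin

lift_definition zero_lin_op :: "'a lin_op" is "\<lambda>f x. 0" by simp
lift_definition one_lin_op :: "'a lin_op" is "\<lambda>f. f" by simp
lift_definition plus_lin_op :: "'a lin_op \<Rightarrow> 'a lin_op \<Rightarrow> 'a lin_op" is "\<lambda>F G f x. F f x + G f x"
  by (simp add: algebra_simps)
lift_definition minus_lin_op :: "'a lin_op \<Rightarrow> 'a lin_op \<Rightarrow> 'a lin_op" is "\<lambda>F G f x. F f x - G f x"
  by (simp add: algebra_simps)
lift_definition uminus_lin_op :: "'a lin_op \<Rightarrow> 'a lin_op" is "\<lambda>F f x. - F f x"
  by simp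
lift_definition times_lin_op :: "'a lin_op \<Rightarrow> 'a lin_op \<Rightarrow> 'a lin_op" is "\<lambda>F G f. F (G f)"
  by simp
lift_definition scaleC_lin_op :: "complex \<Rightarrow> 'a lin_op \<Rightarrow> 'a lin_op" is "\<lambda>c F f x. c * F f x"
  by (simp add: algebra_simps)

instance
proof
  fix a b c :: "'a lin_op" and k l :: complex
  show "a + b + c = a + (b + c)" "a + b = b + a" "0 + a = a" "- a + a = 0" "a - b = a + - b"
    by (transfer, simp add: fun_eq_iff algebra_simps)+
  show "a * b * c = a * (b * c)" "1 * a = a" "a * 1 = a" "(a + b) * c = a * c + b * c"
    "a * (b + c) = a * b + a * c"
    by (transfer, simp)+
  show "(0 :: 'a lin_op) \<noteq> 1"
    by transfer (metis zero_neq_one)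
  show "k *\<^sub>C (a + b) = k *\<^sub>C a + k *\<^sub>C b" "(k + l) *\<^sub>C a = k *\<^sub>C a + l *\<^sub>C a"
    "k *\<^sub>C l *\<^sub>C a = (k * l) *\<^sub>C a" "1 *\<^sub>C a = a" "k *\<^sub>C a * b = k *\<^sub>C (a * b)" "a * k *\<^sub>C b = k *\<^sub>C (a * b)"
    by (transfer, simp add: fun_eq_iff algebra_simps)+
qed

end

lemma lin_app_simps [simp]:
  "lin_app 0 f x = 0" "lin_app 1 f x = f x" "lin_app (F + G) f x = lin_app F f x + lin_app G f x"
  "lin_app (F - G) f x = lin_app F f x - lin_app G f x" "lin_app (- F) f x = - lin_app F f x"
  "lin_app (F * G) f x = lin_app F (lin_app G f) x" "lin_app (c *\<^sub>C F) f x = c * lin_app F f x"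
  by (transfer, simp)+

lemma lin_op_eqI: "(\<And>f x. lin_app F f x = lin_app G f x) \<Longrightarrow> F = G"
  by transfer (simp add: fun_eq_iff)

lemma lin_app_sum: "lin_app (\<Sum>i\<in>S. F i) f x = (\<Sum>i\<in>S. lin_app (F i) f x)"
  by (induction S rule: infinite_finite_induct) simp_all

section \<open>The action on patterns with middle row (x, y) and bottom entry z\<close>

context
  fixes c2 c3 :: complex
begin

text \<open>In a Gelfand--Tsetlin pattern with middle row \<open>(x, y)\<close> and bottom entry \<open>z\<close>, only the characteristic
  polynomial of the top row matters, and its coefficients are \<open>C\<^sub>2\<close> and \<open>C\<^sub>3\<close> up to affine changes.
  The basis vectors are rescaled so that neither this polynomial nor a denominator enters the
  coefficient of \<open>f (x - 1, y + 1, z)\<close> in the action of \<open>Jbar\<close>.\<close>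

definition gt_ratio :: "complex \<Rightarrow> complex \<Rightarrow> complex" where
  "gt_ratio x y = (x^3 + 3 * x^2 + (4 - c2) / 2 * x - c3 / 3) / ((x - y) * (x - y + 1))"

text \<open>Raising x and lowering y gives the same coefficient in either order, as needed for
  [e_23, e_32] to be diagonal. Both numerators are Q(x) Q(y - 1), where Q is the cubic in the
  numerator of \<open>gt_ratio\<close>.\<close>

lemma gt_ratio_cross:
  assumes "x - y \<notin> \<int>"
  shows "gt_ratio (y - 1) x * gt_ratio x (y - 1) = gt_ratio x y * gt_ratio (y - 1) (x + 1)"
proof -
  have "x - y + of_int n \<noteq> 0" for n
    using assms by (metis Ints_minus Ints_of_int add.commute add_eq_0_iff minus_minus)
  from this [of 0] this [of 1] this [of 2] have "x - y \<noteq> 0" "x - y + 1 \<noteq> 0" "x - y + 2 \<noteq> 0" by simp_all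
  moreover have "y - 1 - x = - (x - y + 1)" "y - 1 - x + 1 = - (x - y)" "x - (y - 1) = x - y + 1"
    "y - 1 - (x + 1) = - (x - y + 2)"
    by simp_all
  ultimately show ?thesis
    unfolding gt_ratio_def by (simp add: field_simps)
qed

text \<open>The diagonal part of [e_23, e_32] = e_22 - e_33: these are its coefficient of z and its
  part free of z.\<close>

lemma gt_ratio_sum:
  assumes "x - y \<notin> \<int>"
  shows "gt_ratio (x - 1) y - gt_ratio x y + gt_ratio (y - 1) x - gt_ratio y x = - 1"
    and "- x * gt_ratio (x - 1) y + (x + 1) * gt_ratio x y - y * gt_ratio (y - 1) x + (y + 1) * gt_ratio y x
      = 2 * x + 2 * y + 2"
proof -
  have "x - y + of_int n \<noteq> 0" for n
    using assms by (metis Ints_minus Ints_of_int add.commute add_eq_0_iff minus_minus)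
  from this [of 0] this [of 1] this [of "- 1"]
  have nz: "x - y \<noteq> 0" "x - y + 1 \<noteq> 0" "x - y - 1 \<noteq> 0" by simp_all
  define d where "d = x - y"
  have y: "y = x - d" by (simp add: d_def)
  have nz: "d \<noteq> 0" "d + 1 \<noteq> 0" "d - 1 \<noteq> 0" using nz by (simp_all add: d_def)
  have den: "(x - 1 - y) * (x - 1 - y + 1) = (d - 1) * d" "(x - y) * (x - y + 1) = d * (d + 1)"
    "(y - 1 - x) * (y - 1 - x + 1) = (d + 1) * d" "(y - x) * (y - x + 1) = d * (d - 1)"
    by (simp_all add: d_def algebra_simps)
  show "gt_ratio (x - 1) y - gt_ratio x y + gt_ratio (y - 1) x - gt_ratio y x = - 1"
    unfolding gt_ratio_def den using nz unfolding y
    by (simp add: divide_simps) (simp add: algebra_simps power2_eq_square power3_eq_cube)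
  show "- x * gt_ratio (x - 1) y + (x + 1) * gt_ratio x y - y * gt_ratio (y - 1) x + (y + 1) * gt_ratio y x
      = 2 * x + 2 * y + 2"
    unfolding gt_ratio_def den using nz unfolding y
    by (simp add: divide_simps) (simp add: algebra_simps power2_eq_square power3_eq_cube)
qed


text \<open>These make the coefficients of the simultaneous shifts of x and y vanish in [e_13, e_23]
  = 0 and [e_31, e_32] = 0. The two ratios in each identity differ in one factor of the denominator
  only.\<close>

lemma gt_ratio_twist:
  assumes "x - y \<notin> \<int>"
  shows "(x - y + 1) * gt_ratio (y - 1) x = (x - y - 1) * gt_ratio (y - 1) (x - 1)"
    and "(x - y + 1) * gt_ratio x y = (x - y - 1) * gt_ratio x (y + 1)"
proof -
  have "x - y + of_int n \<noteq> 0" for n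
    using assms by (metis Ints_minus Ints_of_int add.commute add_eq_0_iff minus_minus)
  from this [of 0] this [of 1] this [of "- 1"] have nz: "x - y \<noteq> 0" "x - y + 1 \<noteq> 0" "x - y - 1 \<noteq> 0" by simp_all
  have den: "(y - 1 - x) * (y - 1 - x + 1) = (x - y) * (x - y + 1)"
    "(y - 1 - (x - 1)) * (y - 1 - (x - 1) + 1) = (x - y) * (x - y - 1)"
    "(x - (y + 1)) * (x - (y + 1) + 1) = (x - y) * (x - y - 1)"
    by (simp_all add: algebra_simps)
  show "(x - y + 1) * gt_ratio (y - 1) x = (x - y - 1) * gt_ratio (y - 1) (x - 1)"
    "(x - y + 1) * gt_ratio x y = (x - y - 1) * gt_ratio x (y + 1)"
    unfolding gt_ratio_def den using nz by simp_all
qed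

text \<open>Vanishing where \<open>x - y\<close> is an integer avoids the zeros of the denominators: that set is stable
  under all shifts.\<close>

fun gt_fun :: "3 \<Rightarrow> 3 \<Rightarrow> (complex \<times> complex \<times> complex \<Rightarrow> complex) \<Rightarrow> complex \<times> complex \<times> complex \<Rightarrow> complex" where
  "gt_fun i j f (x, y, z) = (if x - y \<in> \<int> then 0
    else if i = 1 then
     (if j = 1 then z * f (x, y, z)
      else if j = 2 then f (x, y, z - 1)
      else - f (x - 1, y, z - 1) - gt_ratio (y - 1) x * f (x, y - 1, z - 1))
    else if i = 2 then
     (if j = 1 then - ((z - x) * (z - y)) * f (x, y, z + 1)
      else if j = 2 then (x + y - z + 1) * f (x, y, z)
      else (z - x) * f (x - 1, y, z) + (z - y) * gt_ratio (y - 1) x * f (x, y - 1, z))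
    else
     (if j = 1 then (z - y) * gt_ratio x y * f (x + 1, y, z + 1) + (z - x) * f (x, y + 1, z + 1)
      else if j = 2 then gt_ratio x y * f (x + 1, y, z) + f (x, y + 1, z)
      else - (x + y + 1) * f (x, y, z)))"

lift_definition gt_e :: "3 \<Rightarrow> 3 \<Rightarrow> (complex \<times> complex \<times> complex) lin_op" is gt_fun
  by (auto simp: fun_eq_iff algebra_simps)

lemma gt_e_app [simp]: "lin_app (gt_e i j) = gt_fun i j"
  by (fact gt_e.rep_eq)

lemma Ints_shift: "x + 1 - y \<in> \<int> \<longleftrightarrow> x - y \<in> \<int>" "x - 1 - y \<in> \<int> \<longleftrightarrow> x - y \<in> \<int>"
  "x - (y + 1) \<in> \<int> \<longleftrightarrow> x - y \<in> \<int>" "x - (y - 1) \<in> \<int> \<longleftrightarrow> x - y \<in> \<int>" for x y :: complex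
proof -
  have "x + 1 - y = (x - y) + 1" "x - 1 - y = (x - y) - 1" "x - (y + 1) = (x - y) - 1" "x - (y - 1) = (x - y) + 1"
    by simp_all
  moreover have "a + 1 \<in> \<int> \<longleftrightarrow> a \<in> \<int>" "a - 1 \<in> \<int> \<longleftrightarrow> a \<in> \<int>" for a :: complex
    by (metis Ints_1 Ints_add Ints_diff add_diff_cancel diff_add_cancel)+
  ultimately show "x + 1 - y \<in> \<int> \<longleftrightarrow> x - y \<in> \<int>" "x - 1 - y \<in> \<int> \<longleftrightarrow> x - y \<in> \<int>"
  "x - (y + 1) \<in> \<int> \<longleftrightarrow> x - y \<in> \<int>" "x - (y - 1) \<in> \<int> \<longleftrightarrow> x - y \<in> \<int>"
    by (simp_all only:)
qed

lemma gt_commute: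
  "gt_e i j * gt_e k l - gt_e k l * gt_e i j = (if j = k then gt_e i l else 0) - (if l = i then gt_e k j else 0)"
proof (rule lin_op_eqI)
  fix f and p :: "complex \<times> complex \<times> complex"
  obtain x y z where p: "p = (x, y, z)" by (cases p)
  show "lin_app (gt_e i j * gt_e k l - gt_e k l * gt_e i j) f p =
    lin_app ((if j = k then gt_e i l else 0) - (if l = i then gt_e k j else 0)) f p"
  proof (cases "x - y \<in> \<int>")
    case True
    then show ?thesis by (simp add: p)
  next
    case False
    have cross: "gt_ratio x y * (gt_ratio (y - 1) (1 + x) * t) = gt_ratio x (y - 1) * (gt_ratio (y - 1) x * t)" for t
      using gt_ratio_cross [OF False] by (metis add.commute mult.assoc mult.commute)
    \<comment> \<open>The two identities of \<open>gt_ratio_sum\<close>, solved for two of the four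
      ratios, so that they can serve as rewrite rules.\<close>
    have a: "gt_ratio x y = x + 2 * y + 2 - (x - y) * gt_ratio (y - 1) x - (y + 1 - x) * gt_ratio y x"
      using gt_ratio_sum [OF False] by algebra
    have b: "gt_ratio (x - 1) y = gt_ratio x y - gt_ratio (y - 1) x + gt_ratio y x - 1"
      using gt_ratio_sum [OF False] by algebra
    have twist: "(x - y + 1) * gt_ratio (y - 1) x * t = (x - y - 1) * gt_ratio (y - 1) (x - 1) * t"
      "(x - y + 1) * gt_ratio x y * t = (x - y - 1) * gt_ratio x (y + 1) * t" for t
      using gt_ratio_twist [OF False] by simp_all
    note twist = twist(1) [of "f (x - 1, y - 1, z - 1)"] twist(2) [of "f (x + 1, y + 1, z + 1)"]
    have i: "i \<in> {1, 2, 3}" and j: "j \<in> {1, 2, 3}" and k: "k \<in> {1, 2, 3}" and l: "l \<in> {1, 2, 3}"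
      using exhaust_3 by auto
    from False show ?thesis
      using i j k l
      by (elim insertE emptyE; simp add: p Ints_shift;
          ((simp add: algebra_simps; fail) | (simp add: algebra_simps cross, simp add: b, simp add: a algebra_simps; fail) | (insert twist, simp add: algebra_simps; fail)))
  qed
qed

lemma gt_trace: "gt_e 1 1 + gt_e 2 2 + gt_e 3 3 = 0"
proof (rule lin_op_eqI)
  fix f and p :: "complex \<times> complex \<times> complex"
  show "lin_app (gt_e 1 1 + gt_e 2 2 + gt_e 3 3) f p = lin_app 0 f p"
    by (cases p) (simp add: algebra_simps)
qed

definition gt_map :: "sl3 \<Rightarrow> (complex \<times> complex \<times> complex) lin_op"
  where "gt_map A = (\<Sum>i\<in>UNIV. \<Sum>j\<in>UNIV. Rep_sl3 A $ i $ j *\<^sub>C gt_e i j)"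

lemma gt_map_bracket: "gt_map (sl3_bracket A B) = commutator (gt_map A) (gt_map B)"
proof -
  let ?a = "\<lambda>i j. Rep_sl3 A $ i $ j" and ?b = "\<lambda>i j. Rep_sl3 B $ i $ j"
  have "commutator (gt_map A) (gt_map B) = (\<Sum>i\<in>UNIV. \<Sum>j\<in>UNIV. \<Sum>k\<in>UNIV. \<Sum>l\<in>UNIV.
      (?a i j * ?b k l) *\<^sub>C (gt_e i j * gt_e k l)) -
      (\<Sum>k\<in>UNIV. \<Sum>l\<in>UNIV. \<Sum>i\<in>UNIV. \<Sum>j\<in>UNIV. (?a i j * ?b k l) *\<^sub>C (gt_e k l * gt_e i j))"
  proof -
    have "(\<Sum>i\<in>UNIV. \<Sum>j\<in>UNIV. F i j) * (\<Sum>k\<in>UNIV. \<Sum>l\<in>UNIV. G k l) =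
        (\<Sum>i\<in>UNIV. \<Sum>j\<in>UNIV. \<Sum>k\<in>UNIV. \<Sum>l\<in>UNIV. F i j * G k l)"
      for F G :: "3 \<Rightarrow> 3 \<Rightarrow> (complex \<times> complex \<times> complex) lin_op"
      by (simp only: sum_distrib_right) (simp only: sum_distrib_left)
    then show ?thesis
      by (simp only: commutator_def gt_map_def mult_scaleC_left mult_scaleC_right scaleC_scaleC)
        (simp only: mult.commute)
  qed
  also have "(\<Sum>k\<in>UNIV. \<Sum>l\<in>UNIV. \<Sum>i\<in>UNIV. \<Sum>j\<in>UNIV. (?a i j * ?b k l) *\<^sub>C (gt_e k l * gt_e i j)) =
      (\<Sum>i\<in>UNIV. \<Sum>j\<in>UNIV. \<Sum>k\<in>UNIV. \<Sum>l\<in>UNIV. (?a i j * ?b k l) *\<^sub>C (gt_e k l * gt_e i j))"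
    by (simp only: sum_3 add_ac)
  also have "(\<Sum>i\<in>UNIV. \<Sum>j\<in>UNIV. \<Sum>k\<in>UNIV. \<Sum>l\<in>UNIV. (?a i j * ?b k l) *\<^sub>C (gt_e i j * gt_e k l)) -
      (\<Sum>i\<in>UNIV. \<Sum>j\<in>UNIV. \<Sum>k\<in>UNIV. \<Sum>l\<in>UNIV. (?a i j * ?b k l) *\<^sub>C (gt_e k l * gt_e i j)) =
      (\<Sum>i\<in>UNIV. \<Sum>j\<in>UNIV. \<Sum>k\<in>UNIV. \<Sum>l\<in>UNIV. (?a i j * ?b k l) *\<^sub>C
        ((if j = k then gt_e i l else 0) - (if l = i then gt_e k j else 0)))"
    by (simp only: gt_commute [symmetric] complex_vector.scale_right_diff_distrib sum_subtractf)
  also have "\<dots> = gt_map (sl3_bracket A B)"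
    by (simp add: gt_map_def sl3_bracket.rep_eq matrix_matrix_mult_def sum_3
        complex_vector.scale_right_diff_distrib complex_vector.scale_left_diff_distrib
        scaleC_add_left mult.commute)
  finally show ?thesis by simp
qed

lemma gt_rep_ex:
  obtains \<rho> where "complex_algebra_hom \<rho>" "\<And>i j. \<rho> (U_e i j) = gt_e i j"
proof -
  have "free_lift gt_map r = 0" if "r \<in> relators" for r
  proof -
    have "gt_map (sl3_add A B) = gt_map A + gt_map B" for A B
      by (simp add: gt_map_def sl3_add.rep_eq scaleC_add_left sum.distrib)
    moreover have "gt_map (sl3_scale c A) = c *\<^sub>C gt_map A" for c A
      by (simp add: gt_map_def sl3_scale.rep_eq complex_vector.scale_sum_right scaleC_scaleC)
    ultimately show ?thesis
      using that unfolding relators_sl3_def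
      by (auto simp: complex_algebra_hom_simps [OF free_lift_hom] gt_map_bracket commutator_def)
  qed
  then obtain \<rho> where hom: "complex_algebra_hom \<rho>" and \<rho>: "\<And>A. \<rho> (gen A) = gt_map A"
    using presented_lift_ex [of gt_map] by blast
  have gt33: "gt_e 3 3 = - gt_e 1 1 - gt_e 2 2"
    using gt_trace by (metis add.commute add_diff_cancel_left' diff_0 diff_diff_eq)
  have "\<rho> (U_e i j) = gt_e i j" for i j
    using exhaust_3 [of i] exhaust_3 [of j]
    by (elim disjE) (simp_all add: U_e_def \<rho> gt_map_def sl3_e.rep_eq sum_3 scaleC_one gt33
        complex_vector.scale_left_diff_distrib complex_vector.scale_right_diff_distrib)
  with hom show ?thesis by (rule that)
qed

text \<open>With Q the cubic in the numerator of \<open>gt_ratio\<close>, the left sides are the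
  divided differences (Q(x) - Q(y)) / (x - y) and (y Q(x) - x Q(y)) / (x - y). Their constant terms
  carry c2 and c3, which is why the Casimir elements act by these scalars.\<close>

lemma gt_ratio_sym:
  assumes "x - y \<notin> \<int>"
  shows "(x - y + 1) * gt_ratio x y + (y - x + 1) * gt_ratio y x =
      x^2 + x * y + y^2 + 3 * (x + y) + (4 - c2) / 2"
    and "(x - y + 1) * y * gt_ratio x y + (y - x + 1) * x * gt_ratio y x =
      x * y * (x + y) + 3 * x * y + c3 / 3"
proof -
  have "x - y + of_int n \<noteq> 0" for n
    using assms by (metis Ints_minus Ints_of_int add.commute add_eq_0_iff minus_minus)
  from this [of 0] this [of 1] this [of "- 1"]
  have nz: "x - y \<noteq> 0" "x - y + 1 \<noteq> 0" "y - x + 1 \<noteq> 0" by (simp_all, simp add: algebra_simps)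
  define Q where "Q x = x^3 + 3 * x^2 + (4 - c2) / 2 * x - c3 / 3" for x
  have r: "(x - y + 1) * gt_ratio x y = Q x / (x - y)" "(y - x + 1) * gt_ratio y x = - (Q y / (x - y))"
    unfolding gt_ratio_def Q_def [symmetric] using nz
    by simp (metis minus_diff_eq minus_divide_right nz(3) nonzero_mult_divide_mult_cancel_left mult.commute times_divide_eq_right)
  show "(x - y + 1) * gt_ratio x y + (y - x + 1) * gt_ratio y x =
      x^2 + x * y + y^2 + 3 * (x + y) + (4 - c2) / 2"
    unfolding r using nz
    by (simp add: Q_def divide_simps) (simp add: algebra_simps power2_eq_square power3_eq_cube)
  have "(x - y + 1) * y * gt_ratio x y + (y - x + 1) * x * gt_ratio y x =
      y * ((x - y + 1) * gt_ratio x y) + x * ((y - x + 1) * gt_ratio y x)"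
    by (simp add: algebra_simps)
  also have "\<dots> = y * (Q x / (x - y)) - x * (Q y / (x - y))"
    unfolding r by simp
  also have "\<dots> = x * y * (x + y) + 3 * x * y + c3 / 3"
    using nz by (simp add: Q_def divide_simps) (simp add: algebra_simps power2_eq_square power3_eq_cube)
  finally show "(x - y + 1) * y * gt_ratio x y + (y - x + 1) * x * gt_ratio y x =
      x * y * (x + y) + 3 * x * y + c3 / 3" .
qed

lemma gt_rep_values:
  assumes hom: "complex_algebra_hom \<rho>" and e: "\<And>i j. \<rho> (U_e i j) = gt_e i j" and "x - y \<notin> \<int>"
  shows "lin_app (\<rho> U_H1) f (x, y, z) = (2 * z - x - y - 1) / 2 * f (x, y, z)"
    and "lin_app (\<rho> U_H2) f (x, y, z) = (2 * x + 2 * y - z + 2) / 2 * f (x, y, z)"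
    and "lin_app (\<rho> U_C2) f (x, y, z) = c2 * f (x, y, z)"
    and "lin_app (\<rho> U_C3) f (x, y, z) = c3 * f (x, y, z)"
    and "lin_app (\<rho> U_J) f (x, y, z) = ((x - y)^2 - 1) / 4 * f (x, y, z)"
    and "lin_app (\<rho> U_Jbar) f (x, y, z) = (x - z) * f (x - 1, y + 1, z)
      + (((x + y + z + 2)^2 - 1) / 4 - (z - y) * gt_ratio x y - (z - x) * gt_ratio y x) * f (x, y, z)
      - (z - y) * gt_ratio x y * gt_ratio (y - 1) (x + 1) * f (x + 1, y - 1, z)"
proof -
  note hs = complex_algebra_hom_simps [OF hom]
  \<comment> \<open>Instead of expanding the ratios, the scalars are expressed through them; the
    claims about the Casimir elements become polynomial identities in which each ratio is an
    unknown.\<close>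
  have c2: "c2 = 4 + 2 * (x^2 + x * y + y^2 + 3 * (x + y)) - 2 * ((x - y + 1) * gt_ratio x y + (y - x + 1) * gt_ratio y x)"
    using gt_ratio_sym(1) [OF assms(3)] by (simp add: field_simps)
  have c3: "c3 = 3 * ((x - y + 1) * y * gt_ratio x y + (y - x + 1) * x * gt_ratio y x) - 3 * x * y * (x + y) - 9 * x * y"
    using gt_ratio_sym(2) [OF assms(3)] by (simp add: field_simps)
  note s = hs e gt_e_app gt_fun.simps Ints_shift assms(3) numeral_eq_scaleC [where 'a = "(complex \<times> complex \<times> complex) lin_op"] power2_eq_square
  show "lin_app (\<rho> U_H1) f (x, y, z) = (2 * z - x - y - 1) / 2 * f (x, y, z)"
    by (simp add: U_H1_def s) (simp add: field_simps)
  show "lin_app (\<rho> U_H2) f (x, y, z) = (2 * x + 2 * y - z + 2) / 2 * f (x, y, z)"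
    by (simp add: U_H2_def s) (simp add: field_simps)
  show "lin_app (\<rho> U_J) f (x, y, z) = ((x - y)^2 - 1) / 4 * f (x, y, z)"
    by (simp add: U_J_def s) (simp add: field_simps)
  show "lin_app (\<rho> U_Jbar) f (x, y, z) = (x - z) * f (x - 1, y + 1, z)
      + (((x + y + z + 2)^2 - 1) / 4 - (z - y) * gt_ratio x y - (z - x) * gt_ratio y x) * f (x, y, z)
      - (z - y) * gt_ratio x y * gt_ratio (y - 1) (x + 1) * f (x + 1, y - 1, z)"
    by (simp add: U_Jbar_def s) (simp add: field_simps)
  show "lin_app (\<rho> U_C2) f (x, y, z) = c2 * f (x, y, z)"
    by (subst c2, simp add: U_C2_eq s) (simp add: algebra_simps)
  show "lin_app (\<rho> U_C3) f (x, y, z) = c3 * f (x, y, z)"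
    by (subst c3, simp add: U_C3_eq s) (simp add: algebra_simps)
qed

end

section \<open>Linear independence\<close>

text \<open>Used to separate one parameter at a time. Several indices may share an exponent, hence
  the sum over a fibre; S is merely infinite because generic parameters have to avoid
  integers.\<close>

lemma vanishing_power_sum:
  fixes a :: "'i \<Rightarrow> complex"
  assumes "finite G" "infinite S" "\<And>s. s \<in> S \<Longrightarrow> (\<Sum>e\<in>G. a e * s ^ n e) = 0"
  shows "(\<Sum>e\<in>{e\<in>G. n e = m}. a e) = 0"
proof -
  define p where "p = (\<Sum>e\<in>G. monom (a e) (n e))"
  have "poly p s = (\<Sum>e\<in>G. a e * s ^ n e)" for s
    by (simp add: p_def poly_sum poly_monom)
  then have "S \<subseteq> {s. poly p s = 0}" using assms(3) by auto
  then have "p = 0"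
    using assms(2) poly_roots_finite finite_subset by blast
  then have "0 = coeff p m" by simp
  also have "\<dots> = (\<Sum>e\<in>G. if n e = m then a e else 0)"
    by (simp add: p_def coeff_sum)
  also have "\<dots> = (\<Sum>e\<in>{e\<in>G. n e = m}. a e)"
    using assms(1) by (simp add: sum.inter_filter)
  finally show ?thesis by simp
qed

text \<open>Among the terms with nonzero coefficient, the one of largest degree has a leading term
  that nothing cancels.\<close>

lemma distinct_degrees_independent:
  fixes p :: "'i \<Rightarrow> complex poly"
  assumes "finite G" "inj_on (degree \<circ> p) G" "\<And>e. e \<in> G \<Longrightarrow> p e \<noteq> 0"
    and "(\<Sum>e\<in>G. smult (a e) (p e)) = 0" "e \<in> G"
  shows "a e = 0"
proof (rule ccontr)
  assume "a e \<noteq> 0"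
  define G' where "G' = {e\<in>G. a e \<noteq> 0}"
  have G': "finite G'" "G' \<noteq> {}" "G' \<subseteq> G" using assms(1,5) \<open>a e \<noteq> 0\<close> by (auto simp: G'_def)
  obtain m where m: "m \<in> G'" "\<And>e. e \<in> G' \<Longrightarrow> degree (p e) \<le> degree (p m)"
  proof -
    have "Max ((degree \<circ> p) ` G') \<in> (degree \<circ> p) ` G'" using G' by (intro Max_in) auto
    then obtain m where "m \<in> G'" "degree (p m) = Max ((degree \<circ> p) ` G')" by auto
    then show ?thesis using that G' by simp
  qed
  have "coeff (smult (a e) (p e)) (degree (p m)) = 0" if "e \<in> G - {m}" for e
  proof (cases "e \<in> G'")
    case True
    then have "degree (p e) \<noteq> degree (p m)"
      using assms(2) that m(1) G'(3) by (auto simp: inj_on_def)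
    with m(2) [OF True] show ?thesis by (simp add: coeff_eq_0)
  qed (use that in \<open>auto simp: G'_def\<close>)
  then have "(\<Sum>e\<in>G - {m}. coeff (smult (a e) (p e)) (degree (p m))) = 0"
    by (rule sum.neutral [OF ballI])
  then have "(\<Sum>e\<in>G. coeff (smult (a e) (p e)) (degree (p m))) = a m * lead_coeff (p m)"
    using assms(1) m(1) G'(3) sum.remove [of G m "\<lambda>e. coeff (smult (a e) (p e)) (degree (p m))"] by auto
  moreover have "(\<Sum>e\<in>G. coeff (smult (a e) (p e)) (degree (p m))) = 0"
    using arg_cong [OF assms(4), of "\<lambda>q. coeff q (degree (p m))"] by (simp add: coeff_sum)
  ultimately show False
    using m(1) assms(3) by (auto simp: G'_def)
qed

section \<open>Leading coefficients along a chain of points of one weight\<close>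

lemma eigenvalue_power:
  assumes "complex_algebra_hom \<rho>" "\<And>f. lin_app (\<rho> X) f p = v * f p"
  shows "lin_app (\<rho> (X ^ n)) f p = v ^ n * f p"
  by (induction n) (simp_all add: complex_algebra_hom_simps [OF assms(1)] assms(2))

text \<open>x + y and z determine the weight, so all these points have the same weight. Along the
  chain t = x - y decreases by 2 in each step.\<close>

definition chain_point :: "complex \<times> complex \<times> complex \<Rightarrow> int \<Rightarrow> complex \<times> complex \<times> complex"
  where "chain_point p m = (case p of (x, y, z) \<Rightarrow> (x - of_int m, y + of_int m, z))"

locale gt_point =
  fixes c2 c3 x y z :: complex and \<rho> :: "U_sl3 \<Rightarrow> (complex \<times> complex \<times> complex) lin_op"
  assumes hom: "complex_algebra_hom \<rho>" and gt: "\<And>i j. \<rho> (U_e i j) = gt_e c2 c3 i j"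
    and generic: "x - y \<notin> \<int>"
begin

abbreviation "pt \<equiv> chain_point (x, y, z)"

lemma generic_chain: "x - of_int m - (y + of_int m) \<notin> \<int>"
proof
  assume "x - of_int m - (y + of_int m) \<in> \<int>"
  then have "(x - of_int m - (y + of_int m)) + of_int (2 * m) \<in> \<int>"
    by (intro Ints_add Ints_of_int)
  then show False using generic by simp
qed

lemma J_chain: "lin_app (\<rho> U_J) f (pt m) = ((x - y - 2 * of_int m)^2 - 1) / 4 * f (pt m)"
proof -
  have "x - of_int m - (y + of_int m) = x - y - 2 * of_int m" by simp
  with gt_rep_values(5) [OF hom gt generic_chain [of m], of f z] show ?thesis
    by (simp add: chain_point_def)
qed

text \<open>Only the coefficient towards \<open>pt (m + 1)\<close> matters below; by the choice of
  normalization it is a polynomial. The other two stay unnamed.\<close>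

lemma Jbar_chain:
  obtains b c where "\<And>f m. lin_app (\<rho> U_Jbar) f (pt m) =
    (x - z - of_int m) * f (pt (m + 1)) + b m * f (pt m) + c m * f (pt (m - 1))"
proof -
  have "\<exists>b c. \<forall>f. lin_app (\<rho> U_Jbar) f (pt m) =
    (x - z - of_int m) * f (pt (m + 1)) + b * f (pt m) + c * f (pt (m - 1))" for m
  proof -
    define u v where "u = x - of_int m" and "v = y + of_int m"
    have pt: "pt m = (u, v, z)" "pt (m + 1) = (u - 1, v + 1, z)" "pt (m - 1) = (u + 1, v - 1, z)"
      by (simp_all add: chain_point_def u_def v_def)
    have "u - v \<notin> \<int>" using generic_chain by (simp add: u_def v_def)
    from gt_rep_values(6) [OF hom gt this, of _ z] show ?thesis
      unfolding pt
      by (intro exI [of _ "((u + v + z + 2)^2 - 1) / 4 - (z - v) * gt_ratio c2 c3 u v - (z - u) * gt_ratio c2 c3 v u"]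
          exI [of _ "- ((z - v) * gt_ratio c2 c3 u v * gt_ratio c2 c3 (v - 1) (u + 1))"] allI)
        (simp add: u_def)
  qed
  then show ?thesis using that by metis
qed

text \<open>If g vanishes below M, then at M - 1 only the outermost of the three terms of
  \<open>Jbar\<close> survives: each application lets the support grow by one step, with a known
  coefficient.\<close>

lemma Jbar_top:
  assumes "\<And>m. m < M \<Longrightarrow> g (pt m) = 0"
  shows "m < M - 1 \<Longrightarrow> lin_app (\<rho> U_Jbar) g (pt m) = 0"
    and "lin_app (\<rho> U_Jbar) g (pt (M - 1)) = (x - z - of_int (M - 1)) * g (pt M)"
proof -
  obtain b c where *: "\<And>f m. lin_app (\<rho> U_Jbar) f (pt m) =
    (x - z - of_int m) * f (pt (m + 1)) + b m * f (pt m) + c m * f (pt (m - 1))"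
    using Jbar_chain by blast
  show "m < M - 1 \<Longrightarrow> lin_app (\<rho> U_Jbar) g (pt m) = 0"
    and "lin_app (\<rho> U_Jbar) g (pt (M - 1)) = (x - z - of_int (M - 1)) * g (pt M)"
    unfolding * by (simp_all add: assms)
qed

text \<open>As K = [J, Jbar], the coefficient of \<open>Jbar\<close> gets multiplied by the
  difference of the eigenvalues of J at M - 1 and at M, which is t - 2 M + 1 for t = x - y.\<close>

lemma K_top:
  assumes "\<And>m. m < M \<Longrightarrow> g (pt m) = 0"
  shows "m < M - 1 \<Longrightarrow> lin_app (\<rho> U_K) g (pt m) = 0"
    and "lin_app (\<rho> U_K) g (pt (M - 1)) =
      (x - z - of_int (M - 1)) * (x - y - 2 * of_int M + 1) * g (pt M)"
proof -
  have K: "lin_app (\<rho> U_K) g q =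
      lin_app (\<rho> U_J) (lin_app (\<rho> U_Jbar) g) q - lin_app (\<rho> U_Jbar) (lin_app (\<rho> U_J) g) q" for q
    by (simp add: U_K_def commutator_def complex_algebra_hom_simps [OF hom])
  have J: "lin_app (\<rho> U_J) g (pt m) = 0" if "m < M" for m
    by (simp add: J_chain assms that)
  show "m < M - 1 \<Longrightarrow> lin_app (\<rho> U_K) g (pt m) = 0"
    unfolding K J_chain using Jbar_top(1) [of M g] Jbar_top(1) [of M "lin_app (\<rho> U_J) g"] assms J by simp
  show "lin_app (\<rho> U_K) g (pt (M - 1)) =
      (x - z - of_int (M - 1)) * (x - y - 2 * of_int M + 1) * g (pt M)"
  proof -
    have "lin_app (\<rho> U_Jbar) g (pt (M - 1)) = (x - z - of_int (M - 1)) * g (pt M)"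
      by (rule Jbar_top(2)) (rule assms)
    moreover have "lin_app (\<rho> U_Jbar) (lin_app (\<rho> U_J) g) (pt (M - 1)) =
        (x - z - of_int (M - 1)) * lin_app (\<rho> U_J) g (pt M)"
      by (rule Jbar_top(2)) (rule J)
    ultimately show ?thesis
      unfolding K by (simp only: J_chain) (simp add: field_simps power2_eq_square)
  qed
qed

lemma Jbar_power_top:
  assumes "\<And>m. m < M \<Longrightarrow> g (pt m) = 0"
  shows "(\<forall>m < M - int j. lin_app (\<rho> (U_Jbar ^ j)) g (pt m) = 0) \<and>
    lin_app (\<rho> (U_Jbar ^ j)) g (pt (M - int j)) = (\<Prod>i<j. x - z - of_int (M - 1 - int i)) * g (pt M)"
proof (induction j)
  case 0
  show ?case using assms by (simp add: complex_algebra_hom_simps [OF hom])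
next
  case (Suc j)
  let ?g = "lin_app (\<rho> (U_Jbar ^ j)) g"
  have "lin_app (\<rho> (U_Jbar ^ Suc j)) g q = lin_app (\<rho> U_Jbar) ?g q" for q
    by (simp add: complex_algebra_hom_simps [OF hom])
  moreover have "M - int (Suc j) = M - int j - 1" by simp
  ultimately show ?case
    using Jbar_top [of "M - int j" ?g] Suc by (simp add: algebra_simps)
qed

text \<open>The function concentrated at the N-th point reaches the 0-th one only by N shifts, so
  this evaluation detects exactly the monomials with j + k = N. They share the product of shift
  coefficients, and K adds its own factor in t. The remaining factors act last and contribute their
  scalars at the 0-th point.\<close>

lemma monomial_top:
  assumes "k \<in> {0, 1}" "j + k \<le> N"
  shows "lin_app (\<rho> (basis_monomial (\<alpha>, \<beta>, c, d, i, j, k))) (\<lambda>q. if q = pt (int N) then 1 else 0) (pt 0) =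
    ((2 * z - x - y - 1) / 2) ^ \<alpha> * ((2 * x + 2 * y - z + 2) / 2) ^ \<beta> * c2 ^ c * c3 ^ d *
    (((x - y)^2 - 1) / 4) ^ i *
    (if j + k = N then (\<Prod>m<N. x - z - of_int (int m)) * (x - y - 2 * of_nat N + 1) ^ k else 0)"
proof -
  note hs = complex_algebra_hom_simps [OF hom]
  define f :: "complex \<times> complex \<times> complex \<Rightarrow> complex" where "f = (\<lambda>q. if q = pt (int N) then 1 else 0)"
  have f: "f (pt m) = 0" if "m < int N" for m
    using that by (simp add: f_def chain_point_def del: of_int_of_nat_eq)
  define g where "g = lin_app (\<rho> (U_K ^ k)) f"
  define W where "W = (\<Prod>i<k. x - z - of_int (int N - 1 - int i)) * (x - y - 2 * of_nat N + 1) ^ k"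
  have g: "g (pt m) = 0" if "m < int N - int k" for m
    using assms(1) K_top(1) [of "int N" f m] f that by (auto simp: g_def hs)
  have gW: "g (pt (int N - int k)) = W"
    using assms(1) K_top(2) [of "int N" f] f by (auto simp: g_def hs W_def f_def)
  have pt0: "pt 0 = (x, y, z)" by (simp add: chain_point_def)
  note ev = eigenvalue_power [OF hom gt_rep_values(1) [OF hom gt generic]]
    eigenvalue_power [OF hom gt_rep_values(2) [OF hom gt generic]]
    eigenvalue_power [OF hom gt_rep_values(3) [OF hom gt generic]]
    eigenvalue_power [OF hom gt_rep_values(4) [OF hom gt generic]]
    eigenvalue_power [OF hom gt_rep_values(5) [OF hom gt generic]]
  have "lin_app (\<rho> (basis_monomial (\<alpha>, \<beta>, c, d, i, j, k))) f (pt 0) =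
    ((2 * z - x - y - 1) / 2) ^ \<alpha> * ((2 * x + 2 * y - z + 2) / 2) ^ \<beta> * c2 ^ c * c3 ^ d *
    (((x - y)^2 - 1) / 4) ^ i * lin_app (\<rho> (U_Jbar ^ j)) g (pt 0)"
    unfolding pt0 basis_monomial.simps complex_algebra_hom_simps(3) [OF hom] lin_app_simps g_def ev
    by (simp only: mult.assoc)
  moreover have "lin_app (\<rho> (U_Jbar ^ j)) g (pt 0) =
    (if j + k = N then (\<Prod>m<N. x - z - of_int (int m)) * (x - y - 2 * of_nat N + 1) ^ k else 0)"
  proof (cases "j + k = N")
    case True
    then have "lin_app (\<rho> (U_Jbar ^ j)) g (pt 0) = (\<Prod>i<j. x - z - of_int (int j - 1 - int i)) * W"
      using Jbar_power_top [of "int N - int k" g j] g gW by auto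
    also have "\<dots> = (\<Prod>m<N. x - z - of_int (int m)) * (x - y - 2 * of_nat N + 1) ^ k"
    proof -
      have "(\<Prod>i<j. x - z - of_int (int j - 1 - int i)) = (\<Prod>m<j. x - z - of_int (int m))"
        by (rule prod.reindex_bij_witness [of _ "\<lambda>i. j - 1 - i" "\<lambda>i. j - 1 - i"]) auto
      moreover have "N = j \<or> N = Suc j" using True assms(1) by auto
      ultimately show ?thesis using True assms(1) by (auto simp: W_def mult_ac)
    qed
    finally show ?thesis using True by simp
  next
    case False
    then have "0 < int N - int k - int j" using assms(2) by linarith
    then show ?thesis
      using Jbar_power_top [of "int N - int k" g j] g False by auto
  qed
  ultimately show ?thesis by (simp add: f_def)
qed

end

lemma complex_algebra_hom_sum:
  assumes "complex_algebra_hom f"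
  shows "f (\<Sum>i\<in>S. g i) = (\<Sum>i\<in>S. f (g i))"
  by (induction S rule: infinite_finite_induct) (simp_all add: complex_algebra_hom_simps [OF assms])

lemma infinite_non_integers: "infinite {s :: complex. u - s \<notin> \<int>}"
proof
  assume "finite {s :: complex. u - s \<notin> \<int>}"
  moreover have "range (\<lambda>n. u - \<i> * of_nat (Suc n)) \<subseteq> {s. u - s \<notin> \<int>}"
    by (auto elim!: Ints_cases simp: complex_eq_iff)
  ultimately have "finite (range (\<lambda>n. u - \<i> * of_nat (Suc n)))"
    by (rule rev_finite_subset)
  moreover have "inj (\<lambda>n. u - \<i> * of_nat (Suc n))"
    by (rule injI) simp
  ultimately show False
    using range_inj_infinite by blast
qed

text \<open>The terms with nonzero coefficient and largest j + k = N are isolated by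
  \<open>monomial_top\<close>. The four scalars separate the first four exponents, the degree in t
  separates i and k, and N then gives j.\<close>

lemma basis_monomial_relation_trivial:
  assumes "finite F" "F \<subseteq> basis_exponents" "(\<Sum>e\<in>F. a e *\<^sub>C basis_monomial e) = 0" "e \<in> F"
  shows "a e = 0"
proof (rule ccontr)
  assume "a e \<noteq> 0"
  define E :: "nat \<Rightarrow> nat \<times> nat \<times> nat \<times> nat \<times> nat \<times> nat \<times> nat \<Rightarrow> nat"
    where "E n = (\<lambda>(\<alpha>, \<beta>, c, d, i, j, k). [\<alpha>, \<beta>, c, d, i, j, k] ! n)" for n
  have E [simp]: "E 0 (\<alpha>, \<beta>, c, d, i, j, k) = \<alpha>" "E 1 (\<alpha>, \<beta>, c, d, i, j, k) = \<beta>"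
    "E 2 (\<alpha>, \<beta>, c, d, i, j, k) = c" "E 3 (\<alpha>, \<beta>, c, d, i, j, k) = d" "E 4 (\<alpha>, \<beta>, c, d, i, j, k) = i"
    "E 5 (\<alpha>, \<beta>, c, d, i, j, k) = j" "E 6 (\<alpha>, \<beta>, c, d, i, j, k) = k"
    "E (Suc 0) (\<alpha>, \<beta>, c, d, i, j, k) = \<beta>" for \<alpha> \<beta> c d i j k
    by (simp_all add: E_def)
  have k: "E 6 e \<in> {0, 1}" if "e \<in> F" for e
    using assms(2) that by (cases e) (auto simp: basis_exponents_def)
  define F' where "F' = {e\<in>F. a e \<noteq> 0}"
  define N where "N = Max ((\<lambda>e. E 5 e + E 6 e) ` F')"
  define G where "G = {e\<in>F'. E 5 e + E 6 e = N}"
  have "e \<in> F'" using assms(4) \<open>a e \<noteq> 0\<close> by (simp add: F'_def)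
  then have F': "finite F'" "F' \<noteq> {}" using assms(1) by (simp add: F'_def, blast)
  have N: "E 5 e + E 6 e \<le> N" if "e \<in> F'" for e
    using F' that by (auto simp: N_def)
  have "N \<in> (\<lambda>e. E 5 e + E 6 e) ` F'"
    unfolding N_def using F' by (intro Max_in) auto
  then obtain e0 where e0: "e0 \<in> G" by (auto simp: G_def)
  have finG: "finite G" using F' by (simp add: G_def)
  have sum0: "(\<Sum>e\<in>F'. a e *\<^sub>C basis_monomial e) = 0"
    using assms(1,3) sum.mono_neutral_right [of F F' "\<lambda>e. a e *\<^sub>C basis_monomial e"]
    by (auto simp: F'_def)

  \<comment> \<open>The relation is applied to the function concentrated at the N-th point and
    evaluated at the 0-th. The surviving terms have the common factor W, which can be cancelled
    because x - z is not an integer.\<close>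
  have key: "(\<Sum>e\<in>G. a e * (((2 * z - x - y - 1) / 2) ^ E 0 e * ((2 * x + 2 * y - z + 2) / 2) ^ E 1 e *
      c2 ^ E 2 e * c3 ^ E 3 e * (((x - y)^2 - 1) / 4) ^ E 4 e * (x - y - 2 * of_nat N + 1) ^ E 6 e)) = 0"
    if gen: "x - y \<notin> \<int>" "x - z \<notin> \<int>" for x y z c2 c3 :: complex
  proof -
    obtain \<rho> where \<rho>: "complex_algebra_hom \<rho>" "\<And>i j. \<rho> (U_e i j) = gt_e c2 c3 i j"
      using gt_rep_ex by blast
    interpret gt_point c2 c3 x y z \<rho>
      by unfold_locales (rule \<rho> gen)+
    define W where "W = (\<Prod>m<N. x - z - of_int (int m))"
    let ?v = "\<lambda>e. ((2 * z - x - y - 1) / 2) ^ E 0 e * ((2 * x + 2 * y - z + 2) / 2) ^ E 1 e *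
      c2 ^ E 2 e * c3 ^ E 3 e * (((x - y)^2 - 1) / 4) ^ E 4 e * (x - y - 2 * of_nat N + 1) ^ E 6 e"
    let ?f = "\<lambda>q. if q = pt (int N) then 1 else 0"
    have "W \<noteq> 0"
    proof -
      have "x - z \<noteq> of_int m" for m using gen(2) by auto
      then have "x - z - of_int (int m) \<noteq> 0" for m by (metis right_minus_eq)
      then show ?thesis unfolding W_def prod_zero_iff [OF finite_lessThan] by blast
    qed
    have top: "lin_app (\<rho> (basis_monomial e)) ?f (pt 0) = (if e \<in> G then W * ?v e else 0)"
      if "e \<in> F'" for e
    proof (cases e)
      case (fields \<alpha> \<beta> c d i j k)
      then have "k \<in> {0, 1}" "j + k \<le> N" using N [OF that] k [of e] that by (auto simp: F'_def)
      from monomial_top [OF this, of \<alpha> \<beta> c d i] show ?thesis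
        using fields that by (simp add: G_def W_def)
    qed
    have "0 = lin_app (\<rho> (\<Sum>e\<in>F'. a e *\<^sub>C basis_monomial e)) ?f (pt 0)"
      by (simp add: sum0 complex_algebra_hom_simps [OF hom])
    also have "\<dots> = (\<Sum>e\<in>F'. a e * lin_app (\<rho> (basis_monomial e)) ?f (pt 0))"
      by (simp add: complex_algebra_hom_sum [OF hom] complex_algebra_hom_simps [OF hom] lin_app_sum)
    also have "\<dots> = (\<Sum>e\<in>F'. if e \<in> G then a e * (W * ?v e) else 0)"
      by (intro sum.cong) (simp_all add: top)
    also have "\<dots> = (\<Sum>e\<in>F' \<inter> G. a e * (W * ?v e))"
      by (rule sum.inter_restrict [symmetric]) (rule F'(1))
    also have "F' \<inter> G = G" by (auto simp: G_def)
    also have "(\<Sum>e\<in>G. a e * (W * ?v e)) = W * (\<Sum>e\<in>G. a e * ?v e)"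
      by (simp add: sum_distrib_left mult_ac)
    finally show ?thesis using \<open>W \<noteq> 0\<close> by simp
  qed

  have "(\<Sum>e\<in>G. a e * (h1 ^ E 0 e * h2 ^ E 1 e * c2 ^ E 2 e * c3 ^ E 3 e *
      ((t^2 - 1) / 4) ^ E 4 e * (t - 2 * of_nat N + 1) ^ E 6 e)) = 0"
    if "t \<notin> \<int>" "(t - 1) / 2 - h1 \<notin> \<int>" for t h1 h2 c2 c3 :: complex
  proof -
    \<comment> \<open>With s = x + y, these are the solutions of (2 z - s - 1) / 2 = h1 and (2 s - z
      + 2) / 2 = h2, so that H1 and H2 act by prescribed scalars. Then x - z = (t - 1) / 2 -
      h1.\<close>
    define s where "s = (2 * h1 + 4 * h2 - 3) / 3"
    define z where "z = 2 * s - 2 * h2 + 2"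
    have eqs: "(s + t) / 2 - (s - t) / 2 = t" "(s + t) / 2 - z = (t - 1) / 2 - h1"
      "(2 * z - (s + t) / 2 - (s - t) / 2 - 1) / 2 = h1"
      "(2 * ((s + t) / 2) + 2 * ((s - t) / 2) - z + 2) / 2 = h2"
      by (simp_all add: z_def s_def field_simps)
    show ?thesis
      using key [of "(s + t) / 2" "(s - t) / 2" z c2 c3] that unfolding eqs by simp
  qed
  \<comment> \<open>Coefficients are compared in c3, c2, h2 and h1, in this order. For fixed t the
    first three range over all complex numbers; h1 only has to avoid a translate of the
    integers.\<close>
  then have "(\<Sum>e\<in>G. (a e * h1 ^ E 0 e * h2 ^ E 1 e * c2 ^ E 2 e *
      ((t^2 - 1) / 4) ^ E 4 e * (t - 2 * of_nat N + 1) ^ E 6 e) * c3 ^ E 3 e) = 0"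
    if "t \<notin> \<int>" "(t - 1) / 2 - h1 \<notin> \<int>" for t h1 h2 c2 c3 :: complex
    using that by (simp add: mult_ac)
  from vanishing_power_sum [OF finG infinite_UNIV_char_0 this, where m = "E 3 e0"]
  have "(\<Sum>e\<in>{e\<in>G. E 3 e = E 3 e0}. (a e * h1 ^ E 0 e * h2 ^ E 1 e *
      ((t^2 - 1) / 4) ^ E 4 e * (t - 2 * of_nat N + 1) ^ E 6 e) * c2 ^ E 2 e) = 0"
    if "t \<notin> \<int>" "(t - 1) / 2 - h1 \<notin> \<int>" for t h1 h2 c2 :: complex
    using that by (simp add: mult_ac)
  from vanishing_power_sum [OF _ infinite_UNIV_char_0 this, where m = "E 2 e0"] finG
  have "(\<Sum>e\<in>{e\<in>G. E 3 e = E 3 e0 \<and> E 2 e = E 2 e0}. (a e * h1 ^ E 0 e *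
      ((t^2 - 1) / 4) ^ E 4 e * (t - 2 * of_nat N + 1) ^ E 6 e) * h2 ^ E 1 e) = 0"
    if "t \<notin> \<int>" "(t - 1) / 2 - h1 \<notin> \<int>" for t h1 h2 :: complex
    using that by (simp add: mult_ac conj_assoc)
  from vanishing_power_sum [OF _ infinite_UNIV_char_0 this, where m = "E 1 e0"] finG
  have "(\<Sum>e\<in>{e\<in>G. E 3 e = E 3 e0 \<and> E 2 e = E 2 e0 \<and> E 1 e = E 1 e0}. (a e *
      ((t^2 - 1) / 4) ^ E 4 e * (t - 2 * of_nat N + 1) ^ E 6 e) * h1 ^ E 0 e) = 0"
    if "t \<notin> \<int>" "h1 \<in> {h. (t - 1) / 2 - h \<notin> \<int>}" for t h1 :: complex
    using that by (simp add: mult_ac conj_assoc)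
  from vanishing_power_sum [OF _ infinite_non_integers this, where m = "E 0 e0"] finG
  have t: "(\<Sum>e\<in>{e\<in>G. E 3 e = E 3 e0 \<and> E 2 e = E 2 e0 \<and> E 1 e = E 1 e0 \<and> E 0 e = E 0 e0}. a e *
      (((t^2 - 1) / 4) ^ E 4 e * (t - 2 * of_nat N + 1) ^ E 6 e)) = 0"
    if "t \<notin> \<int>" for t :: complex
    using that by (simp add: mult_ac conj_assoc)

  define H where "H = {e\<in>G. E 3 e = E 3 e0 \<and> E 2 e = E 2 e0 \<and> E 1 e = E 1 e0 \<and> E 0 e = E 0 e0}"
  define p :: "nat \<times> nat \<times> nat \<times> nat \<times> nat \<times> nat \<times> nat \<Rightarrow> complex poly"
    where "p e = [:- 1 / 4, 0, 1 / 4:] ^ E 4 e * [:1 - 2 * of_nat N, 1:] ^ E 6 e" for e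
  have deg: "degree (p e) = 2 * E 4 e + E 6 e" for e
    by (simp add: p_def degree_mult_eq degree_power_eq)
  have "a e0 = 0"
  proof (rule distinct_degrees_independent [of H p a e0])
    show "finite H" using finG by (simp add: H_def)
    show "inj_on (degree \<circ> p) H"
    proof (rule inj_onI)
      fix u v assume uv: "u \<in> H" "v \<in> H" "(degree \<circ> p) u = (degree \<circ> p) v"
      then have "u \<in> F" "v \<in> F" by (simp_all add: H_def G_def F'_def)
      then have "E 6 u \<in> {0, 1}" "E 6 v \<in> {0, 1}" using k by blast+
      \<comment> \<open>The degree is 2 i + k with k at most 1, so its parity is k and the rest
        determines i.\<close>
      then have "E 6 u = E 6 v" "E 4 u = E 4 v" using uv(3) by (auto simp: deg; presburger)+
      moreover have "E 5 u + E 6 u = E 5 v + E 6 v" using uv by (simp add: H_def G_def)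
      ultimately show "u = v"
        using uv(1,2) by (cases u; cases v) (simp add: H_def)
    qed
    show "p e \<noteq> 0" for e by (simp add: p_def)
    have "poly (\<Sum>e\<in>H. smult (a e) (p e)) s = (\<Sum>e\<in>H. a e *
      (((s^2 - 1) / 4) ^ E 4 e * (s - 2 * of_nat N + 1) ^ E 6 e))" for s
      by (simp add: poly_sum p_def poly_power algebra_simps power2_eq_square diff_divide_distrib)
    then have "{s. 0 - s \<notin> \<int>} \<subseteq> {s. poly (\<Sum>e\<in>H. smult (a e) (p e)) s = 0}"
      using t by (auto simp: H_def)
    then show "(\<Sum>e\<in>H. smult (a e) (p e)) = 0"
      using infinite_non_integers [of 0] poly_roots_finite finite_subset by blast
    show "e0 \<in> H" using e0 by (simp add: H_def)
  qed
  with e0 show False by (simp add: G_def F'_def)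
qed

lemma basis_monomial_inj: "inj_on basis_monomial basis_exponents"
proof (rule inj_onI, rule ccontr)
  fix u v assume uv: "u \<in> basis_exponents" "v \<in> basis_exponents" "basis_monomial u = basis_monomial v" "u \<noteq> v"
  then have "(\<Sum>e\<in>{u, v}. (if e = u then 1 else - 1) *\<^sub>C basis_monomial e) = 0"
    by (simp add: scaleC_one)
  from basis_monomial_relation_trivial [OF _ _ this, of u] uv show False by simp
qed

lemma basis_monomial_independent: "complex_vector.independent (basis_monomial ` basis_exponents)"
  unfolding complex_vector.independent_explicit_module
proof (intro allI impI)
  fix S a v
  assume S: "finite S" "S \<subseteq> basis_monomial ` basis_exponents" "(\<Sum>v\<in>S. a v *\<^sub>C v) = 0" "v \<in> S"
  obtain F where F: "F \<subseteq> basis_exponents" "finite F" "S = basis_monomial ` F"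
    using S(1,2) by (meson finite_subset_image)
  have inj: "inj_on basis_monomial F"
    using basis_monomial_inj F(1) by (rule inj_on_subset)
  have "(\<Sum>e\<in>F. a (basis_monomial e) *\<^sub>C basis_monomial e) = 0"
    using S(3) unfolding F(3) by (simp add: sum.reindex [OF inj])
  moreover obtain e where "e \<in> F" "v = basis_monomial e" using S(4) F(3) by blast
  ultimately show "a v = 0"
    using basis_monomial_relation_trivial [OF F(2,1), of "\<lambda>e. a (basis_monomial e)" e] by simp
qed

section \<open>Words modulo shorter words\<close>

text \<open>Besides the degree a weight is kept, since the induction for the centralizer needs
  corrections of weight zero. The presented algebra uses the same locale with all weights 0.\<close>

locale filtered_words =
  fixes val :: "'g \<Rightarrow> 'a::complex_algebra_1" and deg :: "'g \<Rightarrow> nat" and wt :: "'g \<Rightarrow> complex"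
begin

definition wval :: "'g list \<Rightarrow> 'a" where "wval l = prod_list (map val l)"
definition wdeg :: "'g list \<Rightarrow> nat" where "wdeg l = sum_list (map deg l)"
definition wwt :: "'g list \<Rightarrow> complex" where "wwt l = sum_list (map wt l)"

definition lower :: "complex \<Rightarrow> nat \<Rightarrow> 'a set"
  where "lower b n = complex_vector.span (wval ` {l. wdeg l < n \<and> wwt l = b})"

lemma word_simps [simp]:
  "wval [] = 1" "wval (g # l) = val g * wval l" "wval (l @ m) = wval l * wval m"
  "wdeg [] = 0" "wdeg (g # l) = deg g + wdeg l" "wdeg (l @ m) = wdeg l + wdeg m"
  "wwt [] = 0" "wwt (g # l) = wt g + wwt l" "wwt (l @ m) = wwt l + wwt m"
  by (simp_all add: wval_def wdeg_def wwt_def)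

lemma word_mset_cong:
  assumes "mset l = mset m"
  shows "wdeg l = wdeg m" "wwt l = wwt m"
  unfolding wdeg_def wwt_def by (metis assms mset_map sum_mset_sum_list)+

lemma lower_mult: "x \<in> lower b n \<Longrightarrow> wval u * x * wval v \<in> lower (wwt u + b + wwt v) (wdeg u + n + wdeg v)"
  unfolding lower_def
proof (induction rule: complex_vector.span_induct_alt)
  case base
  show ?case by (simp add: complex_vector.span_zero)
next
  case (step c x y)
  then obtain l where l: "x = wval l" "wdeg l < n" "wwt l = b" by auto
  have "wval u * x * wval v = wval (u @ l @ v)" by (simp add: l mult.assoc)
  moreover have "wval (u @ l @ v) \<in> wval ` {l. wdeg l < wdeg u + n + wdeg v \<and> wwt l = wwt u + b + wwt v}"
    using l by (intro imageI) simp
  ultimately have "c *\<^sub>C (wval u * x * wval v) + wval u * y * wval v \<in>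
      complex_vector.span (wval ` {l. wdeg l < wdeg u + n + wdeg v \<and> wwt l = wwt u + b + wwt v})"
    using step.IH by (simp add: complex_vector.span_add complex_vector.span_base complex_vector.span_scale)
  then show ?case
    by (simp add: distrib_left distrib_right mult_scaleC_left mult_scaleC_right)
qed

lemma lower_add: "x \<in> lower b n \<Longrightarrow> y \<in> lower b n \<Longrightarrow> x + y \<in> lower b n"
  unfolding lower_def by (rule complex_vector.span_add)

lemma lower_uminus: "x \<in> lower b n \<Longrightarrow> - x \<in> lower b n"
  unfolding lower_def by (rule complex_vector.span_neg)

end

locale almost_commuting_words = filtered_words +
  assumes letters_commute: "val g * val h - val h * val g \<in> lower (wt g + wt h) (deg g + deg h)"
begin

lemma letter_word_commute:
  "val g * wval u - wval u * val g \<in> lower (wt g + wwt u) (deg g + wdeg u)"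
proof (induction u)
  case Nil
  show ?case by (simp add: lower_def complex_vector.span_zero)
next
  case (Cons h u)
  have "(val g * val h - val h * val g) * wval u \<in> lower (wt g + wt h + wwt u) (deg g + deg h + wdeg u)"
    using lower_mult [OF letters_commute, of "[]" g h u] by simp
  moreover have "val h * (val g * wval u - wval u * val g) \<in> lower (wt h + (wt g + wwt u)) (deg h + (deg g + wdeg u))"
    using lower_mult [OF Cons, of "[h]" "[]"] by simp
  ultimately have "(val g * val h - val h * val g) * wval u + val h * (val g * wval u - wval u * val g)
      \<in> lower (wt g + (wt h + wwt u)) (deg g + (deg h + wdeg u))"
    by (intro lower_add) (simp_all add: algebra_simps)
  then show ?case by (simp add: algebra_simps)
qed

text \<open>Commutativity of the associated graded algebra: the first letter of \<open>l\<close> is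
  carried past the prefix that precedes it in \<open>m\<close>, at the cost of terms of lower degree
  and equal weight.\<close>

lemma word_permute: "mset l = mset m \<Longrightarrow> wval l - wval m \<in> lower (wwt l) (wdeg l)"
proof (induction l arbitrary: m)
  case Nil
  then show ?case by (simp add: lower_def complex_vector.span_zero)
next
  case (Cons g u)
  then have "g \<in> set m" by (metis list.set_intros(1) set_mset_mset)
  then obtain a b where m: "m = a @ g # b" by (meson split_list)
  with Cons.prems have ab: "mset u = mset (a @ b)" by simp
  then have "wdeg u = wdeg (a @ b)" "wwt u = wwt (a @ b)" by (rule word_mset_cong)+
  have "val g * (wval u - wval (a @ b)) \<in> lower (wt g + wwt u) (deg g + wdeg u)"
    using lower_mult [OF Cons.IH [OF ab], of "[g]" "[]"] by simp
  moreover have "(val g * wval a - wval a * val g) * wval b \<in> lower (wt g + wwt a + wwt b) (deg g + wdeg a + wdeg b)"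
    using lower_mult [OF letter_word_commute, of "[]" g a b] by simp
  ultimately have "val g * (wval u - wval (a @ b)) + (val g * wval a - wval a * val g) * wval b \<in>
      lower (wt g + wwt u) (deg g + wdeg u)"
    using \<open>wdeg u = _\<close> \<open>wwt u = _\<close> by (intro lower_add) (simp_all add: add.assoc)
  then show ?case by (simp add: m algebra_simps)
qed

end

section \<open>The algebra given by the defining relations is spanned by the monomials\<close>

text \<open>The degrees of the corresponding elements of the enveloping algebra. They fit the
  relations: [J, Jbar] = K has degree 3 < 4, [J, K] and [K, Jbar] have degree at most 4 < 5, and all
  terms of the cubic relation have degree at most 6.\<close>

fun zdeg :: "zgen \<Rightarrow> nat" where
  "zdeg GH1 = 1" | "zdeg GH2 = 1" | "zdeg GC2 = 2" | "zdeg GC3 = 3"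
| "zdeg GJ = 2" | "zdeg GJbar = 2" | "zdeg GK = 3"

interpretation Zw: filtered_words "gen :: zgen \<Rightarrow> Z_algebra" zdeg "\<lambda>_. 0" .

text \<open>The second argument is the set of letters allowed in the words: the cubic relation expresses
  \<open>K\<^sup>2\<close> through words without \<open>K\<close>.\<close>

definition zspan :: "nat \<Rightarrow> zgen set \<Rightarrow> Z_algebra set"
  where "zspan n S = complex_vector.span (Zw.wval ` {l. Zw.wdeg l \<le> n \<and> set l \<subseteq> S})"

lemma zspan_mono: "x \<in> zspan m S \<Longrightarrow> m \<le> n \<Longrightarrow> S \<subseteq> S' \<Longrightarrow> x \<in> zspan n S'"
  unfolding zspan_def by (rule subsetD [OF complex_vector.span_mono]) auto

lemma zspan_add: "x \<in> zspan n S \<Longrightarrow> y \<in> zspan n S \<Longrightarrow> x + y \<in> zspan n S"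
  and zspan_diff: "x \<in> zspan n S \<Longrightarrow> y \<in> zspan n S \<Longrightarrow> x - y \<in> zspan n S"
  and zspan_scale: "x \<in> zspan n S \<Longrightarrow> c *\<^sub>C x \<in> zspan n S"
  unfolding zspan_def
  by (rule complex_vector.span_add complex_vector.span_diff complex_vector.span_scale; assumption)+

lemma zspan_gen: "g \<in> S \<Longrightarrow> zdeg g \<le> n \<Longrightarrow> gen g \<in> zspan n S"
  unfolding zspan_def by (rule complex_vector.span_base, rule image_eqI [of _ _ "[g]"]) auto

lemma zspan_1: "1 \<in> zspan n S"
  unfolding zspan_def by (rule complex_vector.span_base, rule image_eqI [of _ _ "[]"]) auto

lemma zspan_numeral: "numeral k \<in> zspan n S"
  unfolding numeral_eq_scaleC [of k, where 'a = Z_algebra] by (rule zspan_scale [OF zspan_1])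

lemma zspan_mult: "x \<in> zspan m S \<Longrightarrow> y \<in> zspan n S \<Longrightarrow> m + n \<le> k \<Longrightarrow> x * y \<in> zspan k S"
proof -
  assume x: "x \<in> zspan m S" and y: "y \<in> zspan n S" and k: "m + n \<le> k"
  have word: "Zw.wval l * y \<in> zspan k S" if l: "Zw.wdeg l \<le> m" "set l \<subseteq> S" for l
    using y unfolding zspan_def [of n]
  proof (induction rule: complex_vector.span_induct_alt)
    case base
    show ?case by (simp add: zspan_def complex_vector.span_zero)
  next
    case (step c u y)
    then obtain v where v: "u = Zw.wval v" "Zw.wdeg v \<le> n" "set v \<subseteq> S" by auto
    then have "Zw.wval (l @ v) \<in> zspan k S"
      unfolding zspan_def using l k by (intro complex_vector.span_base imageI) auto
    with step.IH show ?case
      by (simp add: v distrib_left mult_scaleC_right zspan_add zspan_scale)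
  qed
  from x show "x * y \<in> zspan k S"
    unfolding zspan_def [of m]
  proof (induction rule: complex_vector.span_induct_alt)
    case base
    show ?case by (simp add: zspan_def complex_vector.span_zero)
  next
    case (step c u x)
    then show ?case
      using word by (auto simp: distrib_right mult_scaleC_left intro!: zspan_add zspan_scale)
  qed
qed

lemma zspan_power: "x \<in> zspan m S \<Longrightarrow> m * k \<le> n \<Longrightarrow> x ^ k \<in> zspan n S"
proof (induction k arbitrary: n)
  case (Suc k)
  then have "x ^ k \<in> zspan (m * k) S" by simp
  with Suc.prems show ?case by (simp add: zspan_mult)
qed (simp add: zspan_1)

abbreviation "pc \<equiv> presented_class :: zgen free_algebra \<Rightarrow> Z_algebra"

lemmas pc_simps = complex_algebra_hom_simps [OF presented_class_hom] presented_class_gen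

lemma zspan_h: "GH2 \<in> S \<Longrightarrow> pc z_h \<in> zspan 1 S"
  by (simp add: z_h_def pc_simps zspan_gen)

lemma zspan_y: "GH1 \<in> S \<Longrightarrow> GH2 \<in> S \<Longrightarrow> pc z_y \<in> zspan 1 S"
  unfolding z_y_def pc_simps
  by (intro zspan_scale zspan_add zspan_mult [of _ 0 _ _ 1] zspan_numeral zspan_gen) simp_all

lemma zspan_a:
  assumes "{GH1, GH2, GC2} \<subseteq> S"
  shows "pc z_a \<in> zspan 2 S"
proof -
  have "pc z_h ^ 2 \<in> zspan 2 S" "pc z_y ^ 2 \<in> zspan 2 S"
    using assms by (auto intro!: zspan_power [of _ 1] zspan_h zspan_y)
  then show ?thesis
    using assms unfolding z_a_def pc_simps
    by (intro zspan_add zspan_mult [of _ 0 _ _ 2] zspan_numeral zspan_gen) simp_all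
qed

lemma zspan_b:
  assumes "{GH1, GH2, GC2, GC3} \<subseteq> S"
  shows "pc z_b_plus \<in> zspan 4 S" "pc z_b_minus \<in> zspan 4 S"
proof -
  have h: "pc z_h \<in> zspan 1 S" and y: "pc z_y \<in> zspan 1 S" 
    using assms by (simp_all del: One_nat_def add: zspan_h zspan_y)
  have C: "gen GC2 \<in> zspan 2 S" "gen GC3 \<in> zspan 3 S" using assms by (auto intro: zspan_gen)
  have "3 * pc z_y \<in> zspan 1 S"
    using zspan_mult [OF zspan_numeral [of _ 0] y] by simp
  then have "3 * pc z_y - pc z_h \<in> zspan 1 S" "3 * pc z_y + pc z_h \<in> zspan 1 S"
    using h by (auto intro: zspan_add zspan_diff)
  moreover have "(2 - pc z_y - pc z_h) * gen GC2 \<in> zspan 3 S" "(2 - pc z_y + pc z_h) * gen GC2 \<in> zspan 3 S"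
    by (rule zspan_mult [of _ 1 _ _ 2]; (intro zspan_add zspan_diff zspan_numeral h y C)?; simp)+
  moreover have "(pc z_y - 2 + pc z_h) * (pc z_y + 2 + pc z_h) * (pc z_y + pc z_h) \<in> zspan 3 S"
    "(pc z_y - 2 - pc z_h) * (pc z_y + 2 - pc z_h) * (pc z_y - pc z_h) \<in> zspan 3 S"
    by (rule zspan_mult [of _ 2 _ _ 1], rule zspan_mult [of _ 1 _ _ 1];
        (intro zspan_add zspan_diff zspan_numeral h y)?; simp)+
  ultimately show "pc z_b_plus \<in> zspan 4 S" "pc z_b_minus \<in> zspan 4 S"
    unfolding z_b_plus_def z_b_minus_def pc_simps using C(2)
    by (auto intro!: zspan_mult [of _ 1 _ _ 3] zspan_add zspan_diff zspan_scale simp del: One_nat_def)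
qed

lemma z_relations:
  fixes J Jb K :: Z_algebra
  defines "J \<equiv> gen GJ" and "Jb \<equiv> gen GJbar" and "K \<equiv> gen GK"
  shows "J * Jb - Jb * J = K"
    and "J * K - K * J = 2 * J^2 + 2 * (J * Jb + Jb * J) - pc z_a * J + pc z_b_plus"
    and "K * Jb - Jb * K = 2 * Jb^2 + 2 * (J * Jb + Jb * J) - pc z_a * Jb + pc z_b_minus"
    and "K^2 = 2 * (J^2 * Jb + Jb * J^2) + 2 * (J * Jb^2 + Jb^2 * J) - 4 * (J + Jb)^2
      - pc z_a * (J * Jb + Jb * J) + 2 * (pc z_b_minus + pc z_a) * J + 2 * (pc z_b_plus + pc z_a) * Jb
      - pc z_cubic_rhs"
proof -
  have "z_K - commutator z_J z_Jbar \<in> relators"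
    "commutator z_J z_K - (2 * z_J^2 + 2 * anticommutator z_J z_Jbar - z_a * z_J + z_b_plus) \<in> relators"
    "commutator z_K z_Jbar - (2 * z_Jbar^2 + 2 * anticommutator z_J z_Jbar - z_a * z_Jbar + z_b_minus) \<in> relators"
    "z_cubic_lhs - z_cubic_rhs \<in> relators"
    unfolding relators_zgen_def by blast+
  note rel = this [THEN presented_class_relator, unfolded commutator_def anticommutator_def z_cubic_lhs_def pc_simps,
      folded J_def Jb_def K_def]
  show "J * Jb - Jb * J = K"
    using rel(1) by simp
  show "J * K - K * J = 2 * J^2 + 2 * (J * Jb + Jb * J) - pc z_a * J + pc z_b_plus"
    using rel(2) by simp
  show "K * Jb - Jb * K = 2 * Jb^2 + 2 * (J * Jb + Jb * J) - pc z_a * Jb + pc z_b_minus"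
    using rel(3) by simp
  show "K^2 = 2 * (J^2 * Jb + Jb * J^2) + 2 * (J * Jb^2 + Jb^2 * J) - 4 * (J + Jb)^2
      - pc z_a * (J * Jb + Jb * J) + 2 * (pc z_b_minus + pc z_a) * J + 2 * (pc z_b_plus + pc z_a) * Jb
      - pc z_cubic_rhs"
    using rel(4) by (simp add: algebra_simps)
qed

lemma z_central:
  assumes "g \<in> {GH1, GH2, GC2, GC3}"
  shows "gen g * x = x * (gen g :: Z_algebra)"
proof (rule presented_commute)
  fix h
  have "commutator (free_gen g) (free_gen h) \<in> relators"
    unfolding relators_zgen_def using assms by blast
  from presented_class_relator [OF this] show "gen g * gen h = gen h * (gen g :: Z_algebra)"
    by (simp add: commutator_def pc_simps)
qed

lemma Zw_lower: "Zw.lower 0 (Suc n) = zspan n UNIV"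
proof -
  have "Zw.wwt l = 0" for l by (induction l) simp_all
  then show ?thesis by (simp add: Zw.lower_def zspan_def less_Suc_eq_le)
qed

text \<open>The cubic relation solved for the square of K. The bound 6 equals the degree of that
  square, so what decreases is not the degree but the number of letters K.\<close>

lemma zspan_6: "gen GK ^ 2 \<in> zspan 6 (- {GK})"
proof -
  let ?S = "- {GK}"
  have gens: "gen GJ \<in> zspan 2 ?S" "gen GJbar \<in> zspan 2 ?S" "gen GC2 \<in> zspan 2 ?S" "gen GC3 \<in> zspan 3 ?S"
    by (auto intro: zspan_gen)
  have h: "pc z_h \<in> zspan 1 ?S" and y: "pc z_y \<in> zspan 1 ?S"
    by (rule zspan_h zspan_y; simp)+
  have a: "pc z_a \<in> zspan 2 ?S" by (rule zspan_a) simp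
  have b: "pc z_b_plus \<in> zspan 4 ?S" "pc z_b_minus \<in> zspan 4 ?S" by (rule zspan_b; simp)+
  note num = zspan_numeral [of _ 0] zspan_1 [of 0]
  have h2: "pc z_h ^ 2 \<in> zspan 2 ?S" and y2: "pc z_y ^ 2 \<in> zspan 2 ?S"
    using zspan_power [OF h, of 2] zspan_power [OF y, of 2] by simp_all
  have JJ: "gen GJ ^ 2 \<in> zspan 4 ?S" "gen GJbar ^ 2 \<in> zspan 4 ?S"
    using zspan_power [OF gens(1), of 2] zspan_power [OF gens(2), of 2] by simp_all
  have JJb: "gen GJ * gen GJbar + gen GJbar * gen GJ \<in> zspan 4 ?S"
    using gens by (auto intro!: zspan_add zspan_mult [of _ 2])
  have sq: "(gen GJ + gen GJbar) ^ 2 \<in> zspan 4 ?S"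
    using gens by (auto intro!: zspan_power [of _ 2] zspan_add)
  have two: "numeral k * x \<in> zspan n ?S" if "x \<in> zspan n ?S" for k x n
    using zspan_mult [OF num(1) that, of n] by simp
  have lhs: "2 * (gen GJ ^ 2 * gen GJbar + gen GJbar * gen GJ ^ 2) \<in> zspan 6 ?S"
    "2 * (gen GJ * gen GJbar ^ 2 + gen GJbar ^ 2 * gen GJ) \<in> zspan 6 ?S"
    "4 * (gen GJ + gen GJbar) ^ 2 \<in> zspan 6 ?S"
    "pc z_a * (gen GJ * gen GJbar + gen GJbar * gen GJ) \<in> zspan 6 ?S"
    "2 * (pc z_b_minus + pc z_a) * gen GJ \<in> zspan 6 ?S"
    "2 * (pc z_b_plus + pc z_a) * gen GJbar \<in> zspan 6 ?S"
  proof -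
    show "2 * (gen GJ ^ 2 * gen GJbar + gen GJbar * gen GJ ^ 2) \<in> zspan 6 ?S"
      by (intro two zspan_add zspan_mult [OF JJ(1) gens(2)] zspan_mult [OF gens(2) JJ(1)]) simp_all
    show "2 * (gen GJ * gen GJbar ^ 2 + gen GJbar ^ 2 * gen GJ) \<in> zspan 6 ?S"
      by (intro two zspan_add zspan_mult [OF JJ(2) gens(1)] zspan_mult [OF gens(1) JJ(2)]) simp_all
    show "4 * (gen GJ + gen GJbar) ^ 2 \<in> zspan 6 ?S"
      by (rule two, rule zspan_mono [OF sq]) simp_all
    show "pc z_a * (gen GJ * gen GJbar + gen GJbar * gen GJ) \<in> zspan 6 ?S"
      by (rule zspan_mult [OF a JJb]) simp
    have ba: "pc z_b_minus + pc z_a \<in> zspan 4 ?S" "pc z_b_plus + pc z_a \<in> zspan 4 ?S"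
      using zspan_mono [OF a, of 4] b by (auto intro!: zspan_add)
    show "2 * (pc z_b_minus + pc z_a) * gen GJ \<in> zspan 6 ?S"
      by (rule zspan_mult [OF two [OF ba(1)] gens(1)]) simp
    show "2 * (pc z_b_plus + pc z_a) * gen GJbar \<in> zspan 6 ?S"
      by (rule zspan_mult [OF two [OF ba(2)] gens(2)]) simp
  qed
  have "pc z_cubic_rhs \<in> zspan 6 ?S"
  proof -
    have f1: "(pc z_y ^ 2 + pc z_h ^ 2) ^ 2 * (1 - gen GC2) \<in> zspan 6 ?S"
      by (rule zspan_mult [OF zspan_power [OF zspan_add [OF y2 h2]] zspan_diff [OF zspan_1 gens(3)], of _ 4]) simp_all
    have f2: "(pc z_h ^ 2 - pc z_y ^ 2) ^ 3 \<in> zspan 6 ?S"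
      by (rule zspan_power [OF zspan_diff [OF h2 y2]]) simp
    have f3: "2 * pc z_h ^ 2 * pc z_y ^ 2 \<in> zspan 6 ?S"
      by (rule zspan_mult [OF two [OF h2] y2]) simp
    have t: "(1/3) *\<^sub>C gen GC3 + 2 * pc z_y + pc z_y * gen GC2 \<in> zspan 3 ?S"
      using gens(4) zspan_mono [OF two [OF y], of 3] zspan_mult [OF y gens(3), of 3]
      by (intro zspan_add zspan_scale) simp_all
    have f4: "((1/3) *\<^sub>C gen GC3 + 2 * pc z_y + pc z_y * gen GC2) *
        ((1/3) *\<^sub>C gen GC3 + 2 * pc z_y + pc z_y * gen GC2 - gen GC2) \<in> zspan 6 ?S"
      by (rule zspan_mult [OF t zspan_diff [OF t zspan_mono [OF gens(3)]]]) simp_all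
    have f5: "pc z_y * (3 * pc z_h ^ 2 - 11 * pc z_y ^ 2) * (3 * gen GC2 - 2 * gen GC3) \<in> zspan 6 ?S"
      by (intro zspan_mult [of _ 3 _ _ 3] zspan_mult [of _ 1 _ _ 2] zspan_diff two h2 y2 y gens(4)
          zspan_mono [OF gens(3)]) simp_all
    have f6: "gen GC2 * (pc z_h ^ 2 + 3 * pc z_y ^ 2) * (5 * pc z_h ^ 2 - pc z_y ^ 2 + 4) \<in> zspan 6 ?S"
      by (intro zspan_mult [of _ 4 _ _ 2] zspan_mult [of _ 2 _ _ 2] zspan_diff zspan_add two h2 y2 gens(3)
          zspan_numeral) simp_all
    show ?thesis
      unfolding z_cubic_rhs_def pc_simps
      by (intro zspan_add zspan_diff zspan_scale f1 f2 f3 f4 f5 f6)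
  qed
  with lhs show ?thesis
    unfolding z_relations(4) by (intro zspan_add zspan_diff)
qed

lemma z_letters_commute:
  "gen g * gen h - gen h * gen g \<in> zspan (zdeg g + zdeg h - 1) UNIV"
proof (cases "g \<in> {GH1, GH2, GC2, GC3} \<or> h \<in> {GH1, GH2, GC2, GC3}")
  case True
  then have "gen g * gen h = gen h * (gen g :: Z_algebra)"
    using z_central by metis
  then show ?thesis by (simp add: zspan_def complex_vector.span_zero)
next
  case False
  have J: "gen GJ \<in> zspan 2 UNIV" "gen GJbar \<in> zspan 2 UNIV"
    by (auto intro: zspan_gen)
  have two: "2 * x \<in> zspan n UNIV" if "x \<in> zspan n UNIV" for x n
    using zspan_mult [OF zspan_numeral [of _ 0] that, of n] by simp
  have a: "pc z_a \<in> zspan 2 UNIV" by (rule zspan_a) simp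
  have b: "pc z_b_plus \<in> zspan 4 UNIV" "pc z_b_minus \<in> zspan 4 UNIV" by (rule zspan_b; simp)+
  have JJb: "gen GJ * gen GJbar - gen GJbar * gen GJ \<in> zspan 3 UNIV"
    unfolding z_relations(1) by (rule zspan_gen) simp_all
  have JK: "gen GJ * gen GK - gen GK * gen GJ \<in> zspan 4 UNIV"
    unfolding z_relations(2) using J a b
    by (intro zspan_add zspan_diff two zspan_power [of _ 2] zspan_mult [of _ 2 _ _ 2]) simp_all
  have KJb: "gen GK * gen GJbar - gen GJbar * gen GK \<in> zspan 4 UNIV"
    unfolding z_relations(3) using J a b
    by (intro zspan_add zspan_diff two zspan_power [of _ 2] zspan_mult [of _ 2 _ _ 2]) simp_all
  have neg: "y - x \<in> zspan n UNIV" if "x - y \<in> zspan n UNIV" for x y n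
    using zspan_scale [OF that, of "- 1"] by (simp add: scaleC_one)
  have zero: "0 \<in> zspan n UNIV" for n by (simp add: zspan_def complex_vector.span_zero)
  show ?thesis
    using False JJb JK KJb neg [OF JJb] neg [OF JK] neg [OF KJb]
    by (cases g; cases h) (simp_all add: zero)
qed

interpretation Zw: almost_commuting_words "gen :: zgen \<Rightarrow> Z_algebra" zdeg "\<lambda>_. 0"
proof
  fix g h
  obtain n where n: "zdeg g + zdeg h = Suc n" by (cases g) auto
  show "gen g * gen h - gen h * gen g \<in> Zw.lower (0 + 0) (zdeg g + zdeg h)"
    using z_letters_commute [of g h] unfolding n by (simp add: Zw_lower)
qed

fun z_monomial :: "nat \<times> nat \<times> nat \<times> nat \<times> nat \<times> nat \<times> nat \<Rightarrow> Z_algebra"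
  where "z_monomial (\<alpha>, \<beta>, c, d, i, j, k) =
    gen GH1 ^ \<alpha> * gen GH2 ^ \<beta> * gen GC2 ^ c * gen GC3 ^ d * gen GJ ^ i * gen GJbar ^ j * gen GK ^ k"

lemma wval_replicate: "Zw.wval (replicate n g) = gen g ^ n"
  by (induction n) simp_all

text \<open>Induction on the degree and, for equal degree, on the number of letters K: sorting
  leaves words of lower degree, and replacing the square of K lowers the second number.\<close>

lemma z_word_span: "Zw.wval l \<in> complex_vector.span (z_monomial ` basis_exponents)"
proof (induction l rule: wf_induct_rule [OF wf_inv_image [where f = "\<lambda>l. (Zw.wdeg l, count_list l GK)",
      OF wf_lex_prod [OF wf_less_than wf_less_than]]])
  case (1 l)
  let ?S = "complex_vector.span (z_monomial ` basis_exponents)"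
  have IH: "Zw.wval m \<in> ?S"
    if "Zw.wdeg m < Zw.wdeg l \<or> Zw.wdeg m = Zw.wdeg l \<and> count_list m GK < count_list l GK" for m
    using 1 that by (simp add: in_inv_image)
  let ?n = "count_list l"
  define u where "u = replicate (?n GH1) GH1 @ replicate (?n GH2) GH2 @ replicate (?n GC2) GC2
    @ replicate (?n GC3) GC3 @ replicate (?n GJ) GJ @ replicate (?n GJbar) GJbar"
  define m where "m = u @ replicate (?n GK) GK"
  have "mset l = mset m"
  proof (rule multiset_eqI)
    fix g show "count (mset l) g = count (mset m) g"
      by (cases g) (simp_all add: m_def u_def count_mset)
  qed
  then have deg: "Zw.wdeg m = Zw.wdeg l" by (rule Zw.word_mset_cong [symmetric])
  have "Zw.wval l - Zw.wval m \<in> Zw.lower (Zw.wwt l) (Zw.wdeg l)"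
    by (rule Zw.word_permute) fact
  moreover have "Zw.lower b (Zw.wdeg l) \<subseteq> ?S" for b
    unfolding Zw.lower_def
    by (rule complex_vector.span_minimal) (use IH in auto)
  ultimately have diff: "Zw.wval l - Zw.wval m \<in> ?S" by blast
  have "Zw.wval m \<in> ?S"
  proof (cases "?n GK \<in> {0, 1}")
    case True
    then have "(?n GH1, ?n GH2, ?n GC2, ?n GC3, ?n GJ, ?n GJbar, ?n GK) \<in> basis_exponents"
      by (simp add: basis_exponents_def)
    then have "z_monomial (?n GH1, ?n GH2, ?n GC2, ?n GC3, ?n GJ, ?n GJbar, ?n GK) \<in> ?S"
      by (intro complex_vector.span_base imageI)
    then show ?thesis by (simp add: m_def u_def wval_replicate mult.assoc)
  next
    case False
    then obtain r where r: "?n GK = r + 2"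
      by (metis add.commute add_2_eq_Suc insertCI not0_implies_Suc numeral_1_eq_Suc_0 numerals(1))
    define m' where "m' = u @ replicate r GK"
    have m': "Zw.wval m = Zw.wval m' * gen GK ^ 2"
      by (simp only: m_def m'_def r Zw.word_simps wval_replicate power_add mult.assoc)
    have deg': "Zw.wdeg m' + 6 = Zw.wdeg l"
      unfolding deg [symmetric] m_def m'_def r by (simp add: Zw.wdeg_def replicate_add)
    have "count_list u GK = 0" by (simp add: u_def count_list_0_iff)
    moreover have "count_list (replicate r GK) GK = r" by (induction r) simp_all
    ultimately have "count_list m' GK = r" by (simp add: m'_def)
    \<comment> \<open>The degree of the new words is at most that of \<open>l\<close>, and their
      number of letters K drops from r + 2 to r.\<close>
    have "Zw.wval m' * q \<in> ?S" if "q \<in> zspan 6 (- {GK})" for q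
      using that unfolding zspan_def
    proof (induction rule: complex_vector.span_induct_alt)
      case base
      show ?case by (simp add: complex_vector.span_zero)
    next
      case (step c w q)
      then obtain v where v: "w = Zw.wval v" "Zw.wdeg v \<le> 6" "set v \<subseteq> - {GK}" by auto
      then have "count_list v GK = 0" by (auto simp: count_list_0_iff)
      then have "Zw.wval (m' @ v) \<in> ?S"
        using v(2) deg' \<open>count_list m' GK = r\<close> r by (intro IH) auto
      with step.IH show ?case
        by (simp add: v(1) distrib_left mult_scaleC_right complex_vector.span_add complex_vector.span_scale)
    qed
    with zspan_6 show ?thesis by (simp add: m')
  qed
  with diff show "Zw.wval l \<in> ?S"
    using complex_vector.span_add by fastforce
qed

lemma z_span: "x \<in> complex_vector.span (z_monomial ` basis_exponents)"
proof -
  have "complex_vector.span (range (\<lambda>w. prod_list (map gen w))) \<subseteq> complex_vector.span (z_monomial ` basis_exponents)"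
    by (rule complex_vector.span_minimal) (use z_word_span in \<open>auto simp: Zw.wval_def\<close>)
  then show ?thesis using presented_words_span [of x] by blast
qed

section \<open>The centralizer of the Cartan subalgebra\<close>

fun z_image :: "zgen \<Rightarrow> U_sl3" where
  "z_image GH1 = U_H1" | "z_image GH2 = U_H2" | "z_image GC2 = U_C2" | "z_image GC3 = U_C3"
| "z_image GJ = U_J" | "z_image GJbar = U_Jbar" | "z_image GK = U_K"

lemma z_image_relators: "r \<in> relators \<Longrightarrow> free_lift z_image r = 0"
proof -
  note hs = complex_algebra_hom_simps [OF free_lift_hom]
  have h: "free_lift z_image z_h = U_H2" by (simp add: z_h_def)
  have y: "free_lift z_image z_y = U_y" by (simp add: z_y_def hs U_y_eq)
  have a: "free_lift z_image z_a = U_a" by (simp add: z_a_def hs h y U_a_def)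
  have b: "free_lift z_image z_b_plus = U_b_plus" "free_lift z_image z_b_minus = U_b_minus"
    by (simp_all only: z_b_plus_def z_b_minus_def hs h y U_b_plus_def U_b_minus_def free_lift_gen z_image.simps)
  have cubic: "free_lift z_image z_cubic_lhs = U_cubic_lhs" "free_lift z_image z_cubic_rhs = U_cubic_rhs"
    by (simp_all only: z_cubic_lhs_def z_cubic_rhs_def anticommutator_def hs h y a b U_cubic_lhs_def
        U_cubic_rhs_def free_lift_gen z_image.simps)
  have central: "z_image z * z_image g = z_image g * z_image z" if "z \<in> {GH1, GH2, GC2, GC3}" for z g
  proof (cases "z \<in> {GC2, GC3} \<or> g \<in> {GC2, GC3}")
    case True
    then have "z_image z \<in> {U_C2, U_C3} \<or> z_image g \<in> {U_C2, U_C3}" by auto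
    then show ?thesis using U_C_central by metis
  next
    case False
    have "z_image z \<in> {U_H1, U_H2}" using False that by auto
    moreover have "z_image g \<in> {U_J, U_Jbar, U_K, U_H1, U_H2}" using False by (cases g) auto
    ultimately show ?thesis by (rule U_H_commute)
  qed
  assume "r \<in> relators"
  then show ?thesis
    unfolding relators_zgen_def
    using central [of GH1] central [of GH2] central [of GC2] central [of GC3] U_JK U_KJbar U_cubic
    by (elim UnE insertE) (auto simp: commutator_def anticommutator_def hs a b cubic U_K_def)
qed

text \<open>The weights of \<open>H\<^sub>1 + \<i> H\<^sub>2\<close>; the real and imaginary parts are those of \<open>H\<^sub>1\<close> and \<open>H\<^sub>2\<close>.\<close>

definition chi :: "3 \<Rightarrow> complex" where
  "chi i = (if i = 1 then 1 / 2 else if i = 2 then - 1 / 2 + \<i> / 2 else - \<i> / 2)"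

lemma chi_simps: "chi 1 = 1 / 2" "chi 2 = - 1 / 2 + \<i> / 2" "chi 3 = - \<i> / 2"
  by (simp_all add: chi_def)

interpretation Uw: almost_commuting_words "\<lambda>(i, j). U_e i j" "\<lambda>_. 1" "\<lambda>(i, j). chi i - chi j"
proof
  fix g h :: "3 \<times> 3"
  obtain i j k l where gh: "g = (i, j)" "h = (k, l)" by fastforce
  interpret filtered_words "\<lambda>(i, j). U_e i j" "\<lambda>_. 1" "\<lambda>(i, j). chi i - chi j" .
  have letter: "U_e a b \<in> lower (chi a - chi b) (1 + 1)" for a b
    unfolding lower_def by (rule complex_vector.span_base, rule image_eqI [of _ _ "[(a, b)]"]) (simp_all del: One_nat_def)
  have zero: "0 \<in> lower b n" for b n unfolding lower_def by (rule complex_vector.span_zero)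
  have "U_e i j * U_e k l - U_e k l * U_e i j = (if j = k then U_e i l else 0) + - (if l = i then U_e k j else 0)"
    using U_e_commute [of i j k l] by simp
  also have "\<dots> \<in> lower (chi i - chi j + (chi k - chi l)) (1 + 1)"
    using letter [of i l] letter [of k j] by (intro lower_add lower_uminus) (auto simp: zero algebra_simps simp del: One_nat_def)
  finally show "(case g of (i, j) \<Rightarrow> U_e i j) * (case h of (i, j) \<Rightarrow> U_e i j) -
      (case h of (i, j) \<Rightarrow> U_e i j) * (case g of (i, j) \<Rightarrow> U_e i j) \<in>
      lower ((case g of (i, j) \<Rightarrow> chi i - chi j) + (case h of (i, j) \<Rightarrow> chi i - chi j)) (1 + 1)"
    by (simp only: gh prod.case)
qed

lemma Uw_wdeg: "Uw.wdeg l = length l"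
  by (induction l) (simp_all del: One_nat_def)

lemma Uw_span: "(x :: U_sl3) \<in> complex_vector.span (range Uw.wval)"
proof -
  let ?S = "complex_vector.span (range Uw.wval)"
  have mult: "x * y \<in> ?S" if "x \<in> ?S" "y \<in> ?S" for x y
    using that(1)
  proof (induction rule: complex_vector.span_induct_alt)
    case base
    show ?case by (simp add: complex_vector.span_zero)
  next
    case (step c u x)
    then obtain v where v: "u = Uw.wval v" by auto
    have "Uw.wval v * y \<in> ?S"
      using that(2)
    proof (induction rule: complex_vector.span_induct_alt)
      case base
      show ?case by (simp add: complex_vector.span_zero)
    next
      case (step c u y)
      then obtain v' where "u = Uw.wval v'" by auto
      then have "Uw.wval v * u \<in> ?S" by (metis Uw.word_simps(3) complex_vector.span_base rangeI)
      with step.IH show ?case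
        by (simp add: distrib_left mult_scaleC_right complex_vector.span_add complex_vector.span_scale)
    qed
    with step.IH show ?case
      by (simp add: v distrib_right mult_scaleC_left complex_vector.span_add complex_vector.span_scale)
  qed
  have e: "U_e i j \<in> ?S" for i j
    by (rule complex_vector.span_base, rule image_eqI [of _ _ "[(i, j)]"]) simp_all
  have "gen A \<in> ?S" for A
    unfolding gen_sl3_expand [of A] by (intro complex_vector.span_sum complex_vector.span_scale e)
  moreover have "1 \<in> ?S"
    by (rule complex_vector.span_base, rule image_eqI [of _ _ "[]"]) simp_all
  ultimately have "prod_list (map gen w) \<in> ?S" for w
    by (induction w) (simp_all add: mult)
  then have "complex_vector.span (range (\<lambda>w. prod_list (map gen w))) \<subseteq> ?S"
    by (intro complex_vector.span_minimal) auto
  then show ?thesis using presented_words_span [of x] by blast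
qed

lemma wwt_count:
  "Uw.wwt l = (\<Sum>i\<in>UNIV. \<Sum>j\<in>UNIV. of_nat (count_list l (i, j)) * (chi i - chi j))"
proof (induction l)
  case (Cons g l)
  obtain a b where g: "g = (a, b)" by (cases g)
  have "(\<Sum>i\<in>UNIV. \<Sum>j\<in>UNIV. of_nat (count_list (g # l) (i, j)) * (chi i - chi j)) =
    (\<Sum>i\<in>UNIV. \<Sum>j\<in>UNIV. of_nat (count_list l (i, j)) * (chi i - chi j) +
      (if i = a then if j = b then chi a - chi b else 0 else 0))"
    by (intro sum.cong refl) (auto simp: g algebra_simps)
  also have "\<dots> = Uw.wwt l + (chi a - chi b)"
    by (simp add: sum.distrib Cons sum.If_cases)
  finally show ?case by (simp add: g)
qed simp

text \<open>Read (i, j) as an edge from i to j. The real and imaginary part of the weight vanish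
  exactly if each of the three vertices has as many incoming as outgoing edges; a nonempty graph of
  this kind contains a directed cycle, of length 1, 2 or 3.\<close>

lemma balanced_word:
  assumes "Uw.wwt l = 0" "l \<noteq> []"
  shows "(\<exists>i. (i, i) \<in> set l) \<or>
    (\<exists>(i, j) \<in> {(2, 1), (3, 1), (3, 2)}. (i, j) \<in> set l \<and> (j, i) \<in> set l) \<or>
    {(3, 1), (1, 2), (2, 3)} \<subseteq> set l \<or> {(3, 2), (2, 1), (1, 3)} \<subseteq> set l"
proof (rule ccontr)
  assume no: "\<not> ?thesis"
  define n where "n i j = count_list l (i, j)" for i j
  have mem: "(i, j) \<in> set l \<longleftrightarrow> n i j > 0" for i j
    by (metis n_def count_list_0_iff gr0I less_irrefl)
  have eq: "(\<Sum>i\<in>UNIV. \<Sum>j\<in>UNIV. of_nat (n i j) * (chi i - chi j)) = 0"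
    using assms(1) unfolding wwt_count n_def .
  have re: "real (n 1 2) * 2 + real (n 1 3) + real (n 3 2) = real (n 2 1) * 2 + real (n 3 1) + real (n 2 3)"
    using arg_cong [OF eq, of Re] by (simp add: sum_3 chi_simps field_simps)
  have im: "real (n 2 1) + real (n 2 3) * 2 + real (n 1 3) = real (n 1 2) + real (n 3 2) * 2 + real (n 3 1)"
    using arg_cong [OF eq, of Im] by (simp add: sum_3 chi_simps field_simps)
  have "n 1 2 * 2 + n 1 3 + n 3 2 = n 2 1 * 2 + n 3 1 + n 2 3"
    "n 2 1 + n 2 3 * 2 + n 1 3 = n 1 2 + n 3 2 * 2 + n 3 1"
    using re im by linarith+
  moreover have "n 1 1 = 0" "n 2 2 = 0" "n 3 3 = 0" "n 2 1 = 0 \<or> n 1 2 = 0" "n 3 1 = 0 \<or> n 1 3 = 0" "n 3 2 = 0 \<or> n 2 3 = 0"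
    "n 3 1 = 0 \<or> n 1 2 = 0 \<or> n 2 3 = 0" "n 3 2 = 0 \<or> n 2 1 = 0 \<or> n 1 3 = 0"
    using no by (auto simp: mem)
  ultimately have zero: "n 1 1 = 0 \<and> n 2 2 = 0 \<and> n 3 3 = 0 \<and> n 1 2 = 0 \<and> n 2 1 = 0 \<and> n 1 3 = 0 \<and> n 3 1 = 0
      \<and> n 2 3 = 0 \<and> n 3 2 = 0"
    by (elim disjE; simp)
  obtain i j l' where "l = (i, j) # l'" using assms(2) by (metis list.exhaust surj_pair)
  then have "n i j > 0" by (simp add: n_def)
  with zero show False using exhaust_3 [of i] exhaust_3 [of j] by auto
qed

text \<open>To be instantiated with the range of the map from the presented algebra; the goal is
  that R contains all words of weight zero.\<close>

locale subalgebra_of_U =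
  fixes R :: "U_sl3 set"
  assumes one: "1 \<in> R" and add: "x \<in> R \<Longrightarrow> y \<in> R \<Longrightarrow> x + y \<in> R" and mult: "x \<in> R \<Longrightarrow> y \<in> R \<Longrightarrow> x * y \<in> R"
    and scale: "x \<in> R \<Longrightarrow> c *\<^sub>C x \<in> R"
    and gens: "U_H1 \<in> R" "U_H2 \<in> R" "U_C2 \<in> R" "U_C3 \<in> R" "U_J \<in> R" "U_Jbar \<in> R" "U_K \<in> R"
begin

lemma zero: "0 \<in> R" using scale [OF one, of 0] by simp
lemma uminus: "x \<in> R \<Longrightarrow> - x \<in> R" using scale [of x "- 1"] by (simp add: scaleC_one)
lemma diff: "x \<in> R \<Longrightarrow> y \<in> R \<Longrightarrow> x - y \<in> R" using add [OF _ uminus, of x y] by simp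
lemma numeral: "numeral k \<in> R"
  unfolding numeral_eq_scaleC [of k, where 'a = U_sl3] by (rule scale [OF one])

lemma cancel: "numeral k * x \<in> R \<Longrightarrow> x \<in> R"
  using scale [of "numeral k * x" "1 / numeral k"]
  by (simp add: numeral_eq_scaleC [of k, where 'a = U_sl3] mult_scaleC_left scaleC_scaleC scaleC_one)

lemma cartan: "U_e i i \<in> R"
proof -
  have "U_y \<in> R" unfolding U_y_eq by (intro scale add mult numeral gens)
  then have 1: "U_e 1 1 \<in> R" using scale [of U_y 2] by (simp add: U_y_def scaleC_scaleC scaleC_one)
  have "U_e 2 2 = U_e 1 1 - 2 *\<^sub>C U_H1" by (simp add: U_H1_def scaleC_scaleC scaleC_one)
  then have 2: "U_e 2 2 \<in> R" using 1 gens scale diff by auto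
  have "U_e 3 3 \<in> R" unfolding U_e_trace using 1 2 diff uminus by auto
  with 1 2 show ?thesis using exhaust_3 [of i] by auto
qed

lemma quadratic: "U_e 2 1 * U_e 1 2 \<in> R" "U_e 3 1 * U_e 1 3 \<in> R" "U_e 3 2 * U_e 2 3 \<in> R"
proof -
  note cl = add diff mult numeral scale cartan gens
  have "U_e 2 1 * U_e 1 2 = U_J - (1/4) *\<^sub>C ((U_e 1 1 - U_e 2 2) * (U_e 1 1 - U_e 2 2) + 2 * (U_e 1 1 - U_e 2 2))"
    "U_e 3 1 * U_e 1 3 = U_Jbar - (1/4) *\<^sub>C ((U_e 1 1 - U_e 3 3) * (U_e 1 1 - U_e 3 3) + 2 * (U_e 1 1 - U_e 3 3))"
    by (simp_all add: U_J_def U_Jbar_def power2_eq_square)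
  then show uv: "U_e 2 1 * U_e 1 2 \<in> R" "U_e 3 1 * U_e 1 3 \<in> R"
    by (metis cl)+
  have "2 * (U_e 3 2 * U_e 2 3) = U_C2 - 2 * (U_e 2 1 * U_e 1 2 + U_e 3 1 * U_e 1 3)
    - 2 * (2 * U_e 1 1 + U_e 1 1 * U_e 1 1 + U_e 1 1 * U_e 2 2 + U_e 2 2 + U_e 2 2 * U_e 2 2)"
    unfolding U_C2_eq by (simp add: algebra_simps)
  also have "\<dots> \<in> R" by (intro cl uv)
  finally show "U_e 3 2 * U_e 2 3 \<in> R" by (rule cancel)
qed

text \<open>C3 yields the sum of the two products modulo elements already found, and K is their
  difference.\<close>

lemma cubic: "U_e 3 1 * U_e 1 2 * U_e 2 3 \<in> R" "U_e 3 2 * U_e 2 1 * U_e 1 3 \<in> R"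
proof -
  note cl = add diff mult [of "U_e i i" for i] mult [of "_ + _"] mult [of "numeral k" for k] numeral scale cartan gens quadratic
  let ?p = "U_e 3 1 * U_e 1 2 * U_e 2 3" and ?q = "U_e 3 2 * U_e 2 1 * U_e 1 3"
  have "3 * (?p + ?q) = U_C3 - 3 * ((U_e 1 1 + U_e 2 2 + 2) * (U_e 2 1 * U_e 1 2)
      - U_e 2 2 * (U_e 3 1 * U_e 1 3) - U_e 1 1 * (U_e 3 2 * U_e 2 3))
    - 3 * (U_e 1 1 * (2 + U_e 1 1 - U_e 1 1 * U_e 2 2 - U_e 2 2 - U_e 2 2 * U_e 2 2))"
    unfolding U_C3_eq by (simp add: algebra_simps)
  also have "\<dots> \<in> R" by (intro cl)
  finally have sum: "?p + ?q \<in> R" by (rule cancel)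
  have "2 * ?p = (?p + ?q) + U_K" "2 * ?q = (?p + ?q) - U_K"
    by (simp_all add: U_K_eq mult_2)
  then have "2 * ?p \<in> R" "2 * ?q \<in> R" using sum gens add diff by metis+
  then show "?p \<in> R" "?q \<in> R" using cancel by blast+
qed

lemma lower_R:
  assumes "\<And>m. Uw.wwt m = 0 \<Longrightarrow> length m < n \<Longrightarrow> Uw.wval m \<in> R"
  shows "Uw.lower 0 n \<subseteq> R"
proof -
  show ?thesis
    unfolding Uw.lower_def
  proof (rule complex_vector.span_minimal)
    show "complex_vector.subspace R"
      by (rule complex_vector.subspaceI) (rule zero add scale; assumption)+
  qed (use assms Uw_wdeg in auto)
qed

text \<open>A cycle inside the word is moved to the front. The rest again has weight zero and is
  shorter, and so are the corrections from reordering.\<close>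

lemma balanced_word_R: "Uw.wwt l = 0 \<Longrightarrow> Uw.wval l \<in> R"
proof (induction l rule: length_induct)
  case (1 l)
  have low: "Uw.lower 0 (length l) \<subseteq> R" using 1 by (intro lower_R) blast
  have front: "Uw.wval l \<in> R" if "mset l = mset (u @ m)" "Uw.wwt u = 0" "Uw.wval u \<in> R" "u \<noteq> []" for u m
  proof -
    have "length l = length (u @ m)" using that(1) mset_eq_length by blast
    then have "length m < length l" using that(4) by simp
    have "Uw.wwt l = Uw.wwt (u @ m)" using that(1) by (rule Uw.word_mset_cong)
    then have "Uw.wwt m = 0" using 1(2) that(2) by simp
    with 1(1) \<open>length m < length l\<close> have "Uw.wval m \<in> R" by blast
    then have "Uw.wval (u @ m) \<in> R" using that(3) mult by simp
    moreover have "Uw.wval l - Uw.wval (u @ m) \<in> R"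
      using Uw.word_permute [OF that(1)] low unfolding 1(2) Uw_wdeg by blast
    ultimately show ?thesis using add by fastforce
  qed
  have complement: "\<exists>m. mset l = mset (u @ m)" if "mset u \<subseteq># mset l" for u
  proof -
    obtain m where "mset m = mset l - mset u" using ex_mset by blast
    then have "mset l = mset (u @ m)" using that by simp
    then show ?thesis ..
  qed
  \<comment> \<open>A word \<open>u\<close> without repetitions whose letters all occur in
    \<open>l\<close> is a sub-multiset of \<open>l\<close>, so it can be moved to the front.\<close>
  have frontI: "Uw.wval l \<in> R" if "distinct u" "set u \<subseteq> set l" "Uw.wwt u = 0" "Uw.wval u \<in> R" "u \<noteq> []" for u
  proof -
    have "mset u \<subseteq># mset l"
      using that(1,2) by (auto simp: subseteq_mset_def distinct_count_atmost_1 Suc_le_eq)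
    with complement front that show ?thesis by blast
  qed
  show ?case
  proof (cases "l = []")
    case True
    then show ?thesis by (simp add: one)
  next
    case False
    have "Uw.wval l \<in> R" if "(i, i) \<in> set l" for i
      using that cartan [of i] by (intro frontI [of "[(i, i)]"]) simp_all
    moreover have "Uw.wval l \<in> R" if "(i, j) \<in> {(2, 1), (3, 1), (3, 2)}" "(i, j) \<in> set l" "(j, i) \<in> set l" for i j
      using that quadratic by (intro frontI [of "[(i, j), (j, i)]"]) auto
    moreover have "Uw.wval l \<in> R" if "{(3, 1), (1, 2), (2, 3)} \<subseteq> set l"
      using that cubic by (intro frontI [of "[(3, 1), (1, 2), (2, 3)]"]) (simp_all add: mult.assoc)
    moreover have "Uw.wval l \<in> R" if "{(3, 2), (2, 1), (1, 3)} \<subseteq> set l"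
      using that cubic by (intro frontI [of "[(3, 2), (2, 1), (1, 3)]"]) (simp_all add: mult.assoc)
    ultimately show ?thesis
      using balanced_word [OF 1(2) False] by auto
  qed
qed

end

section \<open>Weights of words and the projection to weight zero\<close>

lemma cartan_weight:
  "(U_H1 + \<i> *\<^sub>C U_H2) * U_e i j = U_e i j * (U_H1 + \<i> *\<^sub>C U_H2) + (chi i - chi j) *\<^sub>C U_e i j"
proof -
  have ad: "U_e a a * U_e i j = U_e i j * U_e a a + ((if a = i then 1 else 0) - (if j = a then 1 else 0)) *\<^sub>C U_e i j" for a
    using U_e_commute [of a a i j] by (auto simp: scaleC_one complex_vector.scale_minus_left)
  let ?X = "U_H1 + \<i> *\<^sub>C U_H2"
  have X: "?X = (1/2) *\<^sub>C U_e 1 1 + (- 1/2 + \<i>/2) *\<^sub>C U_e 2 2 + (- \<i>/2) *\<^sub>C U_e 3 3"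
    by (simp add: U_H1_def U_H2_def complex_vector.scale_right_diff_distrib scaleC_scaleC scaleC_add_left
        complex_vector.scale_minus_left complex_vector.scale_left_diff_distrib)
  have "?X * U_e i j = U_e i j * ?X + ((1/2) *\<^sub>C (((if 1 = i then 1 else 0) - (if j = 1 then 1 else 0)) *\<^sub>C U_e i j)
     + (- 1/2 + \<i>/2) *\<^sub>C (((if 2 = i then 1 else 0) - (if j = 2 then 1 else 0)) *\<^sub>C U_e i j)
     + (- \<i>/2) *\<^sub>C (((if 3 = i then 1 else 0) - (if j = 3 then 1 else 0)) *\<^sub>C U_e i j))"
    unfolding X distrib_left distrib_right mult_scaleC_left mult_scaleC_right ad scaleC_add_right
    by (simp only: add_ac)
  also have "(1/2) *\<^sub>C (((if 1 = i then 1 else 0) - (if j = 1 then 1 else 0)) *\<^sub>C U_e i j)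
     + (- 1/2 + \<i>/2) *\<^sub>C (((if 2 = i then 1 else 0) - (if j = 2 then 1 else 0)) *\<^sub>C U_e i j)
     + (- \<i>/2) *\<^sub>C (((if 3 = i then 1 else 0) - (if j = 3 then 1 else 0)) *\<^sub>C U_e i j)
     = (chi i - chi j) *\<^sub>C U_e i j"
    unfolding scaleC_scaleC scaleC_add_left [symmetric]
    by (rule arg_cong [of _ _ "\<lambda>c. c *\<^sub>C U_e i j"])
      (use exhaust_3 [of i] exhaust_3 [of j] in \<open>elim disjE; simp add: chi_def\<close>)
  finally show ?thesis .
qed

lemma word_weight:
  "(U_H1 + \<i> *\<^sub>C U_H2) * Uw.wval l = Uw.wval l * (U_H1 + \<i> *\<^sub>C U_H2) + Uw.wwt l *\<^sub>C Uw.wval l"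
proof (induction l)
  case (Cons g l)
  let ?X = "U_H1 + \<i> *\<^sub>C U_H2"
  obtain i j where g: "g = (i, j)" by (cases g)
  have "?X * Uw.wval (g # l) = (?X * U_e i j) * Uw.wval l" by (simp add: g mult.assoc)
  also have "\<dots> = U_e i j * (?X * Uw.wval l) + (chi i - chi j) *\<^sub>C (U_e i j * Uw.wval l)"
    unfolding cartan_weight by (simp only: distrib_right mult.assoc mult_scaleC_left)
  also have "\<dots> = Uw.wval (g # l) * ?X + Uw.wwt (g # l) *\<^sub>C Uw.wval (g # l)"
    unfolding Cons by (simp add: g distrib_left mult.assoc mult_scaleC_right scaleC_add_left del: mult_scaleC_left)
  finally show ?case .
qed simp

text \<open>Words span but are dependent, so the terms of nonzero weight in an expression for x
  cannot be discarded by comparing coefficients.\<close>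

lemma centralizer_balanced:
  assumes "x \<in> cartan_centralizer"
  shows "x \<in> complex_vector.span (Uw.wval ` {l. Uw.wwt l = 0})"
proof -
  let ?X = "U_H1 + \<i> *\<^sub>C U_H2"
  let ?S = "complex_vector.span (Uw.wval ` {l. Uw.wwt l = 0})"
  have Xx: "?X * x = x * ?X"
    using assms by (simp add: cartan_centralizer_def commutator_def distrib_left distrib_right
        mult_scaleC_left mult_scaleC_right)
  obtain t r where t: "finite t" "t \<subseteq> range Uw.wval" and x: "x = (\<Sum>v\<in>t. r v *\<^sub>C v)"
    using Uw_span [of x] unfolding complex_vector.span_explicit by blast
  have "\<forall>v\<in>t. \<exists>l. v = Uw.wval l" using t(2) by auto
  then obtain w where w: "\<And>v. v \<in> t \<Longrightarrow> v = Uw.wval (w v)" by metis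
  have ad: "?X * v - v * ?X = Uw.wwt (w v) *\<^sub>C v" if "v \<in> t" for v
    using word_weight [of "w v"] w [OF that] by simp
  \<comment> \<open>A polynomial in \<open>ad X\<close> acts on \<open>x\<close> as its constant term; choosing one that vanishes at the
    nonzero weights projects \<open>x\<close> to weight zero.\<close>
  have poly: "(\<Sum>v\<in>t. (r v * poly P (Uw.wwt (w v))) *\<^sub>C v) = poly P 0 *\<^sub>C x" for P
  proof (induction P)
    case (pCons c Q)
    let ?q = "\<lambda>v. r v * poly Q (Uw.wwt (w v))"
    have "(\<Sum>v\<in>t. ?q v *\<^sub>C (Uw.wwt (w v) *\<^sub>C v)) = (\<Sum>v\<in>t. ?q v *\<^sub>C (?X * v - v * ?X))"
      by (intro sum.cong) (simp_all add: ad)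
    also have "\<dots> = ?X * (\<Sum>v\<in>t. ?q v *\<^sub>C v) - (\<Sum>v\<in>t. ?q v *\<^sub>C v) * ?X"
      by (simp only: sum_distrib_left sum_distrib_right mult_scaleC_left mult_scaleC_right
          complex_vector.scale_right_diff_distrib sum_subtractf)
    also have "\<dots> = 0"
      unfolding pCons by (simp only: mult_scaleC_left mult_scaleC_right Xx diff_self)
    finally have *: "(\<Sum>v\<in>t. ?q v *\<^sub>C (Uw.wwt (w v) *\<^sub>C v)) = 0" .
    have "(\<Sum>v\<in>t. (r v * poly (pCons c Q) (Uw.wwt (w v))) *\<^sub>C v) =
        c *\<^sub>C (\<Sum>v\<in>t. r v *\<^sub>C v) + (\<Sum>v\<in>t. ?q v *\<^sub>C (Uw.wwt (w v) *\<^sub>C v))"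
      by (simp add: complex_vector.scale_sum_right scaleC_scaleC scaleC_add_left distrib_left sum.distrib mult_ac)
    then show ?case by (simp only: * x [symmetric]) simp
  qed simp
  define M where "M = (\<lambda>v. Uw.wwt (w v)) ` t - {0}"
  define P where "P = (\<Prod>\<mu>\<in>M. [:- \<mu>, 1:])"
  have "finite M" using t(1) by (simp add: M_def)
  then have "poly P 0 \<noteq> 0" by (auto simp: P_def poly_prod M_def)
  have "(\<Sum>v\<in>t. (r v * poly P (Uw.wwt (w v))) *\<^sub>C v) \<in> ?S"
  proof (rule complex_vector.span_sum)
    fix v assume v: "v \<in> t"
    show "(r v * poly P (Uw.wwt (w v))) *\<^sub>C v \<in> ?S"
    proof (cases "Uw.wwt (w v) = 0")
      case True
      then have "v \<in> ?S" using w [OF v] by (intro complex_vector.span_base) auto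
      then show ?thesis by (rule complex_vector.span_scale)
    next
      case False
      then have "poly P (Uw.wwt (w v)) = 0"
        using \<open>finite M\<close> v by (auto simp: P_def poly_prod M_def)
      then show ?thesis by (simp add: complex_vector.span_zero)
    qed
  qed
  then have "(1 / poly P 0) *\<^sub>C (poly P 0 *\<^sub>C x) \<in> ?S"
    unfolding poly by (rule complex_vector.span_scale)
  then show ?thesis using \<open>poly P 0 \<noteq> 0\<close> by (simp add: scaleC_scaleC scaleC_one)
qed

theorem corollary8p2:
  shows "(\<exists>\<phi> :: Z_algebra \<Rightarrow> U_sl3.
      complex_algebra_hom \<phi> \<and> bij_betw \<phi> UNIV cartan_centralizer \<and>
      \<phi> (gen GJ) = U_J \<and> \<phi> (gen GJbar) = U_Jbar \<and> \<phi> (gen GK) = U_K \<and>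
      \<phi> (gen GH1) = U_H1 \<and> \<phi> (gen GH2) = U_H2 \<and>
      \<phi> (gen GC2) = U_C2 \<and> \<phi> (gen GC3) = U_C3)
    \<and> inj_on basis_monomial basis_exponents
    \<and> complex_vector.independent (basis_monomial ` basis_exponents)
    \<and> complex_vector.span (basis_monomial ` basis_exponents) = cartan_centralizer"
proof -
  obtain \<phi> where hom: "complex_algebra_hom \<phi>" and \<phi>: "\<And>g. \<phi> (gen g) = z_image g"
    using presented_lift_ex [of z_image] z_image_relators by blast
  note hs = complex_algebra_hom_simps [OF hom]
  interpret subalgebra_of_U "range \<phi>"
  proof
    show "1 \<in> range \<phi>" using hs(4) by (metis rangeI)
    show "x + y \<in> range \<phi>" "x * y \<in> range \<phi>" if "x \<in> range \<phi>" "y \<in> range \<phi>" for x y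
      using that hs(1,3) by (metis (no_types, lifting) imageE rangeI)+
    show "c *\<^sub>C x \<in> range \<phi>" if "x \<in> range \<phi>" for c x
      using that hs(2) by (metis (no_types, lifting) imageE rangeI)
    show "U_H1 \<in> range \<phi>" "U_H2 \<in> range \<phi>" "U_C2 \<in> range \<phi>" "U_C3 \<in> range \<phi>"
      "U_J \<in> range \<phi>" "U_Jbar \<in> range \<phi>" "U_K \<in> range \<phi>"
      using \<phi> z_image.simps by (metis rangeI)+
  qed
  have monomial: "\<phi> (z_monomial e) = basis_monomial e" for e
    by (cases e) (simp add: hs \<phi>)
  have "cartan_centralizer \<subseteq> range \<phi>"
  proof
    fix x assume "x \<in> cartan_centralizer"
    then have "x \<in> complex_vector.span (Uw.wval ` {l. Uw.wwt l = 0})"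
      by (rule centralizer_balanced)
    moreover have "complex_vector.span (Uw.wval ` {l. Uw.wwt l = 0}) \<subseteq> range \<phi>"
    proof (rule complex_vector.span_minimal)
      show "complex_vector.subspace (range \<phi>)"
        by (rule complex_vector.subspaceI) (rule zero add scale; assumption)+
    qed (use balanced_word_R in auto)
    ultimately show "x \<in> range \<phi>" by blast
  qed
  \<comment> \<open>The generators named H1 and H2 are already central in the presented
    algebra.\<close>
  moreover have "range \<phi> \<subseteq> cartan_centralizer"
  proof
    fix u assume "u \<in> range \<phi>"
    then obtain x where u: "u = \<phi> x" by blast
    have "gen g * x = x * gen g" if "g \<in> {GH1, GH2}" for g
      using z_central [of g x] that by blast
    then have "z_image g * u = u * z_image g" if "g \<in> {GH1, GH2}" for g
      unfolding u \<phi> [symmetric] hs(3) [symmetric] using that by simp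
    from this [of GH1] this [of GH2] show "u \<in> cartan_centralizer"
      by (simp add: cartan_centralizer_def commutator_def)
  qed
  ultimately have range: "range \<phi> = cartan_centralizer" by blast
  \<comment> \<open>An element of the kernel is a combination of monomials of the presented algebra,
    and the images of these are independent; so all its coefficients vanish.\<close>
  have "inj \<phi>"
  proof (rule injI)
    fix x y assume "\<phi> x = \<phi> y"
    then have "\<phi> (x - y) = 0" by (simp add: hs)
    obtain t r where t: "finite t" "t \<subseteq> z_monomial ` basis_exponents" and xy: "x - y = (\<Sum>v\<in>t. r v *\<^sub>C v)"
      using z_span [of "x - y"] unfolding complex_vector.span_explicit by blast
    obtain F where F: "F \<subseteq> basis_exponents" "finite F" "t = z_monomial ` F"
      using t by (meson finite_subset_image)
    have inj: "inj_on z_monomial F"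
      using basis_monomial_inj F(1) monomial by (metis inj_on_def subsetD)
    have xy: "x - y = (\<Sum>e\<in>F. r (z_monomial e) *\<^sub>C z_monomial e)"
      unfolding xy F(3) by (simp add: sum.reindex [OF inj])
    then have "(\<Sum>e\<in>F. r (z_monomial e) *\<^sub>C basis_monomial e) = 0"
      using \<open>\<phi> (x - y) = 0\<close> by (simp add: complex_algebra_hom_sum [OF hom] hs monomial)
    then have "r (z_monomial e) = 0" if "e \<in> F" for e
      using basis_monomial_relation_trivial [OF F(2,1), of "\<lambda>e. r (z_monomial e)" e] that by simp
    with xy show "x = y" by simp
  qed
  with range have bij: "bij_betw \<phi> UNIV cartan_centralizer"
    by (simp add: bij_betw_def)
  have "complex_vector.span (basis_monomial ` basis_exponents) \<subseteq> range \<phi>"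
  proof (rule complex_vector.span_minimal)
    show "complex_vector.subspace (range \<phi>)"
      by (rule complex_vector.subspaceI) (rule zero add scale; assumption)+
  qed (use monomial in \<open>metis image_subsetI rangeI\<close>)
  moreover have "\<phi> x \<in> complex_vector.span (basis_monomial ` basis_exponents)" for x
    using z_span [of x]
  proof (induction rule: complex_vector.span_induct_alt)
    case base
    show ?case by (simp add: hs complex_vector.span_zero)
  next
    case (step c v x)
    then obtain e where "e \<in> basis_exponents" "v = z_monomial e" by blast
    then have "\<phi> v \<in> complex_vector.span (basis_monomial ` basis_exponents)"
      by (simp add: monomial complex_vector.span_base)
    with step.IH show ?case
      by (simp add: hs complex_vector.span_add complex_vector.span_scale)
  qed
  ultimately have "complex_vector.span (basis_monomial ` basis_exponents) = cartan_centralizer"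
    unfolding range [symmetric] by blast
  with hom bij \<phi> show ?thesis
    using basis_monomial_inj basis_monomial_independent by auto
qed

end
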